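(* Let $1\le p_1,p_2,q\le\infty$ and $w_*\in\mathcal{W}(\mathbb{R})$. Define $p$ by $\frac1p:=\frac1{p_1}+\frac1{p_2}$ and suppose $p\ge 1$. Assume that $f\in\mathcal{M}^{w_*}_{p_1,q}(\mathbb{R}^n)$ and $g\in\mathcal{M}^{w_*}_{p_2,q}(\mathbb{R}^n)$. Then $f\cdot g\in\mathcal{M}^{w_*}_{p,q}(\mathbb{R}^n)$ and \[ \|f\,g\|_{\mathcal{M}^{w_*}_{p,q}}\le C\,\|f\|_{\mathcal{M}^{w_*}_{p_1,q}}\,\|g\|_{\mathcal{M}^{w_*}_{p_2,q}} \] with a positive constant $C$ which only depends on the choice of the frequency-uniform decomposition $(\sigma_k)_k$, the dimension $n$, the parameter $q$ and the weight $w_*$. In particular, for all $1\le p,q\le\infty$ the modulation space $\mathcal{M}^{w_*}_{p,q}(\mathbb{R}^n)$ is an algebra under pointwise multiplication.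
   Context: Fourier transform: $\mathcal{F}f(\xi)=(2\pi)^{-n/2}\int_{\mathbb{R}^n}f(x)e^{-\mathrm{i}x\cdot\xi}\,dx$. Frequency-uniform decomposition: fix $\rho\in C_0^\infty(\mathbb{R}^n)$ with values in $[0,1]$, supported in $[-1,1]^n$, with $\rho(\xi)=1$ if $|\xi_i|\le\frac12$ for all $i$. Put $\rho_k(\xi)=\rho(\xi-k)$, $\sigma_k=\rho_k\big(\sum_{m\in\mathbb{Z}^n}\rho_m\big)^{-1}$ and $\Box_kf=\mathcal{F}^{-1}(\sigma_k\mathcal{F}f)$ for $k\in\mathbb{Z}^n$. Modulation space: for $1\le p,q\le\infty$ and a monotonically increasing weight function $w_*$ on $[0,\infty)$ with $w_*(0)\ge0$, $\mathcal{M}^{w_*}_{p,q}(\mathbb{R}^n)$ is the set of all $f\in L^p(\mathbb{R}^n)$ with $\|f\|_{\mathcal{M}^{w_*}_{p,q}}:=\big(\sum_{k\in\mathbb{Z}^n}e^{q\,w_*(|k|)}\|\Box_kf\|_{L^p}^q\big)^{1/q}<\infty$ (supremum over $k$ if $q=\infty$). Weights: a measurable function $h:(0,\infty)\to(0,\infty)$ is regularly varying of index $\alpha\in\mathbb{R}$ if $\lim_{t\to\infty}h(tx)/h(t)=x^\alpha$ for all $x>0$. The set $\mathcal{W}(\mathbb{R})$ consists of all functions $w_*=w_*(x)$, $x\in[0,\infty)$, such that: (A1) $w_*\in C^\infty(0,\infty)$ is regularly varying with index $\alpha$, $0\le\alpha<1$; (A2) $w_*\ge1$; (A3) $w_*$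 is strictly increasing; (A4) $\lim_{t\to\infty}(w_*(t)-M\log t)=\infty$ for all $M$; (A5) $w_*'(0)=0$; (A6) $w_*''$ has finitely many changes of sign, with a number $\tau$ such that $w_*''(x)<0$ for all $x>\tau$. *)

theory Defs
  imports "HOL-Analysis.Analysis" "HOL-Probability.Essential_Supremum"
begin

section \<open>Smooth functions and the Schwartz space\<close>

definition partial_deriv ::
    "'n \<Rightarrow> (real ^ 'n \<Rightarrow> 'b::real_normed_vector) \<Rightarrow> real ^ 'n \<Rightarrow> 'b" where
  "partial_deriv i f = (\<lambda>x. frechet_derivative f (at x) (axis i 1))"

primrec iter_partial_deriv ::
    "'n list \<Rightarrow> (real ^ 'n \<Rightarrow> 'b::real_normed_vector) \<Rightarrow> real ^ 'n \<Rightarrow> 'b" where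
  "iter_partial_deriv [] f = f"
| "iter_partial_deriv (i # is) f = partial_deriv i (iter_partial_deriv is f)"

text \<open>A function is of class \<open>C\<^sup>\<infinity>\<close> iff all its iterated partial derivatives exist and are
  (Frechet) differentiable; their continuity is then automatic.\<close>

definition smooth :: "(real ^ 'n \<Rightarrow> 'b::real_normed_vector) \<Rightarrow> bool" where
  "smooth f \<longleftrightarrow> (\<forall>is. iter_partial_deriv is f differentiable_on UNIV)"

definition schwartz :: "(real ^ 'n \<Rightarrow> complex) \<Rightarrow> bool" where
  "schwartz \<phi> \<longleftrightarrow> smooth \<phi> \<and>
     (\<forall>N is. bounded (range (\<lambda>x. norm x ^ N *\<^sub>R iter_partial_deriv is \<phi> x)))"


section \<open>The Fourier transform on functions and on tempered distributions\<close>

definition fourier :: "(real ^ 'n \<Rightarrow> complex) \<Rightarrow> real ^ 'n \<Rightarrow> complex" where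
  "fourier f \<xi> = of_real ((2 * pi) powr (- real CARD('n) / 2)) *
     (LINT x|lebesgue. f x * exp (- (\<i> * of_real (x \<bullet> \<xi>))))"

definition inv_fourier :: "(real ^ 'n \<Rightarrow> complex) \<Rightarrow> real ^ 'n \<Rightarrow> complex" where
  "inv_fourier f x = of_real ((2 * pi) powr (- real CARD('n) / 2)) *
     (LINT \<xi>|lebesgue. f \<xi> * exp (\<i> * of_real (x \<bullet> \<xi>)))"

text \<open>For \<open>f \<in> L\<^sup>p\<close> with \<open>p > 2\<close> the Fourier transform exists only as a tempered distribution.
  Tempered distributions are represented by functionals of which only the values on Schwartz
  functions matter; the operations on them are the usual ones, defined by duality.\<close>

type_synonym 'n dist = "(real ^ 'n \<Rightarrow> complex) \<Rightarrow> complex"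

definition regular_dist :: "(real ^ 'n \<Rightarrow> complex) \<Rightarrow> 'n dist" where
  "regular_dist f \<phi> = (LINT x|lebesgue. f x * \<phi> x)"

definition fourier_dist :: "('n::finite) dist \<Rightarrow> 'n dist" where
  "fourier_dist T \<phi> = T (fourier \<phi>)"

definition inv_fourier_dist :: "('n::finite) dist \<Rightarrow> 'n dist" where
  "inv_fourier_dist T \<phi> = T (inv_fourier \<phi>)"

definition mult_dist :: "(real ^ 'n \<Rightarrow> real) \<Rightarrow> ('n::finite) dist \<Rightarrow> 'n dist" where
  "mult_dist s T \<phi> = T (\<lambda>\<xi>. of_real (s \<xi>) * \<phi> \<xi>)"


section \<open>Lebesgue norms\<close>

text \<open>Real powers on the extended nonnegative reals, meant for exponents \<open>a > 0\<close>.\<close>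

definition ennreal_powr :: "ennreal \<Rightarrow> real \<Rightarrow> ennreal" where
  "ennreal_powr x a = (if x = \<infinity> then \<infinity> else ennreal (enn2real x powr a))"

definition Lp_norm :: "ennreal \<Rightarrow> (real ^ 'n \<Rightarrow> complex) \<Rightarrow> ennreal" where
  "Lp_norm p f =
     (if p = \<infinity> then esssup lebesgue (\<lambda>x. ennreal (norm (f x)))
      else ennreal_powr (\<integral>\<^sup>+x. ennreal (norm (f x) powr enn2real p) \<partial>lebesgue) (1 / enn2real p))"

definition Lp_space :: "ennreal \<Rightarrow> (real ^ 'n \<Rightarrow> complex) set" where
  "Lp_space p = {f. f \<in> borel_measurable lebesgue \<and> Lp_norm p f < \<infinity>}"

text \<open>The \<open>L\<^sup>p\<close> norm of a distribution is that of the \<open>L\<^sup>p\<close> function (unique up to null sets)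
  which represents it, and \<open>\<infinity>\<close> (the infimum of the empty set) if there is no such function.\<close>

definition dist_Lp_norm :: "ennreal \<Rightarrow> ('n::finite) dist \<Rightarrow> ennreal" where
  "dist_Lp_norm p T =
     (INF h\<in>{h \<in> Lp_space p. \<forall>\<phi>. schwartz \<phi> \<longrightarrow> T \<phi> = regular_dist h \<phi>}. Lp_norm p h)"


section \<open>Frequency-uniform decomposition and modulation spaces\<close>

definition lattice_point :: "int ^ 'n \<Rightarrow> real ^ 'n" where
  "lattice_point k = (\<chi> i. real_of_int (k $ i))"

text \<open>The family \<open>s\<close> plays the role of \<open>(\<sigma>\<^sub>k)\<^sub>k\<close>. For every \<open>\<xi>\<close> only finitely many terms of
  the sum in the denominator are nonzero.\<close>

definition freq_uniform_decomposition :: "(int ^ 'n \<Rightarrow> real ^ 'n \<Rightarrow> real) \<Rightarrow> bool" where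
  "freq_uniform_decomposition s \<longleftrightarrow>
     (\<exists>\<rho> :: real ^ 'n \<Rightarrow> real.
        smooth \<rho> \<and>
        (\<forall>\<xi>. 0 \<le> \<rho> \<xi> \<and> \<rho> \<xi> \<le> 1) \<and>
        (\<forall>\<xi>. \<rho> \<xi> \<noteq> 0 \<longrightarrow> (\<forall>i. \<bar>\<xi> $ i\<bar> \<le> 1)) \<and>
        (\<forall>\<xi>. (\<forall>i. \<bar>\<xi> $ i\<bar> \<le> 1 / 2) \<longrightarrow> \<rho> \<xi> = 1) \<and>
        (\<forall>k \<xi>. s k \<xi> = \<rho> (\<xi> - lattice_point k) *
           inverse (\<Sum>\<^sub>\<infinity>m. \<rho> (\<xi> - lattice_point m))))"

definition box_op :: "(int ^ 'n \<Rightarrow> real ^ 'n \<Rightarrow> real) \<Rightarrow> int ^ 'n \<Rightarrow>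
    (real ^ 'n \<Rightarrow> complex) \<Rightarrow> 'n dist" where
  "box_op s k f = inv_fourier_dist (mult_dist (s k) (fourier_dist (regular_dist f)))"

definition modulation_norm :: "(int ^ 'n \<Rightarrow> real ^ 'n \<Rightarrow> real) \<Rightarrow> (real \<Rightarrow> real) \<Rightarrow>
    ennreal \<Rightarrow> ennreal \<Rightarrow> (real ^ 'n \<Rightarrow> complex) \<Rightarrow> ennreal" where
  "modulation_norm s w p q f =
     (if q = \<infinity> then
        (SUP k. ennreal (exp (w (norm (lattice_point k)))) * dist_Lp_norm p (box_op s k f))
      else
        ennreal_powr
          (\<Sum>\<^sub>\<infinity>k. ennreal (exp (enn2real q * w (norm (lattice_point k)))) *
                 ennreal_powr (dist_Lp_norm p (box_op s k f)) (enn2real q))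
          (1 / enn2real q))"

definition modulation_space :: "(int ^ 'n \<Rightarrow> real ^ 'n \<Rightarrow> real) \<Rightarrow> (real \<Rightarrow> real) \<Rightarrow>
    ennreal \<Rightarrow> ennreal \<Rightarrow> (real ^ 'n \<Rightarrow> complex) set" where
  "modulation_space s w p q = {f \<in> Lp_space p. modulation_norm s w p q f < \<infinity>}"

text \<open>A linear space of functions, closed under pointwise products, whose multiplication is
  bounded with respect to the given norm.\<close>

definition pointwise_algebra ::
    "(real ^ 'n \<Rightarrow> complex) set \<Rightarrow> ((real ^ 'n \<Rightarrow> complex) \<Rightarrow> ennreal) \<Rightarrow> bool" where
  "pointwise_algebra A N \<longleftrightarrow>
     (\<lambda>x. 0) \<in> A \<and>
     (\<forall>f\<in>A. \<forall>g\<in>A. (\<lambda>x. f x + g x) \<in> A) \<and>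
     (\<forall>c. \<forall>f\<in>A. (\<lambda>x. c * f x) \<in> A) \<and>
     (\<forall>f\<in>A. \<forall>g\<in>A. (\<lambda>x. f x * g x) \<in> A) \<and>
     (\<exists>C>0. \<forall>f\<in>A. \<forall>g\<in>A. N (\<lambda>x. f x * g x) \<le> ennreal C * N f * N g)"


section \<open>The class of weights\<close>

text \<open>Weights are functions on \<open>[0,\<infinity>)\<close>; the values of the representing function on the
  negative reals are irrelevant.\<close>

definition regularly_varying :: "(real \<Rightarrow> real) \<Rightarrow> real \<Rightarrow> bool" where
  "regularly_varying h \<alpha> \<longleftrightarrow>
     h \<in> borel_measurable (restrict_space borel {0<..}) \<and>
     (\<forall>t>0. h t > 0) \<and>
     (\<forall>x>0. ((\<lambda>t. h (t * x) / h t) \<longlongrightarrow> x powr \<alpha>) at_top)"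

definition finitely_many_sign_changes :: "(real \<Rightarrow> real) \<Rightarrow> bool" where
  "finitely_many_sign_changes h \<longleftrightarrow>
     (\<exists>N. \<forall>xs. sorted_wrt (<) xs \<and> (\<forall>x\<in>set xs. 0 < x) \<and>
        (\<forall>i. Suc i < length xs \<longrightarrow> h (xs ! i) * h (xs ! Suc i) < 0) \<longrightarrow> length xs \<le> N)"

definition weight_class :: "(real \<Rightarrow> real) set" where
  "weight_class = {w.
     (\<forall>m. \<forall>x>0. (deriv ^^ m) w differentiable (at x)) \<and>
     (\<exists>\<alpha>. 0 \<le> \<alpha> \<and> \<alpha> < 1 \<and> regularly_varying w \<alpha>) \<and>
     (\<forall>x\<ge>0. 1 \<le> w x) \<and>
     strict_mono_on {0..} w \<and>
     (\<forall>M. filterlim (\<lambda>t. w t - M * ln t) at_top at_top) \<and>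
     (w has_real_derivative 0) (at 0 within {0..}) \<and>
     finitely_many_sign_changes ((deriv ^^ 2) w) \<and>
     (\<exists>\<tau>. \<forall>x>0. x > \<tau> \<longrightarrow> (deriv ^^ 2) w x < 0)}"

end

theory Submission
  imports Defs "HOL-Probability.Probability"
begin

text \<open>Each \<open>\<box>\<^sub>k f\<close> is the convolution of \<open>f\<close> with \<open>e\<^sup>i\<^sup>k\<^sup>x K(x)\<close>, where \<open>K\<close> is a fixed integrable and
  bounded kernel. Since the weight beats every power, a finite modulation norm makes
  \<open>\<Sum>\<^sub>k \<box>\<^sub>k f\<close> converge absolutely in \<open>L\<^sup>p\<close>, and its sum is \<open>f\<close> because both sides have the same
  pairing with all band-limited functions. Hence \<open>\<box>\<^sub>j (f g)\<close> is the sum of the terms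
  \<open>\<box>\<^sub>j (\<box>\<^sub>k f \<box>\<^sub>l g)\<close>, which vanish unless \<open>j - k - l\<close> is bounded, and the inequalities of
  Young and Hoelder reduce the estimate to sequences. There, subexponentiality of the weight in the form
  \<open>w (x + y + R) \<le> w x + c w y + C\<close> for \<open>y \<le> x\<close>, with \<open>c < 1\<close>, lets the larger frequency carry the full weight
  and leaves the summable factor \<open>e\<^sup>-\<^sup>(\<^sup>1\<^sup>-\<^sup>c\<^sup>)\<^sup>w\<close> at the smaller one, so that Young's inequality
  \<open>\<ell>\<^sup>q * \<ell>\<^sup>1 \<subseteq> \<ell>\<^sup>q\<close> applies.\<close>

section \<open>Lebesgue norms of extended nonnegative functions\<close>

text \<open>For general \<open>p\<close> the Fourier transform of an \<open>L^p\<close> function is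
  not a function. No transform of \<open>f\<close> is therefore ever taken: each frequency statement
  is a Fubini identity (\<open>conv_pairing\<close>) in which only the integrable test side is
  transformed. Uniqueness of the transform is likewise applied only to integrable functions, made so
  by a kernel or a cutoff. The constant does not depend on \<open>p1\<close>, \<open>p2\<close>,
  \<open>p\<close> because Young's inequality costs the \<open>L^1\<close> norm of \<open>K\<close>,
  Hoelder's inequality costs 1, and the sequence inequality does not see the Lebesgue exponents.
  Lattice sums are integrals over counting measure, so the single Minkowski inequality
  \<open>Lnorm_integral_le\<close> acts as triangle inequality for series, as Young's inequality in
  space and as Young's inequality on the lattice. The number \<open>c < 1\<close> comes from the
  index \<alpha> < 1: doubling the argument multiplies the weight, in the limit, by 2^\<alpha> < 2,
  and a dilation factor l > 2 with l^\<alpha> < 2 leaves room to absorb the shift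
  \<open>R\<close>.\<close>

lemma ennreal_mult_divide_self:
  fixes c x :: ennreal
  assumes "c \<noteq> 0" "c < top"
  shows "c * (x / c) = x"
  using assms by (simp add: ennreal_times_divide mult.commute[of c] ennreal_mult_divide_eq)

section \<open>Real powers and convexity inequalities on the extended nonnegative reals\<close>

lemma ennreal_powr_top [simp]: "ennreal_powr \<infinity> a = \<infinity>" "ennreal_powr top a = top"
  by (simp_all add: ennreal_powr_def)

lemma ennreal_powr_ennreal: "0 \<le> x \<Longrightarrow> ennreal_powr (ennreal x) a = ennreal (x powr a)"
  by (simp add: ennreal_powr_def)

lemma ennreal_powr_0 [simp]: "ennreal_powr 0 a = 0"
  by (simp add: ennreal_powr_def)

lemma ennreal_powr_1 [simp]: "ennreal_powr 1 a = 1"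
  by (simp add: ennreal_powr_def)

lemma ennreal_powr_one [simp]: "ennreal_powr x 1 = x"
  by (cases x) (simp_all add: ennreal_powr_ennreal)

lemma ennreal_powr_eq_0_iff [simp]: "ennreal_powr x a = 0 \<longleftrightarrow> x = 0"
  by (cases x) (simp_all add: ennreal_powr_ennreal)

lemma ennreal_powr_eq_top_iff [simp]: "ennreal_powr x a = top \<longleftrightarrow> x = top"
  by (cases x) (simp_all add: ennreal_powr_ennreal)

lemma ennreal_powr_mono: "0 < a \<Longrightarrow> x \<le> y \<Longrightarrow> ennreal_powr x a \<le> ennreal_powr y a"
  by (cases x; cases y) (auto simp: ennreal_powr_ennreal top_unique intro!: ennreal_leI powr_mono2)

lemma ennreal_powr_mult:
  "0 < a \<Longrightarrow> ennreal_powr (x * y) a = ennreal_powr x a * ennreal_powr y a"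
  by (cases x; cases y; cases "x = 0"; cases "y = 0")
     (auto simp: ennreal_powr_ennreal powr_mult ennreal_mult_top ennreal_top_mult
       simp flip: ennreal_mult)

lemma ennreal_powr_powr:
  "ennreal_powr (ennreal_powr x a) b = ennreal_powr x (a * b)"
  by (cases x) (auto simp: ennreal_powr_ennreal powr_powr)

lemma ennreal_powr_inverse [simp]:
  "0 < a \<Longrightarrow> ennreal_powr (ennreal_powr x a) (1 / a) = x"
  "0 < a \<Longrightarrow> ennreal_powr (ennreal_powr x (1 / a)) a = x"
  by (simp_all add: ennreal_powr_powr)

lemma measurable_ennreal_powr [measurable]:
  assumes [measurable]: "F \<in> borel_measurable M"
  shows "(\<lambda>x. ennreal_powr (F x) a) \<in> borel_measurable M"
  unfolding ennreal_powr_def by measurable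

text \<open>Tangent line of the convex function \<open>t powr r\<close> at \<open>s\<close>,
  obtained from Young's inequality with the exponents \<open>r\<close> and
  \<open>r / (r - 1)\<close>. Integrating it yields Jensen's inequality.\<close>

lemma real_powr_tangent:
  fixes s t r :: real
  assumes "1 \<le> r" "0 \<le> s" "0 \<le> t"
  shows "r * s powr (r - 1) * t \<le> t powr r + (r - 1) * s powr r"
proof (cases "r = 1")
  case True
  then show ?thesis using assms by auto
next
  case False
  have "t * s powr (r - 1) \<le> t powr r / r + (s powr (r - 1)) powr (r / (r - 1)) / (r / (r - 1))"
    by (rule Youngs_inequality) (use assms False in \<open>auto simp: field_simps\<close>)
  moreover have "(s powr (r - 1)) powr (r / (r - 1)) = s powr r"
    using False by (simp add: powr_powr)
  ultimately show ?thesis using assms by (simp add: field_simps)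
qed

lemma ennreal_powr_tangent:
  assumes "1 \<le> r" "0 \<le> s"
  shows "ennreal (r * s powr (r - 1)) * t \<le> ennreal_powr t r + ennreal ((r - 1) * s powr r)"
proof (cases t)
  case (real u)
  have "r * s powr (r - 1) * u \<le> u powr r + (r - 1) * s powr r"
    using real_powr_tangent[of r s u] assms real by simp
  then show ?thesis
    using real assms by (simp add: ennreal_powr_ennreal flip: ennreal_mult ennreal_plus)
qed simp

lemma le_one_plus_ennreal_powr: "1 \<le> r \<Longrightarrow> t \<le> 1 + ennreal_powr t r"
proof (cases t)
  case (real u)
  assume r: "1 \<le> r"
  have "u \<le> 1 + u powr r"
  proof (cases "u \<le> 1")
    case False
    then have "u powr 1 \<le> u powr r" using r by (intro powr_mono) auto
    then show ?thesis using False by simp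
  qed (simp add: add_increasing2)
  then show ?thesis
    using real by (simp add: ennreal_powr_ennreal flip: ennreal_plus ennreal_1)
qed simp

text \<open>Young's inequality for the numbers \<open>s^r\<close> and \<open>t^r\<close> with the
  conjugate exponents \<open>a / r\<close> and \<open>b / r\<close>; it is the pointwise form of
  Hoelder's inequality.\<close>

lemma ennreal_powr_Young:
  assumes "0 < r" "r \<le> a" "r \<le> b" "1 / r = 1 / a + 1 / b"
  shows "ennreal_powr (s * t) r \<le> ennreal (r / a) * ennreal_powr s a + ennreal (r / b) * ennreal_powr t b"
proof (cases "s = top \<or> t = top")
  case True
  then show ?thesis using assms by (auto simp: ennreal_mult_top)
next
  case False
  then obtain x y where xy: "s = ennreal x" "t = ennreal y" "0 \<le> x" "0 \<le> y"
    by (metis ennreal_cases)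
  have ab: "a > r" "b > r"
  proof -
    have "0 < 1 / a" "0 < 1 / b" using assms by simp_all
    then have "a \<noteq> r" "b \<noteq> r" using assms(4) by auto
    then show "a > r" "b > r" using assms by simp_all
  qed
  have e1: "1 / (a / r) + 1 / (b / r) = 1"
  proof -
    have "1 / (a / r) + 1 / (b / r) = r * (1 / a + 1 / b)" by (simp add: field_simps)
    also have "\<dots> = 1" using assms by (simp flip: assms(4))
    finally show ?thesis .
  qed
  have "x powr r * y powr r \<le> (x powr r) powr (a / r) / (a / r) + (y powr r) powr (b / r) / (b / r)"
    by (rule Youngs_inequality) (use ab assms e1 in auto)
  then have "(x * y) powr r \<le> (r / a) * x powr a + (r / b) * y powr b"
    using assms xy by (simp add: powr_powr powr_mult mult.commute)
  then show ?thesis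
    using xy assms by (simp add: ennreal_powr_ennreal flip: ennreal_mult ennreal_plus)
qed

text \<open>Stated for an arbitrary measure and values in the extended nonnegative reals, so that
  Lebesgue norms on space and sequence norms on the lattice share all inequalities, and no
  finiteness has to be known in advance.\<close>

definition Lnorm :: "'a measure \<Rightarrow> ennreal \<Rightarrow> ('a \<Rightarrow> ennreal) \<Rightarrow> ennreal" where
  "Lnorm M p F =
     (if p = \<infinity> then esssup M F
      else ennreal_powr (\<integral>\<^sup>+x. ennreal_powr (F x) (enn2real p) \<partial>M) (1 / enn2real p))"

section \<open>Minkowski, Hoelder and Young inequalities\<close>

lemma enn2real_ge_1: "1 \<le> p \<Longrightarrow> p \<noteq> \<infinity> \<Longrightarrow> 1 \<le> enn2real p"
  by (cases p) (auto simp: one_ennreal.rep_eq)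

lemma Lnorm_mono_AE:
  assumes "1 \<le> p" "F \<in> borel_measurable M" "AE x in M. F x \<le> G x"
  shows "Lnorm M p F \<le> Lnorm M p G"
proof (cases "p = \<infinity>")
  case True
  then show ?thesis using assms by (simp add: Lnorm_def esssup_AE_mono)
next
  case False
  have "1 \<le> enn2real p" using assms False by (simp add: enn2real_ge_1)
  with False assms show ?thesis
    by (auto simp: Lnorm_def intro!: ennreal_powr_mono nn_integral_mono_AE)
qed

lemma Lnorm_cong_AE:
  assumes "F \<in> borel_measurable M" "G \<in> borel_measurable M" "AE x in M. F x = G x"
  shows "Lnorm M p F = Lnorm M p G"
  using assms esssup_AE_cong[OF assms]
  by (auto simp: Lnorm_def intro!: arg_cong[where f="\<lambda>x. ennreal_powr x _"] nn_integral_cong_AE)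

text \<open>Homogeneity turns a bound on the norm into a bound on an integral without a root, which
  is the form that convexity arguments deliver.\<close>

lemma Lnorm_le_iff:
  assumes "1 \<le> p" "p \<noteq> \<infinity>" "F \<in> borel_measurable M" "0 < c" "c < \<infinity>"
  shows "Lnorm M p F \<le> c \<longleftrightarrow> (\<integral>\<^sup>+x. ennreal_powr (F x / c) (enn2real p) \<partial>M) \<le> 1"
proof -
  define r where "r = enn2real p"
  have r: "1 \<le> r" using assms by (simp add: r_def enn2real_ge_1)
  obtain d where d: "c = ennreal d" "0 < d" using assms by (cases c) auto
  have "(\<integral>\<^sup>+x. ennreal_powr (F x / c) r \<partial>M) = (\<integral>\<^sup>+x. ennreal_powr (F x) r * ennreal_powr (inverse c) r \<partial>M)"
    using r by (simp add: divide_ennreal_def ennreal_powr_mult)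
  also have "\<dots> = (\<integral>\<^sup>+x. ennreal_powr (F x) r \<partial>M) * ennreal_powr (inverse c) r"
    using assms by (simp add: nn_integral_multc)
  finally have 1: "(\<integral>\<^sup>+x. ennreal_powr (F x / c) r \<partial>M) = (\<integral>\<^sup>+x. ennreal_powr (F x) r \<partial>M) * ennreal_powr (inverse c) r" .
  let ?I = "\<integral>\<^sup>+x. ennreal_powr (F x) r \<partial>M"
  have "Lnorm M p F \<le> c \<longleftrightarrow> ?I \<le> ennreal_powr c r"
    using ennreal_powr_mono[of r "Lnorm M p F" c] ennreal_powr_mono[of "1/r" ?I "ennreal_powr c r"] r assms(2)
    by (auto simp: Lnorm_def r_def[symmetric])
  also have "\<dots> \<longleftrightarrow> ?I * ennreal_powr (inverse c) r \<le> ennreal_powr c r * ennreal_powr (inverse c) r"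
    using d by (subst (1 2) mult.commute, intro ennreal_mult_le_mult_iff[symmetric])
       (auto simp: inverse_ennreal ennreal_powr_ennreal)
  also have "ennreal_powr c r * ennreal_powr (inverse c) r = 1"
    using r d by (simp flip: ennreal_powr_mult add: inverse_ennreal ennreal_mult[symmetric] )
  finally show ?thesis using 1 by (simp add: r_def)
qed

lemma Lnorm_0_iff:
  assumes "1 \<le> p" "F \<in> borel_measurable M"
  shows "Lnorm M p F = 0 \<longleftrightarrow> (AE x in M. F x = 0)"
proof (cases "p = \<infinity>")
  case True
  then show ?thesis using assms esssup_AE[of F M] esssup_I[of F M 0]
    by (auto simp: Lnorm_def elim: AE_mp)
next
  case False
  with assms show ?thesis
    by (simp add: Lnorm_def nn_integral_0_iff_AE)
qed

text \<open>Jensen's inequality for the power \<open>r\<close> and the probability density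
  \<open>c / S\<close>, multiplied by the total mass \<open>S\<close>.\<close>

lemma nn_integral_Jensen:
  assumes r: "1 \<le> r" and [measurable]: "c \<in> borel_measurable M" "T \<in> borel_measurable M"
    and S: "(\<integral>\<^sup>+i. c i \<partial>M) = S" "0 < S" "S < \<infinity>"
  shows "S * ennreal_powr ((\<integral>\<^sup>+i. c i * T i \<partial>M) / S) r \<le> (\<integral>\<^sup>+i. c i * ennreal_powr (T i) r \<partial>M)"
    (is "S * ennreal_powr (?H / S) r \<le> ?R")
proof (cases "?H = \<infinity>")
  case True
  \<comment> \<open>An infinite mean forces the right-hand side to be infinite, since
    \<open>t \<le> 1 + t^r\<close> integrates to \<open>?H \<le> S + ?R\<close> and \<open>S\<close>
    is finite.\<close>
  have "?H \<le> (\<integral>\<^sup>+i. c i + c i * ennreal_powr (T i) r \<partial>M)"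
    using mult_left_mono[OF le_one_plus_ennreal_powr[OF r]]
    by (intro nn_integral_mono) (simp add: distrib_left)
  also have "\<dots> = S + ?R" by (simp add: nn_integral_add S)
  finally have "?R = top" using True S by (auto simp: top_unique ennreal_add_eq_top)
  then show ?thesis by simp
next
  case False
  obtain S' where S': "S = ennreal S'" "0 < S'" using S by (cases S) auto
  obtain H' where H': "?H = ennreal H'" "0 \<le> H'" using False by (cases ?H) auto
  \<comment> \<open>The tangent is taken at the mean value, so that its integral against
    \<open>c\<close> returns the power of the mean.\<close>
  define h where "h = H' / S'"
  have h: "0 \<le> h" "?H / S = ennreal h" using H' S' by (simp_all add: h_def divide_ennreal)
  have "ennreal (r * h powr (r - 1)) * ?H = (\<integral>\<^sup>+i. c i * (ennreal (r * h powr (r - 1)) * T i) \<partial>M)"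
    by (simp add: nn_integral_cmult[symmetric] mult_ac)
  also have "\<dots> \<le> (\<integral>\<^sup>+i. c i * (ennreal_powr (T i) r + ennreal ((r - 1) * h powr r)) \<partial>M)"
    using ennreal_powr_tangent[OF r h(1)] by (intro nn_integral_mono mult_left_mono) auto
  also have "\<dots> = ?R + S * ennreal ((r - 1) * h powr r)"
    by (simp add: distrib_left nn_integral_add nn_integral_multc S)
  finally have *: "ennreal (r * h powr (r - 1)) * ?H \<le> ?R + S * ennreal ((r - 1) * h powr r)" .
  show ?thesis
  proof (cases ?R)
    case (real R')
    have "r * h powr (r - 1) * H' \<le> R' + S' * ((r - 1) * h powr r)"
      using * real H' S' r by (simp flip: ennreal_mult ennreal_plus)
    moreover have "r * h powr (r - 1) * H' = r * (S' * h powr r)"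
    proof -
      have "h powr (r - 1) * H' = S' * h powr r"
      proof (cases "h = 0")
        case True
        then show ?thesis using S' by (simp add: h_def)
      next
        case False
        then have "h powr r = h powr (r - 1) * h" using h by (simp add: powr_diff)
        then show ?thesis using S' by (simp add: h_def)
      qed
      then show ?thesis by simp
    qed
    ultimately have "S' * h powr r \<le> R'" by argo
    then show ?thesis using real S' h by (simp add: ennreal_powr_ennreal flip: ennreal_mult)
  qed simp
qed


text \<open>Minkowski's integral inequality. Up to the factor \<open>S\<close>, the integral over
  \<open>i\<close> is an average of the functions \<open>F i / c i\<close> with weights
  \<open>c i\<close>, each of norm at most 1, and the unit ball is convex. The norms are replaced by
  a measurable majorant \<open>c\<close>, so that their measurability in \<open>i\<close> is not an
  issue.\<close>

lemma Lnorm_integral_le: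
  assumes p: "1 \<le> p" and sf: "sigma_finite_measure M" "sigma_finite_measure N"
    and F[measurable]: "case_prod F \<in> borel_measurable (N \<Otimes>\<^sub>M M)"
    and c[measurable]: "c \<in> borel_measurable N"
    and le: "\<And>i. i \<in> space N \<Longrightarrow> Lnorm M p (F i) \<le> c i"
  shows "Lnorm M p (\<lambda>x. \<integral>\<^sup>+i. F i x \<partial>N) \<le> (\<integral>\<^sup>+i. c i \<partial>N)"
proof -
  interpret M: sigma_finite_measure M by fact
  interpret N: sigma_finite_measure N by fact
  interpret P: pair_sigma_finite N M ..
  have Fi [measurable]: "F i \<in> borel_measurable M" if "i \<in> space N" for i
    using measurable_Pair2[OF F that] by simp
  have Fx [measurable]: "(\<lambda>i. F i x) \<in> borel_measurable N" if "x \<in> space M" for x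
    using measurable_Pair1[OF F that] by simp
  have H [measurable]: "(\<lambda>x. \<integral>\<^sup>+i. F i x \<partial>N) \<in> borel_measurable M"
    by measurable
  define S where "S = (\<integral>\<^sup>+i. c i \<partial>N)"
  consider "S = \<infinity>" | "p = \<infinity>" | "S = 0" | "0 < S" "S < \<infinity>" "p \<noteq> \<infinity>"
    by (metis infinity_ennreal_def less_top not_gr_zero)
  then have "Lnorm M p (\<lambda>x. \<integral>\<^sup>+i. F i x \<partial>N) \<le> S"
  proof cases
    case 1
    then show ?thesis by simp
  next
    case 2
    have "AE i in N. AE x in M. F i x \<le> c i"
    proof (rule AE_I2)
      fix i assume i: "i \<in> space N"
      have "AE x in M. F i x \<le> Lnorm M p (F i)" using esssup_AE[of "F i" M] 2 by (simp add: Lnorm_def)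
      then show "AE x in M. F i x \<le> c i" by eventually_elim (use le[OF i] in order)
    qed
    then have "AE x in M. AE i in N. F i x \<le> c i"
      by (subst P.AE_commute[symmetric]) (auto intro!: measurable_pair_swap)
    then have "AE x in M. (\<integral>\<^sup>+i. F i x \<partial>N) \<le> S"
      unfolding S_def by eventually_elim (rule nn_integral_mono_AE)
    then show ?thesis using 2 by (simp add: Lnorm_def esssup_I)
  next
    case 3
    then have "AE i in N. c i = 0" by (simp add: S_def nn_integral_0_iff_AE)
    with AE_space have "AE i in N. AE x in M. F i x = 0"
    proof eventually_elim
      case (elim i)
      then show ?case using le[of i] Lnorm_0_iff[OF p, of "F i" M] by simp
    qed
    then have "AE x in M. AE i in N. F i x = 0"
      by (subst P.AE_commute[symmetric]) auto
    with AE_space have "AE x in M. (\<integral>\<^sup>+i. F i x \<partial>N) = 0"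
      by eventually_elim (subst nn_integral_0_iff_AE, auto)
    then show ?thesis using Lnorm_0_iff[OF p H] by simp
  next
    case 4
    define r where "r = enn2real p"
    have r: "1 \<le> r" using p 4 by (simp add: r_def enn2real_ge_1)
    have cfin: "AE i in N. c i < \<infinity>"
      using nn_integral_PInf_AE[OF c] 4 by (auto simp: S_def less_top)
    \<comment> \<open>The factorisation \<open>F i x = c i * (F i x / c i)\<close> fails where
      \<open>c i = 0\<close> unless \<open>F i x = 0\<close>. That holds for almost all
      \<open>x\<close> for each \<open>i\<close>, and Fubini for null sets turns it into almost all
      \<open>i\<close> for almost all \<open>x\<close>.\<close>
    have "AE i in N. AE x in M. c i = 0 \<longrightarrow> F i x = 0"
    proof (rule AE_I2)
      fix i assume i: "i \<in> space N"
      show "AE x in M. c i = 0 \<longrightarrow> F i x = 0"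
        using le[of i] Lnorm_0_iff[OF p, of "F i" M] i by (cases "c i = 0") auto
    qed
    then have zero: "AE x in M. AE i in N. c i = 0 \<longrightarrow> F i x = 0"
      by (subst P.AE_commute[symmetric]) auto
    have H_eq: "AE x in M. (\<integral>\<^sup>+i. F i x \<partial>N) = (\<integral>\<^sup>+i. c i * (F i x / c i) \<partial>N)"
      using zero
    proof eventually_elim
      case (elim x)
      show ?case
      proof (rule nn_integral_cong_AE)
        show "AE i in N. F i x = c i * (F i x / c i)"
          using elim cfin
        proof eventually_elim
          case (elim i)
          then show ?case
            by (cases "c i = 0") (auto simp: ennreal_mult_divide_self)
        qed
      qed
    qed
    \<comment> \<open>Jensen at each \<open>x\<close>, Tonelli, and then for each \<open>i\<close>
      the normalisation by \<open>c i\<close>.\<close>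
    have "S * (\<integral>\<^sup>+x. ennreal_powr ((\<integral>\<^sup>+i. F i x \<partial>N) / S) r \<partial>M)
        = (\<integral>\<^sup>+x. S * ennreal_powr ((\<integral>\<^sup>+i. F i x \<partial>N) / S) r \<partial>M)"
      by (rule nn_integral_cmult[symmetric]) measurable
    also have "\<dots> \<le> (\<integral>\<^sup>+x. (\<integral>\<^sup>+i. c i * ennreal_powr (F i x / c i) r \<partial>N) \<partial>M)"
    proof (rule nn_integral_mono_AE)
      show "AE x in M. S * ennreal_powr ((\<integral>\<^sup>+i. F i x \<partial>N) / S) r \<le> (\<integral>\<^sup>+i. c i * ennreal_powr (F i x / c i) r \<partial>N)"
        using H_eq AE_space
      proof eventually_elim
        case (elim x)
        have [measurable]: "(\<lambda>i. F i x) \<in> borel_measurable N" using elim Fx by simp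
        show ?case unfolding elim(1)
          by (rule nn_integral_Jensen[OF r]) (use 4 S_def in auto)
      qed
    qed
    also have "\<dots> = (\<integral>\<^sup>+i. (\<integral>\<^sup>+x. c i * ennreal_powr (F i x / c i) r \<partial>M) \<partial>N)"
      by (rule P.Fubini') measurable
    also have "\<dots> \<le> (\<integral>\<^sup>+i. c i \<partial>N)"
    proof (rule nn_integral_mono_AE)
      show "AE i in N. (\<integral>\<^sup>+x. c i * ennreal_powr (F i x / c i) r \<partial>M) \<le> c i"
        using cfin AE_space
      proof eventually_elim
        case (elim i)
        have [measurable]: "F i \<in> borel_measurable M" using elim Fi by simp
        show ?case
        proof (cases "c i = 0")
          case False
          have "(\<integral>\<^sup>+x. ennreal_powr (F i x / c i) r \<partial>M) \<le> 1"
            using Lnorm_le_iff[of p "F i" M "c i"] p 4 False elim le[of i]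
            by (simp add: r_def zero_less_iff_neq_zero)
          from mult_left_mono[OF this, of "c i"] show ?thesis
            by (simp add: nn_integral_cmult)
        qed simp
      qed
    qed
    also have "\<dots> = S * 1" by (simp add: S_def)
    finally have "(\<integral>\<^sup>+x. ennreal_powr ((\<integral>\<^sup>+i. F i x \<partial>N) / S) r \<partial>M) \<le> 1"
      using 4 by (subst (asm) ennreal_mult_le_mult_iff) auto
    then show ?thesis
      using Lnorm_le_iff[of p _ M S] p 4 H by (simp add: r_def)
  qed
  then show ?thesis by (simp add: S_def)
qed

lemma Lnorm_cmult:
  assumes p: "1 \<le> p" and [measurable]: "F \<in> borel_measurable M"
  shows "Lnorm M p (\<lambda>x. a * F x) \<le> a * Lnorm M p F"
proof (cases "p = \<infinity>")
  case True
  have "AE x in M. a * F x \<le> a * esssup M F"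
    using esssup_AE[of F M] by eventually_elim (rule mult_left_mono, auto)
  then show ?thesis using True by (simp add: Lnorm_def esssup_I)
next
  case False
  then have r: "1 \<le> enn2real p" using p by (simp add: enn2real_ge_1)
  then show ?thesis using False
    by (simp add: Lnorm_def ennreal_powr_mult nn_integral_cmult)
qed

text \<open>After division by the bounds \<open>a\<close> and \<open>b\<close>, the pointwise Young
  inequality integrates to \<open>r / r1 + r / r2 = 1\<close>.\<close>

lemma Lnorm_mult_le_normalized:
  assumes p: "1 \<le> p1" "1 \<le> p2" "1 \<le> p" "p1 \<noteq> \<infinity>" "p2 \<noteq> \<infinity>" "p \<noteq> \<infinity>"
    and pp: "1 / enn2real p = 1 / enn2real p1 + 1 / enn2real p2"
    and [measurable]: "F \<in> borel_measurable M" "G \<in> borel_measurable M"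
    and a: "Lnorm M p1 F \<le> a" "0 < a" "a < \<infinity>" and b: "Lnorm M p2 G \<le> b" "0 < b" "b < \<infinity>"
  shows "Lnorm M p (\<lambda>x. F x * G x) \<le> a * b"
proof -
  define r r1 r2 where "r = enn2real p" and "r1 = enn2real p1" and "r2 = enn2real p2"
  have r: "1 \<le> r" "1 \<le> r1" "1 \<le> r2" using p by (simp_all add: r_def r1_def r2_def enn2real_ge_1)
  have e: "1 / r = 1 / r1 + 1 / r2" using pp by (simp add: r_def r1_def r2_def)
  have "1 / r1 \<le> 1 / r" "1 / r2 \<le> 1 / r" using r e by simp_all
  then have le: "r \<le> r1" "r \<le> r2" using r by (simp_all add: field_simps)
  have r12: "r / r1 + r / r2 = 1"
  proof -
    have "r / r1 + r / r2 = r * (1 / r1 + 1 / r2)" by (simp add: field_simps)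
    then show ?thesis using r by (simp flip: e)
  qed
  obtain a' b' where ab: "a = ennreal a'" "b = ennreal b'" "0 < a'" "0 < b'"
    using a b by (cases a; cases b) auto
  have "inverse (a * b) = inverse a * inverse b"
    using ab by (simp add: inverse_ennreal flip: ennreal_mult)
  then have q: "F x * G x / (a * b) = (F x / a) * (G x / b)" for x
    by (simp only: divide_ennreal_def mult_ac)
  have "(\<integral>\<^sup>+x. ennreal_powr (F x * G x / (a * b)) r \<partial>M)
      \<le> (\<integral>\<^sup>+x. ennreal (r / r1) * ennreal_powr (F x / a) r1 + ennreal (r / r2) * ennreal_powr (G x / b) r2 \<partial>M)"
    unfolding q by (intro nn_integral_mono ennreal_powr_Young) (use r le e in auto)
  also have "\<dots> = ennreal (r / r1) * (\<integral>\<^sup>+x. ennreal_powr (F x / a) r1 \<partial>M)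
      + ennreal (r / r2) * (\<integral>\<^sup>+x. ennreal_powr (G x / b) r2 \<partial>M)"
    by (simp add: nn_integral_add nn_integral_cmult)
  also have "\<dots> \<le> ennreal (r / r1) * 1 + ennreal (r / r2) * 1"
    using Lnorm_le_iff[of p1 F M a] Lnorm_le_iff[of p2 G M b] p a b
    by (intro add_mono mult_left_mono) (auto simp: r1_def r2_def)
  also have "\<dots> = 1" using r r12 by (simp flip: ennreal_plus)
  finally show ?thesis
    using p ab by (subst Lnorm_le_iff) (auto simp: r_def ennreal_zero_less_mult_iff ennreal_mult_less_top)
qed

text \<open>An infinite exponent reduces to a pointwise bound, a vanishing norm to a product
  vanishing almost everywhere, and an infinite norm to a trivial right-hand side. What remains can
  be normalised.\<close>

lemma Lnorm_Hoelder:
  assumes p: "1 \<le> p1" "1 \<le> p2" "1 \<le> p" and pp: "1 / p = 1 / p1 + 1 / p2"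
    and [measurable]: "F \<in> borel_measurable M" "G \<in> borel_measurable M"
  shows "Lnorm M p (\<lambda>x. F x * G x) \<le> Lnorm M p1 F * Lnorm M p2 G"
proof -
  have inf: "Lnorm M p (\<lambda>x. F x * G x) \<le> Lnorm M \<infinity> F * Lnorm M p G"
    if [measurable]: "F \<in> borel_measurable M" "G \<in> borel_measurable M" for F G :: "'a \<Rightarrow> ennreal"
  proof -
    have "AE x in M. F x * G x \<le> Lnorm M \<infinity> F * G x"
      using esssup_AE[of F M] by eventually_elim (auto simp: Lnorm_def intro: mult_right_mono)
    then have "Lnorm M p (\<lambda>x. F x * G x) \<le> Lnorm M p (\<lambda>x. Lnorm M \<infinity> F * G x)"
      using p by (intro Lnorm_mono_AE) auto
    also have "\<dots> \<le> Lnorm M \<infinity> F * Lnorm M p G" using p by (intro Lnorm_cmult) auto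
    finally show ?thesis .
  qed
  have inv: "inverse (inverse z) = z" for z :: ennreal
  proof (cases z)
    case (real r)
    then show ?thesis by (cases "r = 0") (simp_all add: inverse_ennreal)
  qed simp
  \<comment> \<open>If one exponent is infinite, its reciprocal is 0, and the other exponent is
    identified with \<open>p\<close> by injectivity of the reciprocal.\<close>
  have inj: "x = y" if "1 / x = 1 / y" for x y :: ennreal
  proof -
    have "inverse (inverse x) = inverse (inverse y)" using that by (simp add: divide_ennreal_def)
    then show ?thesis by (simp only: inv)
  qed
  consider "p1 = \<infinity>" | "p2 = \<infinity>" | "p1 \<noteq> \<infinity>" "p2 \<noteq> \<infinity>" by argo
  then show ?thesis
  proof cases
    case 1
    with pp have "p = p2" by - (rule inj, simp add: divide_ennreal_def)
    with 1 show ?thesis using inf[of F G] by simp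
  next
    case 2
    with pp have "p = p1" by - (rule inj, simp add: divide_ennreal_def)
    with 2 show ?thesis using inf[of G F] by (simp add: mult.commute)
  next
    case 3
    obtain r1 r2 where r12: "p1 = ennreal r1" "p2 = ennreal r2" "1 \<le> r1" "1 \<le> r2"
      using p 3 by (cases p1; cases p2) (auto simp flip: ennreal_1)
    have pf: "p \<noteq> \<infinity>" using pp r12 by (auto simp: divide_ennreal_def inverse_ennreal)
    then obtain r where r: "p = ennreal r" "1 \<le> r"
      using p by (cases p) (auto simp flip: ennreal_1)
    have "1 / r = 1 / r1 + 1 / r2"
      using pp r r12 by (simp add: divide_ennreal_def inverse_ennreal inverse_eq_divide flip: ennreal_plus)
    then have pp': "1 / enn2real p = 1 / enn2real p1 + 1 / enn2real p2" using r r12 by simp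
    let ?a = "Lnorm M p1 F" and ?b = "Lnorm M p2 G"
    consider "?a = 0 \<or> ?b = 0" | "?a = \<infinity>" "?b \<noteq> 0" | "?b = \<infinity>" "?a \<noteq> 0" | "0 < ?a" "?a < \<infinity>" "0 < ?b" "?b < \<infinity>"
      by (metis infinity_ennreal_def less_top not_gr_zero)
    then show ?thesis
    proof cases
      case 1
      then have "AE x in M. F x * G x = 0"
        using Lnorm_0_iff[of p1 F M] Lnorm_0_iff[of p2 G M] p by (auto elim!: AE_mp)
      then show ?thesis using Lnorm_0_iff[of p "\<lambda>x. F x * G x" M] p by simp
    next
      case 4
      then show ?thesis using Lnorm_mult_le_normalized[of p1 p2 p F M G ?a ?b] p 3 pf pp' by simp
    qed (auto simp: ennreal_mult_top ennreal_top_mult)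
  qed
qed

text \<open>Takes the place of Hoelder's inequality with the conjugate exponent: for normalised
  \<open>G\<close> the bound \<open>t \<le> 1 + t^r\<close> splits the integral into the
  \<open>L^1\<close> norm of \<open>F\<close> and its supremum. The resulting constant is the same
  for all \<open>p\<close>.\<close>

lemma nn_integral_mult_le_Lnorm:
  assumes p: "1 \<le> p" and [measurable]: "F \<in> borel_measurable M" "G \<in> borel_measurable M"
    and B: "\<And>x. x \<in> space M \<Longrightarrow> F x \<le> B"
  shows "(\<integral>\<^sup>+x. F x * G x \<partial>M) \<le> ((\<integral>\<^sup>+x. F x \<partial>M) + B) * Lnorm M p G"
proof -
  let ?a = "Lnorm M p G"
  consider "p = \<infinity>" | "?a = 0" | "?a = \<infinity>" | "p \<noteq> \<infinity>" "0 < ?a" "?a < \<infinity>"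
    by (metis infinity_ennreal_def less_top not_gr_zero)
  then show ?thesis
  proof cases
    case 1
    have "(\<integral>\<^sup>+x. F x * G x \<partial>M) \<le> (\<integral>\<^sup>+x. F x * ?a \<partial>M)"
    proof (rule nn_integral_mono_AE)
      show "AE x in M. F x * G x \<le> F x * ?a"
        using esssup_AE[of G M] by eventually_elim (auto simp: Lnorm_def 1 intro: mult_left_mono)
    qed
    also have "\<dots> = (\<integral>\<^sup>+x. F x \<partial>M) * ?a" by (simp add: nn_integral_multc)
    also have "\<dots> \<le> ((\<integral>\<^sup>+x. F x \<partial>M) + B) * ?a" by (intro mult_right_mono) auto
    finally show ?thesis .
  next
    case 2
    then have "AE x in M. G x = 0" using Lnorm_0_iff[OF p, of G M] by simp
    then have "AE x in M. F x * G x = 0" by eventually_elim simp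
    then have "(\<integral>\<^sup>+x. F x * G x \<partial>M) = 0" by (simp add: nn_integral_0_iff_AE)
    then show ?thesis by simp
  next
    case 3
    \<comment> \<open>With \<open>0 * \<infinity> = 0\<close>, an infinite norm of \<open>G\<close>
      makes the right-hand side infinite only if the first factor is nonzero, so \<open>F\<close>
      vanishing almost everywhere is treated apart.\<close>
    have "(\<integral>\<^sup>+x. F x * G x \<partial>M) = 0" if "(\<integral>\<^sup>+x. F x \<partial>M) = 0"
    proof -
      from that have "AE x in M. F x = 0" by (simp add: nn_integral_0_iff_AE)
      then have "AE x in M. F x * G x = 0" by eventually_elim simp
      then show ?thesis by (simp add: nn_integral_0_iff_AE)
    qed
    then show ?thesis using 3
      by (cases "(\<integral>\<^sup>+x. F x \<partial>M) = 0") (auto simp: ennreal_mult_top)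
  next
    case 4
    define r where "r = enn2real p"
    have r: "1 \<le> r" using p 4 by (simp add: r_def enn2real_ge_1)
    obtain a where a: "?a = ennreal a" "0 < a" using 4 by (cases ?a) auto
    have G: "G x = ?a * (G x / ?a)" for x
      using a by (simp add: ennreal_mult_divide_self)
    have "(\<integral>\<^sup>+x. F x * G x \<partial>M) = (\<integral>\<^sup>+x. ?a * (F x * (G x / ?a)) \<partial>M)"
      by (subst G) (simp add: mult_ac)
    also have "\<dots> \<le> (\<integral>\<^sup>+x. ?a * (F x + B * ennreal_powr (G x / ?a) r) \<partial>M)"
    proof (intro nn_integral_mono mult_left_mono)
      fix x assume x: "x \<in> space M"
      have "F x * (G x / ?a) \<le> F x * (1 + ennreal_powr (G x / ?a) r)"
        using r by (intro mult_left_mono le_one_plus_ennreal_powr) auto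
      also have "\<dots> \<le> F x + B * ennreal_powr (G x / ?a) r"
        using B[OF x] by (auto simp: distrib_left intro!: add_mono mult_right_mono)
      finally show "F x * (G x / ?a) \<le> F x + B * ennreal_powr (G x / ?a) r" .
    qed simp
    also have "\<dots> = ?a * ((\<integral>\<^sup>+x. F x \<partial>M) + B * (\<integral>\<^sup>+x. ennreal_powr (G x / ?a) r \<partial>M))"
      by (simp add: nn_integral_cmult nn_integral_add)
    also have "\<dots> \<le> ?a * ((\<integral>\<^sup>+x. F x \<partial>M) + B * 1)"
      using Lnorm_le_iff[of p G M ?a] p 4 by (intro mult_left_mono add_mono) (auto simp: r_def)
    finally show ?thesis by (simp add: mult.commute)
  qed
qed

text \<open>The embedding of a sequence space into the bounded sequences, with norm 1; through it a
  single frequency piece is controlled by the modulation norm.\<close>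

lemma le_Lnorm_count_space:
  assumes "1 \<le> p"
  shows "F k \<le> Lnorm (count_space UNIV) p F"
proof (cases "p = \<infinity>")
  case True
  have "AE x in count_space UNIV. F x \<le> esssup (count_space UNIV) F" by (rule esssup_AE)
  then show ?thesis using True by (simp add: Lnorm_def AE_count_space)
next
  case False
  then have r: "1 \<le> enn2real p" using assms by (simp add: enn2real_ge_1)
  have "ennreal_powr (F k) (enn2real p) \<le> (\<integral>\<^sup>+x. ennreal_powr (F x) (enn2real p) \<partial>count_space UNIV)"
    by (rule nn_integral_ge_point) simp
  then have "ennreal_powr (ennreal_powr (F k) (enn2real p)) (1 / enn2real p) \<le> Lnorm (count_space UNIV) p F"
    unfolding Lnorm_def using r False by (simp only: if_False) (rule ennreal_powr_mono, auto)
  moreover have "0 < enn2real p" using r by simp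
  ultimately show ?thesis by (simp only: ennreal_powr_inverse)
qed

lemma Lnorm_count_space_bij:
  assumes "bij g"
  shows "Lnorm (count_space UNIV) p (\<lambda>x. F (g x)) = Lnorm (count_space UNIV) p F"
proof -
  have 1: "(\<integral>\<^sup>+x. H (g x) \<partial>count_space UNIV) = (\<integral>\<^sup>+x. H x \<partial>count_space UNIV)" for H
    using assms by (rule nn_integral_bij_count_space)
  have 2: "esssup (count_space UNIV) (\<lambda>x. F (g x)) = esssup (count_space UNIV) F"
    using assms by (auto simp: esssup_eq_AE AE_count_space bij_def surj_def intro!: arg_cong[where f=Inf])
      (metis)
  show ?thesis unfolding Lnorm_def 2 using 1[of "\<lambda>y. ennreal_powr (F y) (enn2real p)"] by simp
qed

section \<open>Fourier inversion and uniqueness\<close>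

lemma continuous_on_cis [continuous_intros]:
  "continuous_on S f \<Longrightarrow> continuous_on S (\<lambda>x. cis (f x))"
  by (simp add: cis_conv_exp) (intro continuous_intros)

lemma borel_measurable_cis [measurable]:
  "f \<in> borel_measurable M \<Longrightarrow> (\<lambda>x. cis (f x)) \<in> borel_measurable M"
  by (rule borel_measurable_continuous_on[where f=cis]) (simp_all add: continuous_intros)

lemma integrable_mult_bounded:
  fixes u v :: "'a \<Rightarrow> complex"
  assumes u: "integrable M u" and v: "v \<in> borel_measurable M" "\<And>x. norm (v x) \<le> B"
  shows "integrable M (\<lambda>x. u x * v x)"
proof (rule Bochner_Integration.integrable_bound)
  show "integrable M (\<lambda>x. norm (u x) * B)" using u by simp
  have "norm (u x) * norm (v x) \<le> norm (u x) * B" for x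
    by (intro mult_left_mono v) simp
  then show "AE x in M. norm (u x * v x) \<le> norm (norm (u x) * B)"
    by (intro AE_I2) (simp add: norm_mult, smt (verit) v(2) norm_ge_zero abs_mult abs_of_nonneg)
qed (use assms in measurable)

lemma integrable_mult_cis:
  fixes u :: "'a \<Rightarrow> complex"
  assumes "integrable M u" "f \<in> borel_measurable M"
  shows "integrable M (\<lambda>x. u x * cis (f x))"
  using assms by (intro integrable_mult_bounded[where B=1]) auto

lemma Fubini_nn:
  fixes f :: "'a \<Rightarrow> 'b \<Rightarrow> complex"
  assumes "sigma_finite_measure M" "sigma_finite_measure N"
    and f [measurable]: "case_prod f \<in> borel_measurable (M \<Otimes>\<^sub>M N)"
    and fin: "(\<integral>\<^sup>+x. \<integral>\<^sup>+y. ennreal (norm (f x y)) \<partial>N \<partial>M) < \<infinity>"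
  shows "(\<integral>x. \<integral>y. f x y \<partial>N \<partial>M) = (\<integral>y. \<integral>x. f x y \<partial>M \<partial>N)"
proof -
  interpret M: sigma_finite_measure M by fact
  interpret N: sigma_finite_measure N by fact
  interpret pair_sigma_finite M N ..
  have "integrable (M \<Otimes>\<^sub>M N) (case_prod f)"
    using fin by (intro integrableI_bounded f) (simp add: N.nn_integral_fst[symmetric] split_beta')
  from Fubini_integral[OF this] show ?thesis by simp
qed

lemma nn_integral_lborel_affine:
  fixes f :: "'a::euclidean_space \<Rightarrow> ennreal"
  assumes [measurable]: "f \<in> borel_measurable borel" and c: "c \<noteq> 0"
  shows "(\<integral>\<^sup>+x. f x \<partial>lborel) = ennreal (\<bar>c\<bar> ^ DIM('a)) * (\<integral>\<^sup>+x. f (t + c *\<^sub>R x) \<partial>lborel)"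
  by (subst lborel_affine[OF c, of t])
     (simp add: nn_integral_density nn_integral_distr nn_integral_cmult)

lemma integral_lborel_affine:
  fixes f :: "'a::euclidean_space \<Rightarrow> complex"
  assumes [measurable]: "f \<in> borel_measurable borel" and c: "c \<noteq> 0"
  shows "(\<integral>x. f x \<partial>lborel) = of_real (\<bar>c\<bar> ^ DIM('a)) * (\<integral>x. f (t + c *\<^sub>R x) \<partial>lborel)"
  by (subst lborel_affine[OF c, of t])
     (simp add: integral_density integral_distr scaleR_conv_of_real)

lemma integrable_lborel_affine:
  fixes f :: "'a::euclidean_space \<Rightarrow> complex"
  assumes f: "integrable lborel f" and c: "c \<noteq> 0"
  shows "integrable lborel (\<lambda>x. f (t + c *\<^sub>R x))"
proof -
  have [measurable]: "f \<in> borel_measurable borel" using borel_measurable_integrable[OF f] by simp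
  have "ennreal (\<bar>c\<bar> ^ DIM('a)) * (\<integral>\<^sup>+x. ennreal (norm (f (t + c *\<^sub>R x))) \<partial>lborel) < \<infinity>"
    using f c nn_integral_lborel_affine[of "\<lambda>x. ennreal (norm (f x))" c t]
    by (simp add: integrable_iff_bounded)
  then show ?thesis using c
    by (intro integrableI_bounded) (auto simp: ennreal_mult_less_top)
qed

text \<open>The Fourier transform in the convention of characteristic functions: positive sign, no
  normalising factor. Applied twice it gives the reflection times \<open>(2 * pi)^n\<close>.\<close>

definition Etrans :: "('a::euclidean_space \<Rightarrow> complex) \<Rightarrow> 'a \<Rightarrow> complex" where
  "Etrans u \<xi> = (\<integral>x. u x * cis (x \<bullet> \<xi>) \<partial>lborel)"

lemma Etrans_measurable [measurable]:
  assumes [measurable]: "u \<in> borel_measurable borel"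
  shows "Etrans u \<in> borel_measurable borel"
  unfolding Etrans_def by measurable

lemma norm_Etrans_le: "norm (Etrans u \<xi>) \<le> (\<integral>x. norm (u x) \<partial>lborel)"
  using integral_norm_bound[of lborel "\<lambda>x. u x * cis (x \<bullet> \<xi>)"]
  by (simp add: Etrans_def norm_mult)

section \<open>Gaussians and Fourier inversion\<close>

lemma Gauss_integral_1:
  "integrable lborel (\<lambda>y. complex_of_real (exp (- y\<^sup>2 / 2)) * cis (y * t))" (is ?A)
  "(\<integral>y. complex_of_real (exp (- y\<^sup>2 / 2)) * cis (y * t) \<partial>lborel) = of_real (sqrt (2 * pi) * exp (- t\<^sup>2 / 2))" (is ?B)
proof -
  have "complex_of_real (exp (- t\<^sup>2 / 2)) = char std_normal_distribution t"
    by (simp add: char_std_normal_distribution)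
  also have "\<dots> = (\<integral>x. std_normal_density x *\<^sub>R iexp (t * x) \<partial>lborel)"
    unfolding char_def by (subst integral_density) auto
  also have "\<dots> = (\<integral>x. complex_of_real (1 / sqrt (2 * pi)) * (complex_of_real (exp (- x\<^sup>2 / 2)) * cis (x * t)) \<partial>lborel)"
    by (intro Bochner_Integration.integral_cong refl)
       (simp add: std_normal_density_def scaleR_conv_of_real cis_conv_exp mult.commute)
  also have "\<dots> = complex_of_real (1 / sqrt (2 * pi)) * (\<integral>x. (complex_of_real (exp (- x\<^sup>2 / 2)) * cis (x * t)) \<partial>lborel)"
    by (rule integral_mult_right_zero)
  finally show ?B by (simp add: field_simps)
  \<comment> \<open>The value just computed is nonzero, while the integral of a non-integrable
    function is 0 by convention.\<close>
  then show ?A using not_integrable_integral_eq by fastforce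
qed

definition gauss :: "'a::euclidean_space \<Rightarrow> complex" where
  "gauss y = of_real (exp (- (norm y)\<^sup>2 / 2))"

lemma gauss_measurable [measurable]: "gauss \<in> borel_measurable borel"
  unfolding gauss_def by measurable

lemma norm_gauss_le_1: "norm (gauss y) \<le> 1"
  by (simp add: gauss_def)

lemma Etrans_gauss:
  fixes z :: "'a::euclidean_space"
  shows "Etrans gauss z = of_real (sqrt (2 * pi) ^ DIM('a)) * gauss z"
proof -
  interpret product_sigma_finite "\<lambda>_::'a. lborel :: real measure" ..
  let ?h = "\<lambda>b y. complex_of_real (exp (- y\<^sup>2 / 2)) * cis (y * (z \<bullet> b))"
  have eq: "gauss y * cis (y \<bullet> z) = (\<Prod>b\<in>Basis. ?h b (y \<bullet> b))" for y
  proof -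
    have 1: "(norm y)\<^sup>2 = (\<Sum>b\<in>Basis. (y \<bullet> b)\<^sup>2)"
      unfolding power2_norm_eq_inner by (subst euclidean_inner) (simp add: power2_eq_square)
    have "gauss y * cis (y \<bullet> z)
      = exp (of_real (- (\<Sum>b\<in>Basis. (y \<bullet> b)\<^sup>2) / 2) + \<i> * of_real (\<Sum>b\<in>Basis. (y \<bullet> b) * (z \<bullet> b)))"
      by (simp only: gauss_def cis_conv_exp exp_of_real[symmetric] exp_add 1 euclidean_inner[of y z])
    also have "\<dots> = exp (\<Sum>b\<in>Basis. of_real (- (y \<bullet> b)\<^sup>2 / 2) + \<i> * of_real ((y \<bullet> b) * (z \<bullet> b)))"
      by (simp add: sum.distrib sum_distrib_left sum_negf sum_divide_distrib flip: sum_subtractf)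
    also have "\<dots> = (\<Prod>b\<in>Basis. ?h b (y \<bullet> b))"
      by (simp only: exp_sum finite_Basis exp_add cis_conv_exp exp_of_real[symmetric])
    finally show ?thesis .
  qed
  have "Etrans gauss z = (\<integral>y. (\<Prod>b\<in>Basis. ?h b (y \<bullet> b)) \<partial>lborel)"
    by (simp add: Etrans_def eq)
  also have "\<dots> = (\<integral>f. (\<Prod>b\<in>Basis. ?h b ((\<Sum>b\<in>Basis. f b *\<^sub>R b) \<bullet> b)) \<partial>(\<Pi>\<^sub>M b\<in>Basis. lborel))"
    by (subst lborel_eq, subst integral_distr) measurable
  also have "\<dots> = (\<integral>f. (\<Prod>b\<in>Basis. ?h b (f b)) \<partial>(\<Pi>\<^sub>M b\<in>Basis. lborel))"
    by (intro Bochner_Integration.integral_cong refl prod.cong)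
       (simp_all add: inner_sum_left inner_Basis if_distrib sum.delta cong: if_cong)
  also have "\<dots> = (\<Prod>b\<in>Basis. \<integral>y. ?h b y \<partial>lborel)"
    by (rule product_integral_prod) (rule finite_Basis, rule Gauss_integral_1)
  also have "\<dots> = (\<Prod>b\<in>Basis. of_real (sqrt (2 * pi)) * of_real (exp (- (z \<bullet> b)\<^sup>2 / 2)))"
    by (intro prod.cong refl) (subst Gauss_integral_1(2), simp)
  also have "\<dots> = of_real (sqrt (2 * pi)) ^ DIM('a) * (\<Prod>b\<in>Basis. of_real (exp (- (z \<bullet> b)\<^sup>2 / 2)))"
    by (simp add: prod.distrib)
  also have "(\<Prod>b\<in>Basis. complex_of_real (exp (- (z \<bullet> b)\<^sup>2 / 2))) = gauss z"
  proof -
    have "(norm z)\<^sup>2 = (\<Sum>b\<in>Basis. (z \<bullet> b)\<^sup>2)"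
      unfolding power2_norm_eq_inner by (subst euclidean_inner) (simp add: power2_eq_square)
    then show ?thesis
      by (simp add: gauss_def exp_sum[symmetric] sum_negf sum_divide_distrib flip: of_real_prod)
  qed
  finally show ?thesis by simp
qed

lemma integral_gauss: "(\<integral>y. gauss y \<partial>(lborel :: 'a::euclidean_space measure)) = of_real (sqrt (2 * pi) ^ DIM('a))"
  using Etrans_gauss[of "0 :: 'a"] by (simp add: Etrans_def gauss_def)

lemma integrable_gauss: "integrable lborel (gauss :: 'a::euclidean_space \<Rightarrow> complex)"
proof (rule ccontr)
  assume "\<not> integrable lborel (gauss :: 'a \<Rightarrow> complex)"
  then show False using integral_gauss[where 'a='a] not_integrable_integral_eq[of "lborel :: 'a measure" gauss] by simp
qed

lemma Etrans_gauss_scaled: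
  fixes z :: "'a::euclidean_space"
  assumes "0 < \<epsilon>"
  shows "Etrans (\<lambda>y. gauss (\<epsilon> *\<^sub>R y)) z = of_real (sqrt (2 * pi) ^ DIM('a) / \<epsilon> ^ DIM('a)) * gauss (z /\<^sub>R \<epsilon>)"
proof -
  have "Etrans (\<lambda>y. gauss (\<epsilon> *\<^sub>R y)) z
      = of_real (\<bar>1 / \<epsilon>\<bar> ^ DIM('a)) * (\<integral>x. gauss (\<epsilon> *\<^sub>R (0 + (1 / \<epsilon>) *\<^sub>R x)) * cis ((0 + (1 / \<epsilon>) *\<^sub>R x) \<bullet> z) \<partial>lborel)"
    unfolding Etrans_def using assms by (intro integral_lborel_affine) measurable
  also have "(\<integral>x. gauss (\<epsilon> *\<^sub>R (0 + (1 / \<epsilon>) *\<^sub>R x)) * cis ((0 + (1 / \<epsilon>) *\<^sub>R x) \<bullet> z) \<partial>lborel) = Etrans gauss (z /\<^sub>R \<epsilon>)"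
    using assms by (simp add: Etrans_def inverse_eq_divide)
  finally show ?thesis using assms by (simp add: Etrans_gauss power_divide)
qed

lemma integrable_gauss_scaled: "0 < \<epsilon> \<Longrightarrow> integrable lborel (\<lambda>y. gauss (\<epsilon> *\<^sub>R y))"
  using integrable_lborel_affine[OF integrable_gauss, of \<epsilon> 0] by simp

text \<open>The Gaussian factor makes the double integral absolutely convergent, and its own
  transform is a Gaussian which concentrates at \<open>x = - \<xi>\<close> as \<epsilon> tends to 0.
  Both inversion and uniqueness start from this identity.\<close>

lemma Etrans_Etrans_gauss:
  fixes u :: "'a::euclidean_space \<Rightarrow> complex"
  assumes u: "integrable lborel u" and \<epsilon>: "0 < \<epsilon>"
  shows "(\<integral>y. Etrans u y * cis (y \<bullet> \<xi>) * gauss (\<epsilon> *\<^sub>R y) \<partial>lborel)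
       = of_real (sqrt (2 * pi) ^ DIM('a) / \<epsilon> ^ DIM('a)) * (\<integral>x. u x * gauss ((x + \<xi>) /\<^sub>R \<epsilon>) \<partial>lborel)"
proof -
  have [measurable]: "u \<in> borel_measurable borel" using borel_measurable_integrable[OF u] by simp
  have "(\<integral>y. Etrans u y * cis (y \<bullet> \<xi>) * gauss (\<epsilon> *\<^sub>R y) \<partial>lborel)
      = (\<integral>y. \<integral>x. u x * cis (x \<bullet> y) * (cis (y \<bullet> \<xi>) * gauss (\<epsilon> *\<^sub>R y)) \<partial>lborel \<partial>lborel)"
    by (simp add: Etrans_def mult.assoc flip: integral_mult_left_zero)
  also have "\<dots> = (\<integral>x. \<integral>y. u x * cis (x \<bullet> y) * (cis (y \<bullet> \<xi>) * gauss (\<epsilon> *\<^sub>R y)) \<partial>lborel \<partial>lborel)"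
  proof (rule Fubini_nn)
    have "(\<integral>\<^sup>+y. \<integral>\<^sup>+x. ennreal (norm (u x * cis (x \<bullet> y) * (cis (y \<bullet> \<xi>) * gauss (\<epsilon> *\<^sub>R y)))) \<partial>lborel \<partial>lborel)
      = (\<integral>\<^sup>+x. ennreal (norm (u x)) \<partial>lborel) * (\<integral>\<^sup>+y. ennreal (norm (gauss (\<epsilon> *\<^sub>R y))) \<partial>(lborel :: 'a measure))"
      by (simp add: norm_mult ennreal_mult nn_integral_multc nn_integral_cmult)
    also have "\<dots> < \<infinity>"
      using u integrable_gauss_scaled[OF \<epsilon>, where 'a='a] by (simp add: integrable_iff_bounded ennreal_mult_less_top)
    finally show "(\<integral>\<^sup>+y. \<integral>\<^sup>+x. ennreal (norm (u x * cis (x \<bullet> y) * (cis (y \<bullet> \<xi>) * gauss (\<epsilon> *\<^sub>R y)))) \<partial>lborel \<partial>lborel) < \<infinity>" .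
  qed (simp_all add: sigma_finite_lborel)
  also have "\<dots> = (\<integral>x. u x * Etrans (\<lambda>y. gauss (\<epsilon> *\<^sub>R y)) (x + \<xi>) \<partial>lborel)"
  proof (intro Bochner_Integration.integral_cong refl)
    fix x :: 'a
    have eq: "u x * cis (x \<bullet> y) * (cis (y \<bullet> \<xi>) * gauss (\<epsilon> *\<^sub>R y)) = u x * (gauss (\<epsilon> *\<^sub>R y) * cis (y \<bullet> (x + \<xi>)))" for y
      by (simp add: inner_add_right inner_commute mult_ac flip: cis_mult)
    show "(\<integral>y. u x * cis (x \<bullet> y) * (cis (y \<bullet> \<xi>) * gauss (\<epsilon> *\<^sub>R y)) \<partial>lborel) = u x * Etrans (\<lambda>y. gauss (\<epsilon> *\<^sub>R y)) (x + \<xi>)"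
      unfolding Etrans_def eq by (rule integral_mult_right_zero)
  qed
  also have "\<dots> = of_real (sqrt (2 * pi) ^ DIM('a) / \<epsilon> ^ DIM('a)) * (\<integral>x. u x * gauss ((x + \<xi>) /\<^sub>R \<epsilon>) \<partial>lborel)"
    unfolding Etrans_gauss_scaled[OF \<epsilon>] by (subst integral_mult_right_zero[symmetric]) (simp only: mult_ac)
  finally show ?thesis .
qed

lemma one_plus_of_nat_neq_0 [simp]: "1 + complex_of_nat n \<noteq> 0"
  by (metis of_nat_Suc of_nat_eq_0_iff nat.distinct(1))

lemma tendsto_inverse_Suc: "(\<lambda>n. 1 / real (Suc n)) \<longlonglongrightarrow> 0"
  using LIMSEQ_inverse_real_of_nat by (simp add: inverse_eq_divide)

text \<open>Boxes are stable under intersection and generate the Borel sets, so by Dynkin's argument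
  \<open>u\<close> has integral 0 over every Borel set.\<close>

lemma lborel_AE_zero_boxes:
  fixes u :: "'a::euclidean_space \<Rightarrow> complex"
  assumes u: "integrable lborel u" and box: "\<And>a b. (\<integral>x. indicator (box a b) x *\<^sub>R u x \<partial>lborel) = 0"
  shows "AE x in lborel. u x = 0"
proof (rule sigma_finite_measure.density_zero[OF sigma_finite_lborel u])
  let ?E = "range (\<lambda>(a, b). box a b :: 'a set)"
  have [measurable]: "u \<in> borel_measurable borel" using borel_measurable_integrable[OF u] by simp
  have int: "integrable lborel (\<lambda>x. indicator A x *\<^sub>R u x)" if "A \<in> sets borel" for A
    using u that by (intro integrable_mult_indicator) auto
  have Un: "(\<lambda>n. \<integral>x. indicator (\<Union>i<n. A i) x *\<^sub>R u x \<partial>lborel) \<longlonglongrightarrow> (\<integral>x. indicator (\<Union>i. A i) x *\<^sub>R u x \<partial>lborel)"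
    if A: "range A \<subseteq> sets borel" for A :: "nat \<Rightarrow> 'a set"
  proof (rule integral_dominated_convergence[where w="\<lambda>x. norm (u x)"])
    have [measurable]: "A i \<in> sets borel" for i using A by auto
    show "(\<lambda>x. indicator (\<Union>i. A i) x *\<^sub>R u x) \<in> borel_measurable lborel" by measurable
    show "(\<lambda>x. indicator (\<Union>i<n. A i) x *\<^sub>R u x) \<in> borel_measurable lborel" for n by measurable
    show "AE x in lborel. (\<lambda>n. indicator (\<Union>i<n. A i) x *\<^sub>R u x) \<longlonglongrightarrow> indicator (\<Union>i. A i) x *\<^sub>R u x"
    proof (intro AE_I2 tendsto_scaleR tendsto_const)
      fix x show "(\<lambda>n. indicator (\<Union>i<n. A i) x :: real) \<longlonglongrightarrow> indicator (\<Union>i. A i) x"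
        by (rule LIMSEQ_indicator_UN)
    qed
    show "integrable lborel (\<lambda>x. norm (u x))" using u by simp
    show "AE x in lborel. norm (indicator (\<Union>i<n. A i) x *\<^sub>R u x) \<le> norm (u x)" for n
      by (intro AE_I2) (simp split: split_indicator)
  qed
  \<comment> \<open>The complement step of the induction needs the integral over the whole space,
    which is exhausted by growing boxes.\<close>
  have UNIV: "(\<integral>x. indicator UNIV x *\<^sub>R u x \<partial>lborel) = 0"
  proof -
    let ?A = "\<lambda>n::nat. box (- (real n *\<^sub>R One)) (real n *\<^sub>R One) :: 'a set"
    have "(\<lambda>n. \<integral>x. indicator (?A n) x *\<^sub>R u x \<partial>lborel) \<longlonglongrightarrow> (\<integral>x. indicator UNIV x *\<^sub>R u x \<partial>lborel)"
    proof (rule integral_dominated_convergence[where w="\<lambda>x. norm (u x)"])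
      show "AE x in lborel. (\<lambda>n. indicator (?A n) x *\<^sub>R u x) \<longlonglongrightarrow> indicator UNIV x *\<^sub>R u x"
      proof (intro AE_I2 tendsto_scaleR tendsto_const)
        fix x
        have "incseq ?A"
          by (intro incseq_SucI subset_box_imp(4)) simp
        from LIMSEQ_indicator_incseq[OF this] show "(\<lambda>n. indicator (?A n) x :: real) \<longlonglongrightarrow> indicator UNIV x"
          by (simp add: UN_box_eq_UNIV)
      qed
      show "integrable lborel (\<lambda>x. norm (u x))" using u by simp
      show "AE x in lborel. norm (indicator (?A n) x *\<^sub>R u x) \<le> norm (u x)" for n
        by (intro AE_I2) (simp split: split_indicator)
    qed measurable
    with box show ?thesis by (simp add: LIMSEQ_const_iff)
  qed
  have Int: "Int_stable ?E" "?E \<subseteq> Pow UNIV" by (auto simp: Int_stable_def box_Int_box)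
  have "(\<integral>x. indicator A x *\<^sub>R u x \<partial>lborel) = 0" if "A \<in> sigma_sets UNIV ?E" for A
    using Int that
  proof (induction rule: sigma_sets_induct_disjoint)
    case (basic A)
    then show ?case using box by auto
  next
    case empty
    then show ?case by simp
  next
    case (compl A)
    then have A: "A \<in> sets borel" by (simp add: borel_eq_box)
    have "(\<integral>x. indicator (UNIV - A) x *\<^sub>R u x \<partial>lborel) = (\<integral>x. indicator UNIV x *\<^sub>R u x - indicator A x *\<^sub>R u x \<partial>lborel)"
      by (intro Bochner_Integration.integral_cong refl) (auto split: split_indicator)
    also have "\<dots> = 0" using compl A UNIV int[of UNIV] by (subst Bochner_Integration.integral_diff[OF int int]) auto
    finally show ?case .
  next
    case (union A)
    then have A: "range A \<subseteq> sets borel" by (auto simp: borel_eq_box)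
    have "(\<integral>x. indicator (\<Union>i<n. A i) x *\<^sub>R u x \<partial>lborel) = 0" for n
    proof -
      have "(\<integral>x. indicator (\<Union>i<n. A i) x *\<^sub>R u x \<partial>lborel) = (\<integral>x. (\<Sum>i<n. indicator (A i) x *\<^sub>R u x) \<partial>lborel)"
      proof (intro Bochner_Integration.integral_cong refl)
        fix x
        have "disjoint_family_on A {..<n}" using union(1) by (auto simp: disjoint_family_on_def)
        then show "indicator (\<Union>i<n. A i) x *\<^sub>R u x = (\<Sum>i<n. indicator (A i) x *\<^sub>R u x)"
          by (simp add: indicator_UN_disjoint scaleR_sum_left)
      qed
      also have "\<dots> = (\<Sum>i<n. \<integral>x. indicator (A i) x *\<^sub>R u x \<partial>lborel)"
        using A by (intro Bochner_Integration.integral_sum int) auto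
      finally show ?thesis using union by simp
    qed
    with Un[OF A] show ?case by (simp add: LIMSEQ_const_iff)
  qed
  then show "set_lebesgue_integral lborel A u = 0" if "A \<in> sets lborel" for A
    using that by (simp add: set_lebesgue_integral_def borel_eq_box)
qed



text \<open>Both sides of the Gaussian identity converge as \<epsilon> tends to 0: on the left
  \<open>Etrans u\<close> dominates, on the right a substitution fixes the Gaussian, and continuity
  together with boundedness of \<open>u\<close> gives the limit.\<close>

lemma Etrans_inversion:
  fixes u :: "'a::euclidean_space \<Rightarrow> complex"
  assumes u: "integrable lborel u" "continuous_on UNIV u" and B: "\<And>x. norm (u x) \<le> B"
    and Eu: "integrable lborel (Etrans u)"
  shows "Etrans (Etrans u) \<xi> = of_real ((2 * pi) ^ DIM('a)) * u (- \<xi>)"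
proof -
  have [measurable]: "u \<in> borel_measurable borel" using borel_measurable_integrable[OF u(1)] by simp
  define s :: complex where "s = of_real (sqrt (2 * pi) ^ DIM('a))"
  let ?e = "\<lambda>n. 1 / real (Suc n)"
  have "(\<lambda>n. \<integral>y. Etrans u y * cis (y \<bullet> \<xi>) * gauss (?e n *\<^sub>R y) \<partial>lborel) \<longlonglongrightarrow> (\<integral>y. Etrans u y * cis (y \<bullet> \<xi>) \<partial>lborel)"
  proof (rule integral_dominated_convergence[where w="\<lambda>y. norm (Etrans u y)"])
    show "AE y in lborel. (\<lambda>n. Etrans u y * cis (y \<bullet> \<xi>) * gauss (?e n *\<^sub>R y)) \<longlonglongrightarrow> Etrans u y * cis (y \<bullet> \<xi>)"
    proof (intro AE_I2)
      fix y :: 'a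
      have "(\<lambda>n. gauss (?e n *\<^sub>R y)) \<longlonglongrightarrow> gauss (0 *\<^sub>R y)"
        unfolding gauss_def by (intro tendsto_intros tendsto_inverse_Suc) simp
      then have "(\<lambda>n. Etrans u y * cis (y \<bullet> \<xi>) * gauss (?e n *\<^sub>R y)) \<longlonglongrightarrow> Etrans u y * cis (y \<bullet> \<xi>) * 1"
        by (intro tendsto_mult tendsto_const) (simp add: gauss_def)
      then show "(\<lambda>n. Etrans u y * cis (y \<bullet> \<xi>) * gauss (?e n *\<^sub>R y)) \<longlonglongrightarrow> Etrans u y * cis (y \<bullet> \<xi>)" by simp
    qed
    show "integrable lborel (\<lambda>y. norm (Etrans u y))" using Eu by simp
    show "AE y in lborel. norm (Etrans u y * cis (y \<bullet> \<xi>) * gauss (?e n *\<^sub>R y)) \<le> norm (Etrans u y)" for n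
      using norm_gauss_le_1[where 'a='a] by (intro AE_I2) (simp add: norm_mult mult_left_le)
  qed measurable
  then have 1: "(\<lambda>n. \<integral>y. Etrans u y * cis (y \<bullet> \<xi>) * gauss (?e n *\<^sub>R y) \<partial>lborel) \<longlonglongrightarrow> Etrans (Etrans u) \<xi>"
    by (simp add: Etrans_def[of "Etrans u"])
  have 2: "(\<integral>y. Etrans u y * cis (y \<bullet> \<xi>) * gauss (?e n *\<^sub>R y) \<partial>lborel)
     = s * (\<integral>x. u (- \<xi> + ?e n *\<^sub>R x) * gauss x \<partial>lborel)" for n
  proof -
    have e: "0 < ?e n" by simp
    \<comment> \<open>The Jacobian of this substitution cancels the factor
      \<open>1 / \<epsilon>^n\<close> of the Gaussian identity.\<close>
    have "(\<integral>x. u x * gauss ((x + \<xi>) /\<^sub>R ?e n) \<partial>lborel)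
       = of_real (\<bar>?e n\<bar> ^ DIM('a)) * (\<integral>x. u (- \<xi> + ?e n *\<^sub>R x) * gauss (((- \<xi> + ?e n *\<^sub>R x) + \<xi>) /\<^sub>R ?e n) \<partial>lborel)"
      by (rule integral_lborel_affine) auto
    also have "\<dots> = of_real (?e n ^ DIM('a)) * (\<integral>x. u (- \<xi> + ?e n *\<^sub>R x) * gauss x \<partial>lborel)"
      by (simp add: add.commute)
    finally show ?thesis
      unfolding Etrans_Etrans_gauss[OF u(1) e] by (simp add: s_def)
  qed
  have "(\<lambda>n. \<integral>x. u (- \<xi> + ?e n *\<^sub>R x) * gauss x \<partial>lborel) \<longlonglongrightarrow> (\<integral>x. u (- \<xi>) * gauss x \<partial>(lborel :: 'a measure))"
  proof (rule integral_dominated_convergence[where w="\<lambda>y::'a. B * norm (gauss y)"])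
    show "AE x in lborel. (\<lambda>n. u (- \<xi> + ?e n *\<^sub>R x) * gauss x) \<longlonglongrightarrow> u (- \<xi>) * gauss x"
    proof (intro AE_I2 tendsto_mult tendsto_const)
      fix x
      have "(\<lambda>n. - \<xi> + ?e n *\<^sub>R x) \<longlonglongrightarrow> - \<xi> + 0 *\<^sub>R x" by (intro tendsto_intros tendsto_inverse_Suc)
      from continuous_on_tendsto_compose[OF u(2) this] show "(\<lambda>n. u (- \<xi> + ?e n *\<^sub>R x)) \<longlonglongrightarrow> u (- \<xi>)" by simp
    qed
    show "integrable lborel (\<lambda>y::'a. B * norm (gauss y))"
      by (intro integrable_mult_right integrable_norm integrable_gauss)
    show "AE x in lborel. norm (u (- \<xi> + ?e n *\<^sub>R x) * gauss x) \<le> B * norm (gauss x)" for n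
    proof (rule AE_I2)
      fix x :: 'a
      show "norm (u (- \<xi> + ?e n *\<^sub>R x) * gauss x) \<le> B * norm (gauss x)"
        unfolding norm_mult by (rule mult_right_mono[OF B norm_ge_zero])
    qed
    show "(\<lambda>x. u (- \<xi> + ?e n *\<^sub>R x) * gauss x) \<in> borel_measurable lborel" for n by measurable
    show "(\<lambda>x. u (- \<xi>) * gauss x) \<in> borel_measurable lborel" by measurable
  qed
  then have "(\<lambda>n. s * (\<integral>x. u (- \<xi> + ?e n *\<^sub>R x) * gauss x \<partial>lborel)) \<longlonglongrightarrow> s * (\<integral>x. u (- \<xi>) * gauss x \<partial>(lborel :: 'a measure))"
    by (intro tendsto_intros)
  also have "s * (\<integral>x. u (- \<xi>) * gauss x \<partial>(lborel :: 'a measure)) = s * s * u (- \<xi>)"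
    by (simp add: integral_gauss s_def)
  also have "s * s = of_real ((2 * pi) ^ DIM('a))"
  proof -
    have "sqrt (2 * pi) ^ DIM('a) * sqrt (2 * pi) ^ DIM('a) = (sqrt (2 * pi) * sqrt (2 * pi)) ^ DIM('a)"
      by (rule power_mult_distrib[symmetric])
    also have "sqrt (2 * pi) * sqrt (2 * pi) = 2 * pi" by (rule real_sqrt_mult_self[THEN trans]) simp
    finally show ?thesis unfolding s_def of_real_mult[symmetric] by (rule arg_cong)
  qed
  finally have "(\<lambda>n. \<integral>y. Etrans u y * cis (y \<bullet> \<xi>) * gauss (?e n *\<^sub>R y) \<partial>lborel)
     \<longlonglongrightarrow> of_real ((2 * pi) ^ DIM('a)) * u (- \<xi>)" by (simp only: 2)
  with 1 show ?thesis by (rule LIMSEQ_unique)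
qed



text \<open>A vanishing transform makes every Gaussian average of \<open>u\<close> vanish. Averaging
  over a box and moving the smoothing onto its indicator by Fubini, the integral of \<open>u\<close>
  over the box appears in the limit; no regularity of \<open>u\<close> enters.\<close>

lemma Etrans_unique:
  fixes u :: "'a::euclidean_space \<Rightarrow> complex"
  assumes u: "integrable lborel u" and Eu: "\<And>\<xi>. Etrans u \<xi> = 0"
  shows "AE x in lborel. u x = 0"
proof (rule lborel_AE_zero_boxes[OF u])
  fix a b :: 'a
  let ?B = "box a b" and ?e = "\<lambda>n. 1 / real (Suc n)"
  have [measurable]: "u \<in> borel_measurable borel" using borel_measurable_integrable[OF u] by simp
  \<comment> \<open>The smoothed indicator of the box in the rescaled variable: it is bounded
    independently of \<open>n\<close>, so it can be dominated.\<close>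
  define W where "W n x = (\<integral>t. indicator ?B (x + ?e n *\<^sub>R t) *\<^sub>R gauss t \<partial>lborel)" for n and x :: 'a
  have Wm [measurable]: "W n \<in> borel_measurable borel" for n unfolding W_def by measurable
  have Wb: "norm (W n x) \<le> (\<integral>t. norm (gauss t) \<partial>(lborel::'a measure))" for n x
  proof -
    have "norm (W n x) \<le> (\<integral>t. norm (indicator ?B (x + ?e n *\<^sub>R t) *\<^sub>R gauss t) \<partial>lborel)"
      unfolding W_def by (rule integral_norm_bound)
    also have "\<dots> \<le> (\<integral>t. norm (gauss t) \<partial>(lborel::'a measure))"
      by (intro integral_mono' integrable_norm integrable_gauss) (auto split: split_indicator)
    finally show ?thesis .
  qed
  have zero: "(\<integral>x. u x * W n x \<partial>lborel) = 0" for n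
  proof -
    have "of_real (?e n ^ DIM('a)) * (\<integral>x. u x * W n x \<partial>lborel)
        = (\<integral>x. u x * (\<integral>z. indicator ?B z *\<^sub>R gauss ((x + (- z)) /\<^sub>R ?e n) \<partial>lborel) \<partial>lborel)"
    proof -
      have *: "(\<integral>z. indicator ?B z *\<^sub>R gauss ((x + (- z)) /\<^sub>R ?e n) \<partial>lborel) = of_real (?e n ^ DIM('a)) * W n x" for x
      proof -
        have "(\<integral>z. indicator ?B z *\<^sub>R gauss ((x + (- z)) /\<^sub>R ?e n) \<partial>lborel)
          = of_real (\<bar>?e n\<bar> ^ DIM('a)) * (\<integral>t. indicator ?B (x + ?e n *\<^sub>R t) *\<^sub>R gauss ((x + (- (x + ?e n *\<^sub>R t))) /\<^sub>R ?e n) \<partial>lborel)"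
          by (rule integral_lborel_affine) auto
        then show ?thesis by (simp add: W_def gauss_def)
      qed
      show ?thesis
        unfolding * by (subst integral_mult_right_zero[symmetric]) (simp only: mult.left_commute)
    qed
    also have "\<dots> = (\<integral>x. \<integral>z. u x * (indicator ?B z *\<^sub>R gauss ((x + (- z)) /\<^sub>R ?e n)) \<partial>lborel \<partial>lborel)"
      by (subst integral_mult_right_zero) simp
    also have "\<dots> = (\<integral>z. \<integral>x. u x * (indicator ?B z *\<^sub>R gauss ((x + (- z)) /\<^sub>R ?e n)) \<partial>lborel \<partial>lborel)"
    proof (rule Fubini_nn)
      have "(\<integral>\<^sup>+x. \<integral>\<^sup>+z. ennreal (norm (u x * (indicator ?B z *\<^sub>R gauss ((x + (- z)) /\<^sub>R ?e n)))) \<partial>lborel \<partial>lborel)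
        \<le> (\<integral>\<^sup>+x. \<integral>\<^sup>+z. ennreal (norm (u x)) * indicator ?B z \<partial>lborel \<partial>lborel)"
        using norm_gauss_le_1[where 'a='a]
        by (intro nn_integral_mono) (auto simp: norm_mult mult_left_le split: split_indicator)
      also have "\<dots> = (\<integral>\<^sup>+x. ennreal (norm (u x)) \<partial>lborel) * emeasure lborel ?B"
        by (simp add: nn_integral_multc nn_integral_cmult)
      also have "\<dots> < \<infinity>" using u emeasure_lborel_box_finite[of a b] by (simp add: integrable_iff_bounded ennreal_mult_less_top less_top)
      finally show "(\<integral>\<^sup>+x. \<integral>\<^sup>+z. ennreal (norm (u x * (indicator ?B z *\<^sub>R gauss ((x + (- z)) /\<^sub>R ?e n)))) \<partial>lborel \<partial>lborel) < \<infinity>" .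
    qed (simp_all add: sigma_finite_lborel)
    also have "\<dots> = (\<integral>z. indicator ?B z *\<^sub>R (\<integral>x. u x * gauss ((x + (- z)) /\<^sub>R ?e n) \<partial>lborel) \<partial>lborel)"
      by (simp add: mult_scaleR_right)
    also have "\<dots> = 0"
    proof -
      have "(\<integral>x. u x * gauss ((x + (- z)) /\<^sub>R ?e n) \<partial>lborel) = 0" for z
        using Etrans_Etrans_gauss[OF u, of "?e n" "-z"] Eu by (simp add: of_nat_Suc[symmetric] del: of_nat_Suc)
      then show ?thesis by simp
    qed
    finally show ?thesis by simp
  qed
  define s :: complex where "s = of_real (sqrt (2 * pi) ^ DIM('a))"
  have "(\<lambda>n. \<integral>x. u x * W n x \<partial>lborel) \<longlonglongrightarrow> (\<integral>x. u x * (indicator ?B x *\<^sub>R s) \<partial>lborel)"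
  proof (rule integral_dominated_convergence[where w="\<lambda>x. norm (u x) * (\<integral>t. norm (gauss t) \<partial>(lborel::'a measure))"])
    \<comment> \<open>Off the frontier the indicator is continuous, so the smoothed indicators
      converge there; the frontier of a convex set is null.\<close>
    have "AE x in lborel. x \<notin> frontier ?B"
    proof (rule AE_not_in)
      have "frontier ?B \<in> null_sets lebesgue"
        using negligible_convex_frontier[of ?B] by (simp add: negligible_iff_null_sets)
      then show "frontier ?B \<in> null_sets lborel" by (simp add: null_sets_completion_iff)
    qed
    then show "AE x in lborel. (\<lambda>n. u x * W n x) \<longlonglongrightarrow> u x * (indicator ?B x *\<^sub>R s)"
    proof eventually_elim
      case (elim x)
      have "(\<lambda>n. W n x) \<longlonglongrightarrow> (\<integral>t. indicator ?B x *\<^sub>R gauss t \<partial>(lborel::'a measure))"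
        unfolding W_def
      proof (rule integral_dominated_convergence[where w="\<lambda>t. norm (gauss t)"])
        show "AE t in lborel. (\<lambda>n. indicator ?B (x + ?e n *\<^sub>R t) *\<^sub>R gauss t) \<longlonglongrightarrow> indicator ?B x *\<^sub>R gauss t"
        proof (intro AE_I2 tendsto_scaleR tendsto_const)
          fix t
          have "(\<lambda>n. x + ?e n *\<^sub>R t) \<longlonglongrightarrow> x + 0 *\<^sub>R t" by (intro tendsto_intros tendsto_inverse_Suc)
          moreover have "isCont (indicator ?B :: 'a \<Rightarrow> real) x"
            using elim by (simp add: isCont_indicator)
          ultimately show "(\<lambda>n. indicator ?B (x + ?e n *\<^sub>R t) :: real) \<longlonglongrightarrow> indicator ?B x"
            using isCont_tendsto_compose[of x "indicator ?B" "\<lambda>n. x + ?e n *\<^sub>R t"] by simp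
        qed
      show "integrable lborel (\<lambda>t::'a. norm (gauss t))" using integrable_gauss by auto
        show "AE t in lborel. norm (indicator ?B (x + ?e n *\<^sub>R t) *\<^sub>R gauss t) \<le> norm (gauss t)" for n
          by (intro AE_I2) (simp split: split_indicator)
      qed measurable
      moreover have "(\<integral>t. indicator ?B x *\<^sub>R gauss t \<partial>(lborel::'a measure)) = indicator ?B x *\<^sub>R s"
        by (simp add: integral_gauss s_def)
      ultimately show ?case by (simp only: tendsto_mult tendsto_const)
    qed
    show "integrable lborel (\<lambda>x. norm (u x) * (\<integral>t. norm (gauss t) \<partial>(lborel::'a measure)))"
      using u by (intro integrable_mult_left integrable_norm)
    show "(\<lambda>x. u x * W n x) \<in> borel_measurable lborel" for n by measurable
    show "(\<lambda>x. u x * (indicator ?B x *\<^sub>R s)) \<in> borel_measurable lborel" by measurable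
    show "AE x in lborel. norm (u x * W n x) \<le> norm (u x) * (\<integral>t. norm (gauss t) \<partial>(lborel::'a measure))" for n
      using Wb by (intro AE_I2) (simp add: norm_mult mult_left_mono)
  qed
  then have "(\<integral>x. u x * (indicator ?B x *\<^sub>R s) \<partial>lborel) = 0"
    by (simp add: zero LIMSEQ_const_iff)
  also have "(\<integral>x. u x * (indicator ?B x *\<^sub>R s) \<partial>lborel) = (\<integral>x. (indicator ?B x *\<^sub>R u x) * s \<partial>lborel)"
    by (intro Bochner_Integration.integral_cong refl) (auto split: split_indicator)
  also have "\<dots> = (\<integral>x. indicator ?B x *\<^sub>R u x \<partial>lborel) * s" by (rule integral_mult_left_zero)
  finally show "(\<integral>x. indicator ?B x *\<^sub>R u x \<partial>lborel) = 0" by (simp add: s_def)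
qed

section \<open>Smooth functions and decay of Fourier transforms\<close>

lemma partial_deriv_eqI:
  "(f has_derivative f') (at x) \<Longrightarrow> partial_deriv i f x = f' (axis i 1)"
  unfolding partial_deriv_def by (metis frechet_derivative_at)

lemma partial_deriv_of_real:
  fixes f :: "real ^ 'n \<Rightarrow> real"
  assumes "f differentiable_on UNIV"
  shows "(\<lambda>x. complex_of_real (f x)) differentiable_on UNIV"
    and "partial_deriv i (\<lambda>x. complex_of_real (f x)) = (\<lambda>x. complex_of_real (partial_deriv i f x))"
proof -
  have d: "(f has_derivative frechet_derivative f (at x)) (at x)" for x
    using assms by (simp add: differentiable_on_def frechet_derivative_works)
  then have D: "((\<lambda>x. complex_of_real (f x)) has_derivative (\<lambda>h. complex_of_real (frechet_derivative f (at x) h))) (at x)" for x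
    by (rule has_derivative_of_real)
  then show "(\<lambda>x. complex_of_real (f x)) differentiable_on UNIV"
    by (auto simp: differentiable_on_def differentiable_def)
  show "partial_deriv i (\<lambda>x. complex_of_real (f x)) = (\<lambda>x. complex_of_real (partial_deriv i f x))"
    by (rule ext, subst partial_deriv_eqI[OF D]) (simp add: partial_deriv_def)
qed

lemma smooth_of_real:
  fixes f :: "real ^ 'n \<Rightarrow> real"
  assumes "smooth f"
  shows "smooth (\<lambda>x. complex_of_real (f x))"
proof -
  have "iter_partial_deriv is (\<lambda>x. complex_of_real (f x)) = (\<lambda>x. complex_of_real (iter_partial_deriv is f x))" for "is"
    using assms by (induction "is") (simp_all add: partial_deriv_of_real smooth_def)
  then show ?thesis using assms by (auto simp: smooth_def intro: partial_deriv_of_real(1))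
qed

text \<open>Closure properties of smooth functions are obtained all at once: this class is closed under
  partial differentiation and hence consists of smooth functions.\<close>

inductive_set smooth_closure :: "(real ^ 'n \<Rightarrow> complex) set" where
  smooth: "smooth f \<Longrightarrow> f \<in> smooth_closure"
| const: "(\<lambda>x. c) \<in> smooth_closure"
| cis: "(\<lambda>x. cis (x \<bullet> a)) \<in> smooth_closure"
| add: "f \<in> smooth_closure \<Longrightarrow> g \<in> smooth_closure \<Longrightarrow> (\<lambda>x. f x + g x) \<in> smooth_closure"
| mult: "f \<in> smooth_closure \<Longrightarrow> g \<in> smooth_closure \<Longrightarrow> (\<lambda>x. f x * g x) \<in> smooth_closure"
| inverse: "f \<in> smooth_closure \<Longrightarrow> (\<And>x. f x \<noteq> 0) \<Longrightarrow> (\<lambda>x. inverse (f x)) \<in> smooth_closure"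
| affine: "f \<in> smooth_closure \<Longrightarrow> (\<lambda>x. f (r *\<^sub>R x + a)) \<in> smooth_closure"

lemma iter_partial_deriv_append:
  "iter_partial_deriv (is @ js) f = iter_partial_deriv is (iter_partial_deriv js f)"
  by (induction "is") simp_all

lemma smooth_partial_deriv: "smooth f \<Longrightarrow> smooth (partial_deriv i f)"
  unfolding smooth_def by (metis iter_partial_deriv_append iter_partial_deriv.simps)

lemma has_derivative_cis [derivative_intros]:
  assumes "(g has_derivative g') (at x within S)"
  shows "((\<lambda>x. cis (g x)) has_derivative (\<lambda>h. \<i> * of_real (g' h) * cis (g x))) (at x within S)"
proof -
  have "(exp has_derivative (\<lambda>h. exp z * h)) (at z)" for z :: complex
    using DERIV_exp[of z] by (simp add: has_field_derivative_def)
  moreover have "((\<lambda>x. \<i> * complex_of_real (g x)) has_derivative (\<lambda>h. \<i> * of_real (g' h))) (at x within S)"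
    by (intro has_derivative_mult_right has_derivative_of_real assms)
  ultimately show ?thesis
    unfolding cis_conv_exp by (auto dest: has_derivative_compose simp: mult.commute)
qed

lemma smooth_closure_deriv:
  fixes f :: "real ^ 'n \<Rightarrow> complex"
  assumes "f \<in> smooth_closure"
  shows "f differentiable (at x)" "partial_deriv i f \<in> smooth_closure"
proof -
  have "(\<forall>x. f differentiable (at x)) \<and> (\<forall>i. partial_deriv i f \<in> smooth_closure)"
    using assms
  proof induction
    case (smooth f)
    have "f differentiable_on UNIV"
      using smooth[unfolded smooth_def, rule_format, of "[]"] by simp
    then show ?case using smooth_partial_deriv[OF smooth]
      by (auto simp: differentiable_on_def intro: smooth_closure.smooth)
  next
    case (const c)
    have D: "((\<lambda>x. c) has_derivative (\<lambda>_. 0)) (at x)" for x :: "real ^ 'n" by simp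
    have "partial_deriv i (\<lambda>x. c) = (\<lambda>x. 0)" for i :: 'n
      by (rule ext, rule partial_deriv_eqI[OF D])
    then show ?case by (auto intro: smooth_closure.const)
  next
    case (cis a)
    have D: "((\<lambda>x. cis (x \<bullet> a)) has_derivative (\<lambda>h. \<i> * of_real (h \<bullet> a) * cis (x \<bullet> a))) (at x)" for x
      by (auto intro!: derivative_eq_intros)
    have "partial_deriv i (\<lambda>x. cis (x \<bullet> a)) = (\<lambda>x. \<i> * of_real (axis i 1 \<bullet> a) * cis (x \<bullet> a))" for i
      by (rule ext, rule partial_deriv_eqI[OF D])
    then show ?case using D by (auto simp: differentiable_def intro: smooth_closure.intros)
  next
    case (add f g)
    then have f: "(f has_derivative frechet_derivative f (at x)) (at x)"
      and g: "(g has_derivative frechet_derivative g (at x)) (at x)" for x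
      by (auto simp: frechet_derivative_works)
    note D = has_derivative_add[OF f g]
    have "partial_deriv i (\<lambda>x. f x + g x) = (\<lambda>x. partial_deriv i f x + partial_deriv i g x)" for i
      by (rule ext, subst partial_deriv_eqI[OF D]) (simp add: partial_deriv_def)
    then show ?case using add D by (auto simp: differentiable_def intro: smooth_closure.add)
  next
    case (mult f g)
    then have f: "(f has_derivative frechet_derivative f (at x)) (at x)"
      and g: "(g has_derivative frechet_derivative g (at x)) (at x)" for x
      by (auto simp: frechet_derivative_works)
    note D = has_derivative_mult[OF f g]
    have "partial_deriv i (\<lambda>x. f x * g x) = (\<lambda>x. f x * partial_deriv i g x + partial_deriv i f x * g x)" for i
      by (rule ext, subst partial_deriv_eqI[OF D]) (simp add: partial_deriv_def)
    then show ?case using mult D by (auto simp: differentiable_def intro!: smooth_closure.add smooth_closure.mult)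
  next
    case (inverse f)
    then have f: "(f has_derivative frechet_derivative f (at x)) (at x)" for x
      by (auto simp: frechet_derivative_works)
    note D = Deriv.has_derivative_inverse[OF inverse(2) f]
    have "partial_deriv i (\<lambda>x. inverse (f x)) = (\<lambda>x. (- 1) * ((inverse (f x) * partial_deriv i f x) * inverse (f x)))" for i
      by (rule ext, subst partial_deriv_eqI[OF D]) (simp add: partial_deriv_def)
    moreover have "(\<lambda>x. (- 1) * ((inverse (f x) * partial_deriv i f x) * inverse (f x))) \<in> smooth_closure" for i
      using inverse by (intro smooth_closure.mult smooth_closure.const smooth_closure.inverse) auto
    ultimately show ?case using D by (auto simp: differentiable_def)
  next
    case (affine f r a)
    then have f: "(f has_derivative frechet_derivative f (at x)) (at x)" for x
      by (auto simp: frechet_derivative_works)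
    have "((\<lambda>x. r *\<^sub>R x + a) has_derivative (\<lambda>h. r *\<^sub>R h)) (at x)" for x
      by (auto intro!: derivative_eq_intros)
    note D = has_derivative_compose[OF this f]
    have "partial_deriv i (\<lambda>x. f (r *\<^sub>R x + a)) = (\<lambda>x. of_real r * partial_deriv i f (r *\<^sub>R x + a))" for i
      unfolding scaleR_conv_of_real[symmetric]
      by (rule ext, subst partial_deriv_eqI[OF D]) (simp add: partial_deriv_def linear_cmul
          bounded_linear.linear[OF has_derivative_bounded_linear[OF f]])
    moreover have "(\<lambda>x. of_real r * partial_deriv i f (r *\<^sub>R x + a)) \<in> smooth_closure" for i
      using affine by (intro smooth_closure.mult smooth_closure.const smooth_closure.affine) auto
    ultimately show ?case using D by (auto simp: differentiable_def)
  qed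
  then show "f differentiable (at x)" "partial_deriv i f \<in> smooth_closure" by auto
qed

lemma smooth_closure_iter: "f \<in> smooth_closure \<Longrightarrow> iter_partial_deriv is f \<in> smooth_closure"
  by (induction "is") (auto intro: smooth_closure_deriv)

lemma smooth_closure_imp_smooth: "f \<in> smooth_closure \<Longrightarrow> smooth f"
  unfolding smooth_def differentiable_on_def
  by (auto intro: smooth_closure_deriv(1)[OF smooth_closure_iter])

lemma smooth_closure_sum:
  "finite I \<Longrightarrow> (\<And>i. i \<in> I \<Longrightarrow> f i \<in> smooth_closure) \<Longrightarrow> (\<lambda>x. \<Sum>i\<in>I. f i x) \<in> smooth_closure"
  by (induction I rule: finite_induct) (auto intro: smooth_closure.const smooth_closure.add)

text \<open>Smooth functions of compact support, built on \<open>smooth_closure\<close> so that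
  products with characters and sums stay inside by the introduction rules.\<close>

definition test_functions :: "(real ^ 'n \<Rightarrow> complex) set" where
  "test_functions = {f \<in> smooth_closure. \<exists>R. \<forall>x. R < norm x \<longrightarrow> f x = 0}"

lemma test_functions_mult:
  "f \<in> test_functions \<Longrightarrow> g \<in> smooth_closure \<Longrightarrow> (\<lambda>x. f x * g x) \<in> test_functions"
  unfolding test_functions_def by (auto intro: smooth_closure.mult)

lemma test_functions_add:
  assumes "f \<in> test_functions" "g \<in> test_functions"
  shows "(\<lambda>x. f x + g x) \<in> test_functions"
proof -
  obtain R S where "\<And>x. R < norm x \<Longrightarrow> f x = 0" "\<And>x. S < norm x \<Longrightarrow> g x = 0"
    using assms by (auto simp: test_functions_def)
  then have "\<forall>x. max R S < norm x \<longrightarrow> f x + g x = 0" by simp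
  then show ?thesis using assms unfolding test_functions_def by (blast intro: smooth_closure.add)
qed

lemma smooth_closure_continuous: "f \<in> smooth_closure \<Longrightarrow> continuous_on S f"
  by (meson continuous_at_imp_continuous_on differentiable_imp_continuous_within smooth_closure_deriv(1))

lemma test_functions_partial_deriv:
  assumes "f \<in> test_functions"
  shows "partial_deriv i f \<in> test_functions"
proof -
  obtain R where R: "\<And>x. R < norm x \<Longrightarrow> f x = 0" using assms by (auto simp: test_functions_def)
  have "partial_deriv i f x = 0" if "R < norm x" for x
  proof -
    have o: "open {x :: real ^ 'n. R < norm x}" by (intro open_Collect_less continuous_intros)
    have "(f has_derivative (\<lambda>_. 0)) (at x)"
      using that R by (intro has_derivative_transform_within_open[OF has_derivative_const o]) simp_all
    then show ?thesis by (rule partial_deriv_eqI)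
  qed
  then show ?thesis using assms smooth_closure_deriv(2) unfolding test_functions_def by blast
qed

lemma test_functions_bounded:
  assumes "f \<in> test_functions"
  obtains B where "\<And>x. norm (f x) \<le> B"
proof -
  obtain R where R: "\<And>x. R < norm x \<Longrightarrow> f x = 0" using assms by (auto simp: test_functions_def)
  have "compact (f ` cball 0 R)"
    using assms by (intro compact_continuous_image smooth_closure_continuous) (auto simp: test_functions_def)
  then have "bounded (f ` cball 0 R)" by (rule compact_imp_bounded)
  then obtain B where "\<forall>x\<in>cball 0 R. norm (f x) \<le> B" by (auto simp: bounded_iff)
  then have B: "norm (f x) \<le> B" if "norm x \<le> R" for x using that by simp
  have "norm (f x) \<le> max B 0" for x using B[of x] R[of x] by (cases "norm x \<le> R") auto
  then show ?thesis using that by blast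
qed

lemma test_functions_schwartz:
  assumes "f \<in> test_functions"
  shows "schwartz f"
  unfolding schwartz_def
proof (intro conjI allI)
  show "smooth f" using assms by (auto simp: test_functions_def intro: smooth_closure_imp_smooth)
  fix N :: nat and "is" :: "'a list"
  have g: "iter_partial_deriv is f \<in> test_functions" (is "?g \<in> _")
    using assms by (induction "is") (auto intro: test_functions_partial_deriv)
  obtain R where R: "\<And>x. R < norm x \<Longrightarrow> ?g x = 0" using g by (auto simp: test_functions_def)
  obtain B where B: "\<And>x. norm (?g x) \<le> B" using test_functions_bounded[OF g] by blast
  have "norm (norm x ^ N *\<^sub>R ?g x) \<le> max R 0 ^ N * B" for x
  proof (cases "R < norm x")
    case True
    have "0 \<le> B" using B[of x] norm_ge_zero[of "?g x"] by linarith
    then show ?thesis using R True by simp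
  next
    case False
    then have "norm x ^ N * norm (?g x) \<le> max R 0 ^ N * B"
      by (intro mult_mono power_mono B) auto
    then show ?thesis by simp
  qed
  then show "bounded (range (\<lambda>x. norm x ^ N *\<^sub>R ?g x))" by (auto simp: bounded_iff)
qed

lemma test_functions_integrable:
  assumes "f \<in> test_functions"
  shows "integrable lborel f"
proof -
  obtain R where R: "\<And>x. R < norm x \<Longrightarrow> f x = 0" using assms by (auto simp: test_functions_def)
  have "integrable lborel (\<lambda>x. indicator (cball 0 R) x *\<^sub>R f x)"
    using assms by (intro borel_integrable_compact[of "cball 0 R" f, simplified] smooth_closure_continuous)
      (auto simp: test_functions_def)
  also have "(\<lambda>x. indicator (cball 0 R) x *\<^sub>R f x) = f"
    using R by (auto simp: fun_eq_iff indicator_def not_le)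
  finally show ?thesis .
qed

lemma test_functions_measurable: "f \<in> test_functions \<Longrightarrow> f \<in> borel_measurable borel"
  by (auto simp: test_functions_def intro: borel_measurable_continuous_onI smooth_closure_continuous)

text \<open>Difference quotients integrate to 0 by translation invariance, and they converge
  dominatedly because the mean value theorem bounds them by the supremum of the derivative.\<close>

lemma integral_partial_deriv_eq_0:
  fixes v :: "real ^ 'n \<Rightarrow> complex"
  assumes v: "v \<in> test_functions"
  shows "(\<integral>x. partial_deriv i v x \<partial>lborel) = 0"
proof -
  let ?e = "\<lambda>n. 1 / real (Suc n)" and ?b = "axis i 1 :: real ^ 'n"
  let ?w = "\<lambda>n x. of_real (real (Suc n)) * (v (?e n *\<^sub>R ?b + 1 *\<^sub>R x) - v x)"
  have [measurable]: "v \<in> borel_measurable borel" "partial_deriv i v \<in> borel_measurable borel"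
    using v by (auto intro: test_functions_measurable test_functions_partial_deriv)
  obtain R where R: "\<And>x. R < norm x \<Longrightarrow> v x = 0" using v by (auto simp: test_functions_def)
  obtain B where B: "\<And>x. norm (partial_deriv i v x) \<le> B"
    using test_functions_bounded[OF test_functions_partial_deriv[OF v]] by blast
  have D: "((\<lambda>t. v (t *\<^sub>R ?b + x)) has_derivative (\<lambda>h. h *\<^sub>R partial_deriv i v (t *\<^sub>R ?b + x))) (at t within S)" for x t S
  proof -
    have f: "(v has_derivative frechet_derivative v (at y)) (at y)" for y
      using v smooth_closure_deriv(1) by (auto simp: frechet_derivative_works test_functions_def)
    have "((\<lambda>t. t *\<^sub>R ?b + x) has_derivative (\<lambda>h. h *\<^sub>R ?b)) (at t within S)"
      by (auto intro!: derivative_eq_intros)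
    from has_derivative_compose[OF this f] show ?thesis
      by (simp add: partial_deriv_def linear_cmul bounded_linear.linear[OF has_derivative_bounded_linear[OF f]])
  qed
  have int: "integrable lborel (\<lambda>x. v (?e n *\<^sub>R ?b + 1 *\<^sub>R x))" for n
    by (rule integrable_lborel_affine[OF test_functions_integrable[OF v]]) simp
  have "(\<integral>x. ?w n x \<partial>lborel) = 0" for n
    using integral_lborel_affine[of v 1 "?e n *\<^sub>R ?b"] int[of n] test_functions_integrable[OF v] by simp
  moreover have "(\<lambda>n. \<integral>x. ?w n x \<partial>lborel) \<longlonglongrightarrow> (\<integral>x. partial_deriv i v x \<partial>lborel)"
  \<comment> \<open>Steps have length at most 1, so all difference quotients vanish outside the ball
    of radius \<open>R + 1\<close>.\<close>
  proof (rule integral_dominated_convergence[where w="\<lambda>x. B * indicator (cball 0 (R + 1)) x"])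
    show "integrable lborel (\<lambda>x :: real ^ 'n. B * indicator (cball 0 (R + 1)) x)"
      using emeasure_lborel_cball_finite[of "0 :: real ^ 'n" "R + 1"]
      by (intro integrable_mult_right integrable_real_indicator) (auto simp: less_top)
    show "AE x in lborel. (\<lambda>n. ?w n x) \<longlonglongrightarrow> partial_deriv i v x"
    proof (rule AE_I2)
      fix x
      have "((\<lambda>h. norm (v (h *\<^sub>R ?b + x) - v x - h *\<^sub>R partial_deriv i v x) / norm h) \<longlongrightarrow> 0) (at 0)"
        using D[of x 0 UNIV] by (simp add: has_derivative_at)
      then have "((\<lambda>h. norm ((v (h *\<^sub>R ?b + x) - v x) /\<^sub>R h - partial_deriv i v x)) \<longlongrightarrow> 0) (at 0)"
      proof (rule Lim_transform_eventually)
        have "norm (v (h *\<^sub>R ?b + x) - v x - h *\<^sub>R partial_deriv i v x) / norm h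
            = norm ((v (h *\<^sub>R ?b + x) - v x) /\<^sub>R h - partial_deriv i v x)" if "h \<noteq> 0" for h
        proof -
          have "(v (h *\<^sub>R ?b + x) - v x) /\<^sub>R h - partial_deriv i v x
              = (v (h *\<^sub>R ?b + x) - v x - h *\<^sub>R partial_deriv i v x) /\<^sub>R h"
            using that by (simp add: scaleR_diff_right)
          then show ?thesis by (simp add: divide_inverse mult.commute)
        qed
        then show "\<forall>\<^sub>F h in at 0. norm (v (h *\<^sub>R ?b + x) - v x - h *\<^sub>R partial_deriv i v x) / norm h
            = norm ((v (h *\<^sub>R ?b + x) - v x) /\<^sub>R h - partial_deriv i v x)"
          unfolding eventually_at_filter by (intro always_eventually allI impI)
      qed
      then have "((\<lambda>h. (v (h *\<^sub>R ?b + x) - v x) /\<^sub>R h) \<longlongrightarrow> partial_deriv i v x) (at 0)"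
        by (simp only: tendsto_norm_zero_iff LIM_zero_iff)
      moreover have "filterlim ?e (at 0) sequentially"
        using tendsto_inverse_Suc by (auto simp: filterlim_at)
      ultimately have "(\<lambda>n. (v (?e n *\<^sub>R ?b + x) - v x) /\<^sub>R ?e n) \<longlonglongrightarrow> partial_deriv i v x"
        by (rule filterlim_compose)
      then show "(\<lambda>n. ?w n x) \<longlonglongrightarrow> partial_deriv i v x"
        by (simp add: scaleR_conv_of_real)
    qed
    show "AE x in lborel. norm (?w n x) \<le> B * indicator (cball 0 (R + 1)) x" for n
    proof (rule AE_I2)
      fix x
      show "norm (?w n x) \<le> B * indicator (cball 0 (R + 1)) x"
      proof (cases "norm x \<le> R + 1")
        case True
        have e: "0 < ?e n" by simp
        have c: "continuous_on {0..?e n} (\<lambda>t. v (t *\<^sub>R ?b + x))"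
          by (rule has_derivative_continuous_on[OF D])
        obtain t where
          "norm (v (?e n *\<^sub>R ?b + x) - v (0 *\<^sub>R ?b + x)) \<le> norm ((?e n - 0) *\<^sub>R partial_deriv i v (t *\<^sub>R ?b + x))"
          using mvt_general[OF e c D] by blast
        also have "\<dots> \<le> ?e n * B" using B by (simp add: divide_right_mono)
        finally have "real (Suc n) * norm (v (?e n *\<^sub>R ?b + x) - v x) \<le> B" by (simp add: field_simps)
        then show ?thesis using True by (simp add: norm_mult del: of_nat_Suc)
      next
        case False
        have "norm x \<le> norm (?e n *\<^sub>R ?b + x) + norm (?e n *\<^sub>R ?b)"
          using norm_triangle_ineq4[of "?e n *\<^sub>R ?b + x" "?e n *\<^sub>R ?b"] by simp
        moreover have "norm (?e n *\<^sub>R ?b) \<le> 1" by (simp add: norm_axis_1)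
        ultimately have "R < norm (?e n *\<^sub>R ?b + x)" using False by linarith
        then show ?thesis using False R by simp
      qed
    qed
  qed measurable
  ultimately show ?thesis by (simp add: LIMSEQ_const_iff)
qed

text \<open>Integration by parts: the derivative of \<open>u x * cis (x \<bullet> \<xi>)\<close> has
  integral 0, and the product rule splits it into the two transforms.\<close>

lemma Etrans_partial_deriv:
  fixes u :: "real ^ 'n \<Rightarrow> complex"
  assumes u: "u \<in> test_functions"
  shows "Etrans (partial_deriv i u) \<xi> = - \<i> * of_real (\<xi> $ i) * Etrans u \<xi>"
proof -
  have f: "(u has_derivative frechet_derivative u (at y)) (at y)" for y
    using u smooth_closure_deriv(1) by (auto simp: frechet_derivative_works test_functions_def)
  have g: "((\<lambda>x. cis (x \<bullet> \<xi>)) has_derivative (\<lambda>h. \<i> * of_real (h \<bullet> \<xi>) * cis (x \<bullet> \<xi>))) (at x)" for x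
    by (auto intro!: derivative_eq_intros)
  note D = has_derivative_mult[OF f g]
  have eq: "partial_deriv i (\<lambda>x. u x * cis (x \<bullet> \<xi>))
      = (\<lambda>x. partial_deriv i u x * cis (x \<bullet> \<xi>) + (\<i> * of_real (\<xi> $ i)) * (u x * cis (x \<bullet> \<xi>)))"
    by (rule ext, subst partial_deriv_eqI[OF D]) (simp add: partial_deriv_def inner_axis' mult_ac add.commute)
  have i1: "integrable lborel (\<lambda>x. u x * cis (x \<bullet> \<xi>))"
    "integrable lborel (\<lambda>x. partial_deriv i u x * cis (x \<bullet> \<xi>))"
    using u by (intro integrable_mult_cis[OF test_functions_integrable]; simp add: test_functions_partial_deriv)+
  have "0 = (\<integral>x. partial_deriv i (\<lambda>x. u x * cis (x \<bullet> \<xi>)) x \<partial>lborel)"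
    using test_functions_mult[OF u smooth_closure.cis] by (simp add: integral_partial_deriv_eq_0)
  also have "\<dots> = Etrans (partial_deriv i u) \<xi> + (\<i> * of_real (\<xi> $ i)) * Etrans u \<xi>"
    unfolding eq Etrans_def using i1 by simp
  finally show ?thesis by (simp add: eq_neg_iff_add_eq_0)
qed

text \<open>A product over the coordinates, so that integrability reduces to that of
  \<open>1 / (1 + t^2)\<close> on the line.\<close>

definition decay :: "'a::euclidean_space \<Rightarrow> real" where
  "decay x = (\<Prod>b\<in>Basis. inverse (1 + (x \<bullet> b)\<^sup>2))"

lemma decay_measurable [measurable]: "decay \<in> borel_measurable borel"
  unfolding decay_def by measurable

lemma decay_pos: "0 < decay x"
  unfolding decay_def by (intro prod_pos) (auto intro: add_pos_nonneg)

lemma integrable_decay: "integrable lborel (decay :: 'a::euclidean_space \<Rightarrow> real)"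
proof (intro integrableI_bounded)
  have 1: "(\<integral>\<^sup>+x. ennreal (inverse (1 + x\<^sup>2)) \<partial>lborel) < \<infinity>"
    using integrable_inverse_1_plus_square
    by (simp add: set_integrable_def einterval_def integrable_iff_bounded add_nonneg_nonneg)
  have "(\<integral>\<^sup>+x. ennreal (norm (decay x)) \<partial>(lborel :: 'a measure)) = (\<integral>\<^sup>+x. (\<Prod>b\<in>Basis. ennreal (inverse (1 + (x \<bullet> b)\<^sup>2))) \<partial>(lborel :: 'a measure))"
    using decay_pos[where 'a='a] by (intro nn_integral_cong) (simp add: decay_def prod_ennreal abs_of_pos prod_nonneg)
  also have "\<dots> = (\<Prod>b\<in>(Basis::'a set). \<integral>\<^sup>+x. ennreal (inverse (1 + x\<^sup>2)) \<partial>lborel)"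
    by (rule nn_integral_lborel_prod) auto
  also have "\<dots> < \<infinity>"
    using 1 by (simp add: power_less_top_ennreal)
  finally show "(\<integral>\<^sup>+x. ennreal (norm (decay x)) \<partial>(lborel :: 'a measure)) < \<infinity>" .
qed measurable

text \<open>Applying \<open>1 - \<partial>^2\<close> in the direction \<open>i\<close> multiplies
  the transform by \<open>1 + (\<xi> $ i)^2\<close>. Doing so once for every coordinate gives a test
  function, whose transform is bounded.\<close>

lemma Etrans_decay:
  fixes u :: "real ^ 'n \<Rightarrow> complex"
  assumes u: "u \<in> test_functions"
  obtains C where "\<And>\<xi>. norm (Etrans u \<xi>) \<le> C * decay \<xi>"
proof -
  have "\<exists>v\<in>test_functions. \<forall>\<xi>. Etrans v \<xi> = of_real (\<Prod>i\<in>A. 1 + (\<xi> $ i)\<^sup>2) * Etrans u \<xi>"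
    if "finite A" for A
    using that
  proof induction
    case empty
    then show ?case using u by auto
  next
    case (insert i A)
    then obtain v where v: "v \<in> test_functions"
      "\<And>\<xi>. Etrans v \<xi> = of_real (\<Prod>i\<in>A. 1 + (\<xi> $ i)\<^sup>2) * Etrans u \<xi>" by blast
    let ?w = "\<lambda>x. v x + partial_deriv i (partial_deriv i v) x * (- 1)"
    have w: "?w \<in> test_functions"
      using v by (intro test_functions_add test_functions_mult test_functions_partial_deriv smooth_closure.const)
    have "Etrans ?w \<xi> = Etrans v \<xi> - Etrans (partial_deriv i (partial_deriv i v)) \<xi>" for \<xi>
    proof -
      have "integrable lborel (\<lambda>x. v x * cis (x \<bullet> \<xi>))"
        "integrable lborel (\<lambda>x. partial_deriv i (partial_deriv i v) x * cis (x \<bullet> \<xi>))"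
        using v by (intro integrable_mult_cis[OF test_functions_integrable]; simp add: test_functions_partial_deriv)+
      then show ?thesis by (simp add: Etrans_def algebra_simps)
    qed
    also have "Etrans v \<xi> - Etrans (partial_deriv i (partial_deriv i v)) \<xi> = of_real (1 + (\<xi> $ i)\<^sup>2) * Etrans v \<xi>" for \<xi>
      using v(1) by (simp add: Etrans_partial_deriv test_functions_partial_deriv power2_eq_square algebra_simps)
    finally show ?case using insert w v(2) by (intro bexI[of _ ?w]) (auto simp: mult_ac)
  qed
  from this[of UNIV] obtain v where v: "v \<in> test_functions"
    "\<And>\<xi>. Etrans v \<xi> = of_real (\<Prod>i\<in>UNIV. 1 + (\<xi> $ i)\<^sup>2) * Etrans u \<xi>" by auto
  have decay: "decay \<xi> = inverse (\<Prod>i\<in>UNIV. 1 + (\<xi> $ i)\<^sup>2)" for \<xi> :: "real ^ 'n"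
  proof -
    have B: "(Basis :: (real ^ 'n) set) = (\<lambda>i. axis i 1) ` UNIV" by (auto simp: Basis_vec_def)
    have "decay \<xi> = (\<Prod>i\<in>UNIV. inverse (1 + (\<xi> $ i)\<^sup>2))"
      unfolding decay_def B by (subst prod.reindex; simp add: inj_on_def axis_eq_axis inner_axis)
    then show ?thesis by (simp add: prod_inversef[symmetric] o_def)
  qed
  have pos: "(\<Prod>i\<in>UNIV. 1 + (\<xi> $ i)\<^sup>2) > 0" for \<xi> :: "real ^ 'n"
    by (intro prod_pos) (auto intro: add_pos_nonneg)
  have "norm (Etrans u \<xi>) \<le> (\<integral>x. norm (v x) \<partial>lborel) * decay \<xi>" for \<xi>
    using norm_Etrans_le[of v \<xi>, unfolded v(2) norm_mult norm_of_real abs_of_pos[OF pos]] pos[of \<xi>]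
    by (simp add: decay field_simps)
  then show ?thesis using that by blast
qed

section \<open>Sums over the lattice and weights\<close>

text \<open>Makes the sums in the modulation norm accessible to Minkowski and Tonelli. An injection
  into the naturals supplies an increasing sequence of finite sets, to which monotone convergence
  applies.\<close>

lemma infsum_conv_nn_integral:
  fixes f :: "'a \<Rightarrow> ennreal"
  assumes "countable (UNIV :: 'a set)"
  shows "(\<Sum>\<^sub>\<infinity>k. f k) = (\<integral>\<^sup>+k. f k \<partial>count_space UNIV)"
proof (rule antisym)
  have fin: "sum f F = (\<integral>\<^sup>+k. f k * indicator F k \<partial>count_space UNIV)" if "finite F" for F
    using that by (subst nn_integral_count_space'[of F]) (auto simp: indicator_def intro!: sum.cong)
  have sup: "(\<Sum>\<^sub>\<infinity>k. f k) = (SUP F\<in>{F. finite F \<and> F \<subseteq> UNIV}. sum f F)"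
    by (rule nonneg_infsum_complete) auto
  show "(\<Sum>\<^sub>\<infinity>k. f k) \<le> (\<integral>\<^sup>+k. f k \<partial>count_space UNIV)"
    unfolding sup
  proof (rule SUP_least)
    fix F assume "F \<in> {F. finite F \<and> F \<subseteq> (UNIV :: 'a set)}"
    then have "sum f F = (\<integral>\<^sup>+k. f k * indicator F k \<partial>count_space UNIV)" by (simp add: fin)
    also have "\<dots> \<le> (\<integral>\<^sup>+k. f k \<partial>count_space UNIV)"
      by (intro nn_integral_mono) (simp split: split_indicator)
    finally show "sum f F \<le> (\<integral>\<^sup>+k. f k \<partial>count_space UNIV)" .
  qed
  obtain g :: "'a \<Rightarrow> nat" where g: "inj g" using assms by (auto simp: countable_def)
  define F where "F n = {x. g x < n}" for n
  have F: "finite (F n)" for n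
    using finite_vimageI[OF finite_lessThan[of n] g] by (simp add: F_def vimage_def)
  have "(\<integral>\<^sup>+k. f k \<partial>count_space UNIV) = (\<integral>\<^sup>+k. (SUP n. f k * indicator (F n) k) \<partial>count_space UNIV)"
  proof (intro nn_integral_cong)
    fix k
    have "f k * indicator (F (Suc (g k))) k \<le> (SUP n. f k * indicator (F n) k)" by (rule SUP_upper) simp
    then have "f k \<le> (SUP n. f k * indicator (F n) k)" by (simp add: F_def)
    moreover have "(SUP n. f k * indicator (F n) k) \<le> f k" by (rule SUP_least) (auto split: split_indicator)
    ultimately show "f k = (SUP n. f k * indicator (F n) k)" by (rule antisym)
  qed
  also have "\<dots> = (SUP n. \<integral>\<^sup>+k. f k * indicator (F n) k \<partial>count_space UNIV)"
    by (intro nn_integral_monotone_convergence_SUP) (auto simp: incseq_def le_fun_def F_def split: split_indicator)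
  also have "\<dots> \<le> (\<Sum>\<^sub>\<infinity>k. f k)"
    unfolding sup fin[OF F, symmetric] using F by (intro SUP_least SUP_upper) simp
  finally show "(\<integral>\<^sup>+k. f k \<partial>count_space UNIV) \<le> (\<Sum>\<^sub>\<infinity>k. f k)" .
qed

section \<open>Summability over the lattice\<close>

lemma countable_UNIV_int_vec: "countable (UNIV :: (int ^ 'n) set)"
proof -
  have "countable (UNIV :: ('n \<Rightarrow> int) set)"
    using countable_PiE[of "UNIV :: 'n set" "\<lambda>_. UNIV :: int set"] by (simp add: PiE_UNIV_domain)
  then have "countable (range (vec_lambda :: ('n \<Rightarrow> int) \<Rightarrow> int ^ 'n))" by simp
  moreover have "range (vec_lambda :: ('n \<Rightarrow> int) \<Rightarrow> int ^ 'n) = UNIV"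
    by (metis surj_def vec_lambda_eta)
  ultimately show ?thesis by simp
qed

lemma abs_summable_inverse_square_int: "Infinite_Set_Sum.abs_summable_on (\<lambda>m::int. inverse (1 + (real_of_int m)\<^sup>2)) UNIV"
proof -
  have nat: "Infinite_Set_Sum.abs_summable_on (\<lambda>m::nat. inverse (1 + (real m)\<^sup>2)) UNIV"
    unfolding abs_summable_on_nat_iff'
  proof (rule summable_comparison_test')
    show "summable (\<lambda>n. 1 / (real n)\<^sup>2)" using inverse_power_summable[of 2] by (simp add: field_simps)
    fix n :: nat assume "1 \<le> n"
    then show "norm (norm (inverse (1 + (real n)\<^sup>2))) \<le> 1 / (real n)\<^sup>2"
      by (auto simp: inverse_eq_divide intro!: divide_left_mono mult_pos_pos add_pos_nonneg)
  qed
  have "Infinite_Set_Sum.abs_summable_on (\<lambda>m::int. inverse (1 + (real_of_int m)\<^sup>2)) (range int)"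
    using nat abs_summable_on_reindex_iff[of int UNIV "\<lambda>m. inverse (1 + (real_of_int m)\<^sup>2)"] by simp
  moreover have "Infinite_Set_Sum.abs_summable_on (\<lambda>m::int. inverse (1 + (real_of_int m)\<^sup>2)) (range (\<lambda>n. - int n))"
    using nat abs_summable_on_reindex_iff[of "\<lambda>n. - int n" UNIV "\<lambda>m. inverse (1 + (real_of_int m)\<^sup>2)"]
    by (simp add: inj_on_def)
  ultimately have "Infinite_Set_Sum.abs_summable_on (\<lambda>m::int. inverse (1 + (real_of_int m)\<^sup>2)) (range int \<union> range (\<lambda>n. - int n))"
    by (rule abs_summable_on_union)
  moreover have "range int \<union> range (\<lambda>n. - int n) = UNIV"
  proof -
    have "m \<in> range int \<union> range (\<lambda>n. - int n)" for m by (cases m rule: int_cases2) auto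
    then show ?thesis by blast
  qed
  ultimately show ?thesis by simp
qed

text \<open>The lattice is a product, and a product of absolutely summable functions of the separate
  coordinates is absolutely summable.\<close>

lemma nn_integral_lattice_decay:
  "(\<integral>\<^sup>+k. ennreal (\<Prod>i\<in>UNIV. inverse (1 + (real_of_int (k $ i))\<^sup>2)) \<partial>count_space (UNIV :: (int ^ 'n) set)) < \<infinity>"
proof -
  have "Infinite_Set_Sum.abs_summable_on (\<lambda>g. \<Prod>i\<in>(UNIV :: 'n set). inverse (1 + (real_of_int (g i))\<^sup>2)) (PiE UNIV (\<lambda>_. UNIV))"
    by (rule abs_summable_on_prod_PiE) (auto intro: abs_summable_inverse_square_int)
  then have "Infinite_Set_Sum.abs_summable_on (\<lambda>g. \<Prod>i\<in>(UNIV :: 'n set). inverse (1 + (real_of_int (g i))\<^sup>2)) UNIV"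
    by (simp add: PiE_UNIV_domain)
  moreover have "bij_betw (vec_nth :: int ^ 'n \<Rightarrow> _) UNIV UNIV"
    by (rule bij_betwI[of _ _ _ vec_lambda]) auto
  ultimately have "Infinite_Set_Sum.abs_summable_on (\<lambda>k::int ^ 'n. \<Prod>i\<in>(UNIV :: 'n set). inverse (1 + (real_of_int (k $ i))\<^sup>2)) UNIV"
    by (subst abs_summable_on_reindex_bij_betw[where g=vec_nth and B=UNIV]) auto
  then show ?thesis
    by (simp add: abs_summable_on_def integrable_iff_bounded prod_nonneg abs_of_nonneg)
qed

text \<open>The weight eventually exceeds any multiple of the logarithm, hence
  \<open>exp (- b * w t)\<close> decays faster than any prescribed power.\<close>

lemma weight_class_ln_growth:
  assumes w: "w \<in> weight_class" and b: "0 < b"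
  obtains C where "0 \<le> C" "\<And>t. 0 \<le> t \<Longrightarrow> exp (- b * w t) \<le> C * inverse (1 + t\<^sup>2) ^ n"
proof -
  \<comment> \<open>With this multiple, \<open>b * (M * ln t)\<close> equals
    \<open>2 * n * ln t\<close>, which produces the decay \<open>t^(- 2 n)\<close>.\<close>
  define M where "M = 2 * real n / b"
  have "filterlim (\<lambda>t. w t - M * ln t) at_top at_top" using w by (simp add: weight_class_def)
  then have "eventually (\<lambda>t. 0 \<le> w t - M * ln t) at_top" unfolding filterlim_at_top by (rule spec)
  then obtain T0 where T0: "\<And>t. T0 \<le> t \<Longrightarrow> M * ln t \<le> w t" by (auto simp: eventually_at_top_linorder)
  define T where "T = max 1 T0"
  have T: "1 \<le> T" by (simp add: T_def)
  have "\<forall>t\<ge>0. 1 \<le> w t" using w by (simp add: weight_class_def)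
  then have w0: "0 \<le> w t" if "0 \<le> t" for t using that by force
  \<comment> \<open>The first entry serves \<open>t \<ge> T\<close>, where
    \<open>1 + t^2 \<le> 2 * t^2\<close>; the second serves \<open>t < T\<close>, where the
    exponential is merely bounded by 1.\<close>
  define C where "C = max (2 ^ n) ((1 + T\<^sup>2) ^ n)"
  have "exp (- b * w t) \<le> C * inverse (1 + t\<^sup>2) ^ n" if t: "0 \<le> t" for t
  proof (cases "T \<le> t")
    case True
    then have t1: "1 \<le> t" using T by simp
    have "2 * real n * ln t = b * (M * ln t)" using b by (simp add: M_def)
    also have "\<dots> \<le> b * w t" using True b T0 by (intro mult_left_mono) (auto simp: T_def)
    finally have "exp (- b * w t) \<le> exp (- (real (2 * n) * ln t))" by simp
    also have "\<dots> = inverse (exp (ln t) ^ (2 * n))"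
      by (simp only: exp_minus exp_of_nat_mult)
    also have "\<dots> = inverse (t ^ (2 * n))" using t1 by simp
    also have "\<dots> = inverse (t\<^sup>2) ^ n" by (simp add: power_mult power_inverse)
    also have "\<dots> \<le> (2 * inverse (1 + t\<^sup>2)) ^ n"
    proof (rule power_mono)
      have "1 \<le> t\<^sup>2" using t1 by (simp add: one_le_power)
      then have "inverse (2 * t\<^sup>2) \<le> inverse (1 + t\<^sup>2)" by (intro le_imp_inverse_le) linarith+
      then show "inverse (t\<^sup>2) \<le> 2 * inverse (1 + t\<^sup>2)" by simp
    qed simp
    also have "\<dots> \<le> C * inverse (1 + t\<^sup>2) ^ n"
      by (auto simp: power_mult_distrib C_def intro!: mult_right_mono)
    finally show ?thesis .
  next
    case False
    have "exp (- b * w t) \<le> 1" using b w0[OF t] by simp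
    also have "1 \<le> ((1 + T\<^sup>2) * inverse (1 + t\<^sup>2)) ^ n"
    proof (rule one_le_power)
      have "t\<^sup>2 \<le> T\<^sup>2" using False t by (intro power_mono) auto
      moreover have "0 < 1 + t\<^sup>2" by (simp add: add_pos_nonneg)
      ultimately show "1 \<le> (1 + T\<^sup>2) * inverse (1 + t\<^sup>2)" by (simp add: field_simps)
    qed
    also have "\<dots> \<le> C * inverse (1 + t\<^sup>2) ^ n"
      by (auto simp: power_mult_distrib C_def intro!: mult_right_mono)
    finally show ?thesis .
  qed
  moreover have "0 \<le> C" by (simp add: C_def le_max_iff_disj)
  ultimately show ?thesis using that by blast
qed

text \<open>The power \<open>CARD('n)\<close> provides one factor \<open>1 / (1 + |k|^2)\<close> per
  coordinate, and each is at most \<open>1 / (1 + (k $ i)^2)\<close>.\<close>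

lemma weight_class_summable:
  fixes w :: "real \<Rightarrow> real"
  assumes w: "w \<in> weight_class" and b: "0 < b"
  shows "(\<integral>\<^sup>+k. ennreal (exp (- b * w (norm (lattice_point k)))) \<partial>count_space (UNIV :: (int ^ 'n) set)) < \<infinity>"
proof -
  obtain C where C: "0 \<le> C" "\<And>t. 0 \<le> t \<Longrightarrow> exp (- b * w t) \<le> C * inverse (1 + t\<^sup>2) ^ CARD('n)"
    using weight_class_ln_growth[OF w b] by metis
  have "exp (- b * w (norm (lattice_point k))) \<le> C * (\<Prod>i\<in>UNIV. inverse (1 + (real_of_int (k $ i))\<^sup>2))" for k :: "int ^ 'n"
  proof -
    have "exp (- b * w (norm (lattice_point k))) \<le> C * inverse (1 + (norm (lattice_point k))\<^sup>2) ^ CARD('n)"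
      by (rule C) simp
    also have "inverse (1 + (norm (lattice_point k))\<^sup>2) ^ CARD('n) = (\<Prod>i\<in>(UNIV::'n set). inverse (1 + (norm (lattice_point k))\<^sup>2))"
      by simp
    also have "\<dots> \<le> (\<Prod>i\<in>UNIV. inverse (1 + (real_of_int (k $ i))\<^sup>2))"
    proof (intro prod_mono conjI le_imp_inverse_le add_left_mono)
      fix i
      have "\<bar>real_of_int (k $ i)\<bar> \<le> norm (lattice_point k)"
        using component_le_norm_cart[of "lattice_point k" i] by (simp add: lattice_point_def)
      then show "(real_of_int (k $ i))\<^sup>2 \<le> (norm (lattice_point k))\<^sup>2"
        by (metis abs_ge_zero power2_abs power_mono)
    qed (auto intro: add_pos_nonneg add_nonneg_nonneg)
    finally show ?thesis using C by (simp add: mult_left_mono)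
  qed
  then have "(\<integral>\<^sup>+k. ennreal (exp (- b * w (norm (lattice_point k)))) \<partial>count_space (UNIV :: (int ^ 'n) set))
    \<le> (\<integral>\<^sup>+k. ennreal C * ennreal (\<Prod>i\<in>UNIV. inverse (1 + (real_of_int (k $ i))\<^sup>2)) \<partial>count_space (UNIV :: (int ^ 'n) set))"
    using C by (intro nn_integral_mono) (simp add: ennreal_leI prod_nonneg flip: ennreal_mult)
  also have "\<dots> < \<infinity>"
    using nn_integral_lattice_decay[where 'n='n] by (simp add: nn_integral_cmult ennreal_mult_less_top)
  finally show ?thesis .
qed

text \<open>Beyond \<open>t0\<close> the weight is concave, so the increment over a step
  \<open>y + R\<close> only grows when the starting point is moved down from \<open>x\<close> to
  \<open>y\<close>. This leaves \<open>w (2 * y + R) - w y\<close>, which regular variation with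
  index below 1 bounds by \<open>c * w y\<close> for large \<open>y\<close>. Bounded
  \<open>y\<close> are absorbed by \<open>C\<close>.\<close>

lemma weight_class_almost_subadditive:
  assumes w: "w \<in> weight_class" and R: "0 \<le> R"
  obtains c C where "0 \<le> c" "c < 1" "0 \<le> C"
    "\<And>x y. 0 \<le> y \<Longrightarrow> y \<le> x \<Longrightarrow> w (x + y + R) \<le> w x + c * w y + C"
proof -
  have mono: "w x \<le> w y" if "0 \<le> x" "x \<le> y" for x y
    using w that by (cases "x = y") (auto simp: weight_class_def strict_mono_on_def less_imp_le)
  have "\<forall>t\<ge>0. 1 \<le> w t" using w by (simp add: weight_class_def)
  then have pos: "0 < w x" if "0 \<le> x" for x using that by force
  have smooth: "(deriv ^^ m) w differentiable (at x)" if "0 < x" for m x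
    using w that by (auto simp: weight_class_def)
  have D1: "(w has_real_derivative deriv w x) (at x)" if "0 < x" for x
    using smooth[OF that, of 0] by (simp add: DERIV_deriv_iff_real_differentiable)
  have D2: "(deriv w has_real_derivative deriv (deriv w) x) (at x)" if "0 < x" for x
    using smooth[OF that, of 1] by (simp add: DERIV_deriv_iff_real_differentiable)
  obtain \<tau> where \<tau>: "\<And>x. 0 < x \<Longrightarrow> \<tau> < x \<Longrightarrow> deriv (deriv w) x < 0"
    using w by (auto simp: weight_class_def numeral_2_eq_2)
  define t0 where "t0 = max 1 (\<tau> + 1)"
  have anti: "deriv w y \<le> deriv w x" if "t0 \<le> x" "x \<le> y" for x y
    using that(2)
  proof (rule DERIV_nonpos_imp_nonincreasing)
    fix z assume "x \<le> z" "z \<le> y"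
    then show "\<exists>d. (deriv w has_real_derivative d) (at z) \<and> d \<le> 0"
      using D2[of z] \<tau>[of z] that by (intro exI[of _ "deriv (deriv w) z"]) (auto simp: t0_def)
  qed
  have incr: "w (y + h) - w y \<le> w (x + h) - w x" if "t0 \<le> x" "x \<le> y" "0 \<le> h" for x y h
    using that(2)
  proof (rule DERIV_nonpos_imp_nonincreasing[where f="\<lambda>z. w (z + h) - w z"])
    fix z assume z: "x \<le> z" "z \<le> y"
    have "((\<lambda>z. w (z + h) - w z) has_real_derivative deriv w (z + h) - deriv w z) (at z)"
      using z that D1[of "z + h"] D1[of z]
      by (intro DERIV_diff) (auto simp: DERIV_shift[symmetric] t0_def)
    then show "\<exists>d. ((\<lambda>z. w (z + h) - w z) has_real_derivative d) (at z) \<and> d \<le> 0"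
      using anti[of z "z + h"] z that by auto
  qed
  obtain \<alpha> where \<alpha>: "0 \<le> \<alpha>" "\<alpha> < 1" "regularly_varying w \<alpha>" using w by (auto simp: weight_class_def)
  \<comment> \<open>Since \<alpha> < 1, the exponent \<open>2 / (1 + \<alpha>)\<close> exceeds 1
    while \<alpha> times it stays below 1: the dilation factor is larger than 2, but the limit ratio
    \<open>L\<close> of the weights is smaller than 2.\<close>
  define l where "l = 2 powr (2 / (1 + \<alpha>))"
  define L where "L = l powr \<alpha>"
  have "2 powr 1 < l" unfolding l_def using \<alpha> by (intro powr_less_mono) auto
  then have l: "2 < l" by simp
  have "L = 2 powr (2 * \<alpha> / (1 + \<alpha>))" by (simp add: L_def l_def powr_powr)
  also have "\<dots> < 2 powr 1" using \<alpha> by (intro powr_less_mono) (auto simp: field_simps)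
  finally have L: "0 \<le> L" "L < 2" by (simp_all add: L_def)
  \<comment> \<open>For \<open>L < 2\<close> the number \<open>1 + L / 2\<close> lies strictly
    between \<open>L\<close> and 2, so the ratio of the weights eventually drops below
    \<open>1 + c\<close> with \<open>c < 1\<close>.\<close>
  define c where "c = L / 2"
  have c: "0 \<le> c" "c < 1" "L < 1 + c" using L by (simp_all add: c_def)
  have "((\<lambda>t. w (t * l) / w t) \<longlongrightarrow> L) at_top"
    using \<alpha> l by (auto simp: regularly_varying_def L_def)
  from order_tendstoD(2)[OF this c(3)] obtain T1 where T1: "\<And>t. T1 \<le> t \<Longrightarrow> w (t * l) / w t < 1 + c"
    by (auto simp: eventually_at_top_linorder)
  \<comment> \<open>The last entry guarantees \<open>2 * y + R \<le> l * y\<close> for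
    \<open>y \<ge> T\<close>.\<close>
  define T where "T = max (max t0 T1) (R / (l - 2))"
  have T: "t0 \<le> T" "T1 \<le> T" "R / (l - 2) \<le> T" "1 \<le> t0" by (auto simp: T_def t0_def)
  \<comment> \<open>For \<open>y < T\<close> this covers both positions of \<open>x\<close>:
    concavity compares the increment with the one at \<open>t0\<close>, and for
    \<open>x < t0\<close> monotonicity suffices.\<close>
  define C where "C = w (t0 + T + R)"
  have C: "0 \<le> C" using pos[of "t0 + T + R"] T R by (simp add: C_def)
  have "w (x + y + R) \<le> w x + c * w y + C" if y: "0 \<le> y" and xy: "y \<le> x" for x y
  proof (cases "T \<le> y")
    case True
    have "w (x + (y + R)) - w x \<le> w (y + (y + R)) - w y"
      using T True R y xy by (intro incr) auto
    moreover have "w (y + (y + R)) \<le> w (y * l)"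
    proof (rule mono)
      have "R \<le> T * (l - 2)" using T l by (simp add: field_simps)
      also have "\<dots> \<le> y * (l - 2)" using True l by (intro mult_right_mono) auto
      finally show "y + (y + R) \<le> y * l" by (simp add: algebra_simps)
    qed (use y R in auto)
    moreover have "w (y * l) \<le> (1 + c) * w y"
      using T1[of y] T True pos[OF y] by (simp add: field_simps)
    ultimately show ?thesis using C by (simp add: algebra_simps)
  next
    case False
    have cw: "0 \<le> c * w y" using c pos[OF y] by simp
    have 1: "w (x + y + R) \<le> w (x + (T + R))" using False y xy R by (intro mono) auto
    show ?thesis
    proof (cases "t0 \<le> x")
      case True
      have "w (x + (T + R)) - w x \<le> w (t0 + (T + R)) - w t0" using True T R by (intro incr) auto
      then show ?thesis using 1 cw pos[of t0] T by (simp add: C_def add.assoc)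
    next
      case False
      have "w (x + (T + R)) \<le> C" unfolding C_def using False T R y xy by (intro mono) auto
      then show ?thesis using 1 cw pos[of x] y xy by simp
    qed
  qed
  then show ?thesis using that c C by blast
qed

section \<open>Frequency-uniform decompositions\<close>

lemma lattice_point_nth [simp]: "lattice_point k $ i = real_of_int (k $ i)"
  by (simp add: lattice_point_def)

lemma lattice_point_0 [simp]: "lattice_point 0 = 0"
  by (simp add: vec_eq_iff)

lemma lattice_point_add: "lattice_point (k + m) = lattice_point k + lattice_point m"
  by (simp add: vec_eq_iff)

lemma lattice_point_diff: "lattice_point (k - m) = lattice_point k - lattice_point m"
  by (simp add: vec_eq_iff)

definition lattice_cube :: "int \<Rightarrow> (int ^ 'n) set" where
  "lattice_cube N = {m. \<forall>i. \<bar>m $ i\<bar> \<le> N}"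

lemma finite_lattice_cube [simp]: "finite (lattice_cube N :: (int ^ 'n) set)"
proof -
  have "lattice_cube N \<subseteq> vec_lambda ` PiE (UNIV :: 'n set) (\<lambda>_. {-N..N})"
  proof
    fix m :: "int ^ 'n" assume m: "m \<in> lattice_cube N"
    have "vec_nth m \<in> PiE (UNIV :: 'n set) (\<lambda>_. {-N..N})"
      using m by (simp add: lattice_cube_def abs_le_iff PiE_UNIV_domain Pi_iff) (metis minus_le_iff)
    then have "vec_lambda (vec_nth m) \<in> vec_lambda ` PiE (UNIV :: 'n set) (\<lambda>_. {-N..N})" by (rule imageI)
    then show "m \<in> vec_lambda ` PiE (UNIV :: 'n set) (\<lambda>_. {-N..N})" by simp
  qed
  then show ?thesis by (rule finite_subset) (intro finite_imageI finite_PiE; simp)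
qed

text \<open>All constants are stripped from the Fourier transform: \<open>Etrans\<close> carries no normalisation, so that
  the multiplier \<open>s k\<close> is convolution with \<open>kernel k x = (2 \<pi>)\<^sup>-\<^sup>n Etrans (s k) x\<close>.\<close>

locale frequency_decomposition =
  fixes s :: "int ^ 'n \<Rightarrow> real ^ 'n \<Rightarrow> real" and \<rho> :: "real ^ 'n \<Rightarrow> real"
  assumes smooth_\<rho>: "smooth \<rho>"
    and \<rho>_nonneg: "0 \<le> \<rho> \<xi>"
    and \<rho>_le_1: "\<rho> \<xi> \<le> 1"
    and \<rho>_supp: "\<rho> \<xi> \<noteq> 0 \<Longrightarrow> \<bar>\<xi> $ i\<bar> \<le> 1"
    and \<rho>_1: "(\<And>i. \<bar>\<xi> $ i\<bar> \<le> 1 / 2) \<Longrightarrow> \<rho> \<xi> = 1"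
    and s_eq: "s k \<xi> = \<rho> (\<xi> - lattice_point k) * inverse (\<Sum>\<^sub>\<infinity>m. \<rho> (\<xi> - lattice_point m))"
begin

section \<open>The partition of unity\<close>

definition denom :: "real ^ 'n \<Rightarrow> real" where
  "denom \<xi> = (\<Sum>\<^sub>\<infinity>m. \<rho> (\<xi> - lattice_point m))"

lemma finite_overlap: "finite {m. \<rho> (\<xi> - lattice_point m) \<noteq> 0}"
proof (rule finite_subset)
  define N where "N = \<lceil>norm \<xi> + 1\<rceil>"
  show "{m. \<rho> (\<xi> - lattice_point m) \<noteq> 0} \<subseteq> lattice_cube N"
  proof safe
    fix m assume m: "\<rho> (\<xi> - lattice_point m) \<noteq> 0"
    have "real_of_int \<bar>m $ i\<bar> \<le> norm \<xi> + 1" for i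
      using \<rho>_supp[OF m, of i] component_le_norm_cart[of \<xi> i] by simp
    then have "real_of_int \<bar>m $ i\<bar> \<le> real_of_int N" for i
      unfolding N_def using le_of_int_ceiling order_trans by blast
    then have "\<bar>m $ i\<bar> \<le> N" for i by (simp only: of_int_le_iff)
    then show "m \<in> lattice_cube N" by (simp add: lattice_cube_def)
  qed
qed simp

lemma denom_eq_sum:
  assumes "finite Q" "{m. \<rho> (\<xi> - lattice_point m) \<noteq> 0} \<subseteq> Q"
  shows "denom \<xi> = (\<Sum>m\<in>Q. \<rho> (\<xi> - lattice_point m))"
proof -
  have "denom \<xi> = (\<Sum>\<^sub>\<infinity>m\<in>Q. \<rho> (\<xi> - lattice_point m))"
    unfolding denom_def using assms(2) by (intro infsum_cong_neutral) auto
  then show ?thesis using assms(1) by simp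
qed

text \<open>Rounding each coordinate moves it by at most 1/2, the size of the cube on which
  \<open>\<rho>\<close> equals 1. Hence at least one term of the denominator is 1.\<close>

lemma \<rho>_round: "\<rho> (\<xi> - lattice_point (\<chi> i. round (\<xi> $ i))) = 1"
  using of_int_round_abs_le by (intro \<rho>_1) (simp add: abs_minus_commute)

lemma denom_ge_1: "1 \<le> denom \<xi>"
proof -
  have "(\<chi> i. round (\<xi> $ i)) \<in> {m. \<rho> (\<xi> - lattice_point m) \<noteq> 0}" by (simp add: \<rho>_round)
  then have "(\<Sum>m\<in>{(\<chi> i. round (\<xi> $ i))}. \<rho> (\<xi> - lattice_point m)) \<le> denom \<xi>"
    unfolding denom_eq_sum[OF finite_overlap order_refl]
    using finite_overlap \<rho>_nonneg by (intro sum_mono2) auto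
  then show ?thesis by (simp add: \<rho>_round)
qed

lemma s_denom: "s k \<xi> = \<rho> (\<xi> - lattice_point k) / denom \<xi>"
  by (simp add: s_eq denom_def divide_inverse)

text \<open>The denominator is periodic under lattice translations, so all multipliers are
  translates of a single one.\<close>

lemma s_shift: "s k \<xi> = s 0 (\<xi> - lattice_point k)"
proof -
  have "denom (\<xi> - lattice_point k) = (\<Sum>\<^sub>\<infinity>m. \<rho> (\<xi> - lattice_point (k + m)))"
    by (simp add: denom_def lattice_point_add algebra_simps)
  also have "\<dots> = denom \<xi>" unfolding denom_def
    by (rule infsum_reindex_bij_betw[where g="\<lambda>m. k + m"]) (rule bij_betwI[of _ _ _ "\<lambda>m. m - k"], auto)
  finally show ?thesis by (simp add: s_denom)
qed

lemma s_supp: "s k \<xi> \<noteq> 0 \<Longrightarrow> \<bar>\<xi> $ i - real_of_int (k $ i)\<bar> \<le> 1"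
  using \<rho>_supp[of "\<xi> - lattice_point k" i] by (auto simp: s_denom)

lemma sum_s:
  assumes "finite Q" "{m. \<rho> (\<xi> - lattice_point m) \<noteq> 0} \<subseteq> Q"
  shows "(\<Sum>m\<in>Q. s m \<xi>) = 1"
  using denom_ge_1[of \<xi>] by (simp add: s_denom denom_eq_sum[OF assms] flip: sum_divide_distrib)

definition \<sigma> :: "real ^ 'n \<Rightarrow> complex" where
  "\<sigma> \<xi> = of_real (s 0 \<xi>)"

lemma of_real_s: "complex_of_real (s k \<xi>) = \<sigma> (\<xi> - lattice_point k)"
  by (simp add: \<sigma>_def s_shift[of k])

lemma \<sigma>_supp: "\<sigma> \<xi> \<noteq> 0 \<Longrightarrow> \<bar>\<xi> $ i\<bar> \<le> 1"
  using s_supp[of 0 \<xi> i] by (simp add: \<sigma>_def)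

lemma \<sigma>_0: "\<sigma> 0 \<noteq> 0"
  using denom_ge_1[of 0] \<rho>_1[of 0] by (simp add: \<sigma>_def s_denom)

lemma norm_le_of_supp: "(\<And>i. \<bar>x $ i\<bar> \<le> (r::real)) \<Longrightarrow> norm (x :: real ^ 'n) \<le> real CARD('n) * r"
  using norm_le_l1_cart[of x] sum_bounded_above[of UNIV "\<lambda>i. \<bar>x $ i\<bar>" r] by simp

text \<open>The quotient defining \<open>s 0\<close> is rewritten with the finitely many terms of the denominator which
  matter on the support of \<open>\<rho>\<close>; the summand \<open>1 - \<rho> (\<xi> / 2)\<close> vanishes there and keeps the denominator
  positive elsewhere.\<close>

lemma \<sigma>_test: "\<sigma> \<in> test_functions"
proof -
  define D where "D \<xi> = (\<Sum>m\<in>lattice_cube 2. complex_of_real (\<rho> (1 *\<^sub>R \<xi> + - lattice_point m)))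
      + (1 + (- 1) * complex_of_real (\<rho> ((1 / 2) *\<^sub>R \<xi> + 0)))" for \<xi>
  have D_real: "D \<xi> = of_real ((\<Sum>m\<in>lattice_cube 2. \<rho> (\<xi> - lattice_point m)) + (1 - \<rho> ((1 / 2) *\<^sub>R \<xi>)))" for \<xi>
    by (simp add: D_def)
  have nonzero: "D \<xi> \<noteq> 0" for \<xi>
  proof -
    have "1 \<le> (\<Sum>m\<in>lattice_cube 2. \<rho> (\<xi> - lattice_point m)) + (1 - \<rho> ((1 / 2) *\<^sub>R \<xi>))"
    \<comment> \<open>In the first case the rounded point still lies in the cube and contributes 1;
      in the second \<open>\<xi> / 2\<close> has an entry larger than 1, so the extra summand equals
      1.\<close>
    proof (cases "\<forall>i. \<bar>\<xi> $ i\<bar> \<le> 2")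
      case True
      have "\<bar>round (\<xi> $ i)\<bar> \<le> 2" for i
      proof -
        have "\<bar>real_of_int (round (\<xi> $ i))\<bar> < 3"
          using True[rule_format, of i] of_int_round_abs_le[of "\<xi> $ i"] by linarith
        then show ?thesis by linarith
      qed
      then have "(\<chi> i. round (\<xi> $ i)) \<in> lattice_cube 2" by (simp add: lattice_cube_def)
      then have "(\<Sum>m\<in>{(\<chi> i. round (\<xi> $ i))}. \<rho> (\<xi> - lattice_point m)) \<le> (\<Sum>m\<in>lattice_cube 2. \<rho> (\<xi> - lattice_point m))"
        using \<rho>_nonneg by (intro sum_mono2) auto
      then show ?thesis using \<rho>_le_1[of "(1 / 2) *\<^sub>R \<xi>"] by (simp add: \<rho>_round)
    next
      case False
      then obtain i where "2 < \<bar>\<xi> $ i\<bar>" by (auto simp: not_le)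
      then have "\<rho> ((1 / 2) *\<^sub>R \<xi>) = 0" using \<rho>_supp[of "(1 / 2) *\<^sub>R \<xi>" i] by fastforce
      then show ?thesis using \<rho>_nonneg by (simp add: sum_nonneg)
    qed
    then show ?thesis unfolding D_real by (metis not_one_le_zero of_real_eq_0_iff)
  qed
  have eq: "\<sigma> = (\<lambda>\<xi>. of_real (\<rho> \<xi>) * inverse (D \<xi>))"
  proof
    fix \<xi>
    show "\<sigma> \<xi> = of_real (\<rho> \<xi>) * inverse (D \<xi>)"
    proof (cases "\<rho> \<xi> = 0")
      case False
      note b = \<rho>_supp[OF False]
      have "\<rho> ((1 / 2) *\<^sub>R \<xi>) = 1" using b by (intro \<rho>_1) (simp add: abs_mult)
      moreover have "{m. \<rho> (\<xi> - lattice_point m) \<noteq> 0} \<subseteq> lattice_cube 2"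
      proof safe
        fix m assume "\<rho> (\<xi> - lattice_point m) \<noteq> 0"
        from \<rho>_supp[OF this] have c: "\<bar>\<xi> $ i - real_of_int (m $ i)\<bar> \<le> 1" for i by simp
        have "\<bar>m $ i\<bar> \<le> 2" for i using b[of i] c[of i] by linarith
        then show "m \<in> lattice_cube 2" by (simp add: lattice_cube_def)
      qed
      ultimately have "D \<xi> = of_real (denom \<xi>)"
        by (simp add: D_real denom_eq_sum[of "lattice_cube 2"])
      then show ?thesis by (simp add: \<sigma>_def s_denom divide_inverse)
    qed (simp add: \<sigma>_def s_denom)
  qed
  have \<rho>C: "(\<lambda>\<xi>. complex_of_real (\<rho> \<xi>)) \<in> smooth_closure"
    by (intro smooth_closure.smooth smooth_of_real smooth_\<rho>)
  have "D \<in> smooth_closure"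
    unfolding D_def[abs_def]
    by (intro smooth_closure.add smooth_closure.mult smooth_closure.const smooth_closure_sum finite_lattice_cube
          smooth_closure.affine[OF \<rho>C])
  then have "\<sigma> \<in> smooth_closure"
    unfolding eq using nonzero by (intro smooth_closure.mult \<rho>C smooth_closure.inverse)
  moreover have "\<sigma> x = 0" if "real CARD('n) * 1 < norm x" for x
    using norm_le_of_supp[of x 1] \<sigma>_supp[of x] that by fastforce
  ultimately show ?thesis unfolding test_functions_def by blast
qed

lemma \<sigma>_measurable [measurable]: "\<sigma> \<in> borel_measurable borel"
  by (rule test_functions_measurable[OF \<sigma>_test])

lemma s_measurable [measurable]: "(\<lambda>\<xi>. complex_of_real (s k \<xi>)) \<in> borel_measurable borel"
  unfolding of_real_s by measurable

lemma s_le_1: "norm (complex_of_real (s k \<xi>)) \<le> 1"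
proof -
  have "s k \<xi> \<le> 1"
    using denom_ge_1[of \<xi>] \<rho>_le_1[of "\<xi> - lattice_point k"] by (simp add: s_denom field_simps)
  moreover have "0 \<le> s k \<xi>" using denom_ge_1[of \<xi>] \<rho>_nonneg by (simp add: s_denom)
  ultimately show ?thesis by simp
qed

section \<open>The convolution kernel\<close>

definition CC :: complex where "CC = of_real ((2 * pi) ^ CARD('n))"

lemma CC_nonzero [simp]: "CC \<noteq> 0"
  by (simp add: CC_def)

definition K :: "real ^ 'n \<Rightarrow> complex" where
  "K x = inverse CC * Etrans \<sigma> x"

definition kernel :: "int ^ 'n \<Rightarrow> real ^ 'n \<Rightarrow> complex" where
  "kernel k x = cis (lattice_point k \<bullet> x) * K x"

lemma K_measurable [measurable]: "K \<in> borel_measurable borel"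
  unfolding K_def[abs_def] by measurable

lemma kernel_measurable [measurable]: "kernel k \<in> borel_measurable borel"
  unfolding kernel_def[abs_def] by measurable

lemma norm_kernel [simp]: "norm (kernel k x) = norm (K x)"
  by (simp add: kernel_def norm_mult)

lemma integrable_Etrans_\<sigma>: "integrable lborel (Etrans \<sigma>)"
proof -
  obtain C where C: "\<And>\<xi>. norm (Etrans \<sigma> \<xi>) \<le> C * decay \<xi>" using Etrans_decay[OF \<sigma>_test] by blast
  show ?thesis
  proof (rule Bochner_Integration.integrable_bound)
    show "integrable lborel (\<lambda>x :: real ^ 'n. C * decay x)" using integrable_decay by (intro integrable_mult_right)
    show "AE x in lborel. norm (Etrans \<sigma> x) \<le> norm (C * decay x)"
      using C by (intro AE_I2) (metis abs_ge_self order_trans real_norm_def)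
  qed measurable
qed

lemma K_integrable: "integrable lborel K"
  unfolding K_def[abs_def] using integrable_Etrans_\<sigma> by (intro integrable_mult_right)

text \<open>A bound for the supremum of \<open>K\<close>, since a transform never exceeds the
  \<open>L^1\<close> norm.\<close>

definition B :: real where "B = norm (inverse CC) * (\<integral>x. norm (\<sigma> x) \<partial>lborel)"

lemma K_bounded: "norm (K x) \<le> B"
  unfolding K_def B_def norm_mult by (intro mult_left_mono norm_Etrans_le norm_ge_zero)

definition \<kappa> :: ennreal where "\<kappa> = (\<integral>\<^sup>+x. ennreal (norm (K x)) \<partial>lborel)"

lemma \<kappa>_finite: "\<kappa> < \<infinity>"
  using K_integrable by (simp add: \<kappa>_def integrable_iff_bounded)

text \<open>Inversion applies because \<open>\<sigma>\<close> is a test function, so that its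
  transform is integrable by its decay.\<close>

lemma Etrans_K: "Etrans K \<xi> = \<sigma> (- \<xi>)"
proof -
  obtain b where "\<And>x. norm (\<sigma> x) \<le> b" using test_functions_bounded[OF \<sigma>_test] by blast
  then have "Etrans (Etrans \<sigma>) \<xi> = CC * \<sigma> (- \<xi>)"
    using \<sigma>_test by (subst Etrans_inversion)
      (auto simp: CC_def test_functions_integrable integrable_Etrans_\<sigma> test_functions_def intro: smooth_closure_continuous)
  moreover have "Etrans K \<xi> = inverse CC * Etrans (Etrans \<sigma>) \<xi>"
    unfolding Etrans_def[of K] Etrans_def[of "Etrans \<sigma>"] K_def by (simp add: mult.assoc)
  ultimately show ?thesis by simp
qed

text \<open>A null kernel would have transform 0, but its transform at the origin is
  \<open>\<sigma> 0\<close>. The reconstruction of \<open>f\<close> from its pieces divides by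
  \<open>\<kappa>\<close>.\<close>

lemma \<kappa>_nonzero: "\<kappa> \<noteq> 0"
proof
  assume "\<kappa> = 0"
  then have "AE x in lborel. K x = 0" by (simp add: \<kappa>_def nn_integral_0_iff_AE)
  then have "AE x in lborel. K x * cis (x \<bullet> 0) = 0" by eventually_elim simp
  then have "Etrans K 0 = 0" unfolding Etrans_def by (rule integral_eq_zero_AE)
  then show False using \<sigma>_0 by (simp add: Etrans_K)
qed

end

section \<open>Translation, reflection and modulation\<close>

lemma Etrans_translate:
  fixes v :: "'a::euclidean_space \<Rightarrow> complex"
  assumes [measurable]: "v \<in> borel_measurable borel"
  shows "Etrans (\<lambda>x. v (x - a)) \<xi> = cis (a \<bullet> \<xi>) * Etrans v \<xi>"
proof -
  have "Etrans (\<lambda>x. v (x - a)) \<xi> = of_real (\<bar>1\<bar> ^ DIM('a)) * (\<integral>x. v ((a + 1 *\<^sub>R x) - a) * cis ((a + 1 *\<^sub>R x) \<bullet> \<xi>) \<partial>lborel)"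
    unfolding Etrans_def by (rule integral_lborel_affine) auto
  also have "\<dots> = (\<integral>x. cis (a \<bullet> \<xi>) * (v x * cis (x \<bullet> \<xi>)) \<partial>lborel)"
    by (simp add: inner_add_left mult_ac flip: cis_mult)
  also have "\<dots> = cis (a \<bullet> \<xi>) * Etrans v \<xi>" unfolding Etrans_def by (rule integral_mult_right_zero)
  finally show ?thesis .
qed

lemma Etrans_reflect:
  fixes v :: "'a::euclidean_space \<Rightarrow> complex"
  assumes [measurable]: "v \<in> borel_measurable borel"
  shows "Etrans (\<lambda>x. v (a - x)) \<xi> = cis (a \<bullet> \<xi>) * Etrans v (- \<xi>)"
proof -
  have "Etrans (\<lambda>x. v (a - x)) \<xi> = of_real (\<bar>-1\<bar> ^ DIM('a)) * (\<integral>x. v (a - (a + (-1) *\<^sub>R x)) * cis ((a + (-1) *\<^sub>R x) \<bullet> \<xi>) \<partial>lborel)"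
    unfolding Etrans_def by (rule integral_lborel_affine) auto
  also have "\<dots> = (\<integral>x. cis (a \<bullet> \<xi>) * (v x * cis (x \<bullet> - \<xi>)) \<partial>lborel)"
    by (simp add: inner_diff_left mult_ac cis_mult)
  also have "\<dots> = cis (a \<bullet> \<xi>) * Etrans v (- \<xi>)" unfolding Etrans_def by (rule integral_mult_right_zero)
  finally show ?thesis .
qed

lemma Etrans_modulate: "Etrans (\<lambda>x. v x * cis (x \<bullet> a)) \<xi> = Etrans v (\<xi> + a)"
  by (simp add: Etrans_def inner_add_right mult.assoc cis_mult add.commute)

context frequency_decomposition
begin

lemma kernel_eq_Etrans: "kernel k x = inverse CC * Etrans (\<lambda>\<xi>. of_real (s k \<xi>)) x"
  unfolding of_real_s by (simp add: Etrans_translate kernel_def K_def)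

text \<open>The reflection in \<open>x - y\<close> cancels the sign change of
  \<open>Etrans_K\<close>, so the kernel as a function of \<open>y\<close> has its frequencies
  exactly where \<open>s k\<close> lives. All support arguments use this form.\<close>

lemma Etrans_kernel_reflect:
  "Etrans (\<lambda>y. kernel k (x - y)) \<xi> = cis (x \<bullet> \<xi>) * of_real (s k \<xi>)"
proof -
  have "Etrans (kernel k) (- \<xi>) = of_real (s k \<xi>)"
  proof -
    have "Etrans (kernel k) (- \<xi>) = Etrans (\<lambda>x. K x * cis (x \<bullet> lattice_point k)) (- \<xi>)"
      by (simp add: kernel_def[abs_def] inner_commute mult.commute)
    then show ?thesis by (simp add: Etrans_modulate Etrans_K of_real_s)
  qed
  then show ?thesis by (simp add: Etrans_reflect)
qed

end

section \<open>The convolution operators\<close>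

text \<open>Valid without integrability, because the Bochner integral of a non-integrable function
  is 0; series may thus be estimated before their convergence is known.\<close>

lemma norm_integral_le_nn: "ennreal (norm (integral\<^sup>L M f)) \<le> (\<integral>\<^sup>+x. ennreal (norm (f x)) \<partial>M)"
  for f :: "'a \<Rightarrow> 'b :: {banach, second_countable_topology}"
  by (cases "integrable M f") (auto simp: integral_norm_bound_ennreal not_integrable_integral_eq)

lemma integrable_Fubini_nn:
  fixes f :: "'a \<Rightarrow> 'b \<Rightarrow> complex"
  assumes "sigma_finite_measure M" "sigma_finite_measure N"
    and f [measurable]: "case_prod f \<in> borel_measurable (M \<Otimes>\<^sub>M N)"
    and fin: "(\<integral>\<^sup>+x. \<integral>\<^sup>+y. ennreal (norm (f x y)) \<partial>N \<partial>M) < \<infinity>"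
  shows "integrable N (\<lambda>y. \<integral>x. f x y \<partial>M)"
proof -
  interpret M: sigma_finite_measure M by fact
  interpret N: sigma_finite_measure N by fact
  interpret pair_sigma_finite M N ..
  have "integrable (M \<Otimes>\<^sub>M N) (case_prod f)"
    using fin by (intro integrableI_bounded f) (simp add: N.nn_integral_fst[symmetric] split_beta')
  from integrable_snd[OF this] show ?thesis by simp
qed

lemma Fubini_nn_integral_swap:
  assumes "sigma_finite_measure M" "sigma_finite_measure N"
    and f [measurable]: "case_prod f \<in> borel_measurable (M \<Otimes>\<^sub>M N)"
  shows "(\<integral>\<^sup>+x. \<integral>\<^sup>+y. f x y \<partial>N \<partial>M) = (\<integral>\<^sup>+y. \<integral>\<^sup>+x. f x y \<partial>M \<partial>N)"
proof -
  interpret M: sigma_finite_measure M by fact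
  interpret N: sigma_finite_measure N by fact
  interpret pair_sigma_finite M N ..
  show ?thesis by (rule Fubini'[symmetric]) measurable
qed

text \<open>The finiteness assumption has the sum inside the integral, which is the shape in which
  \<open>conv_sum\<close> provides it.\<close>

lemma Fubini_count_space:
  fixes f :: "'i \<Rightarrow> 'b \<Rightarrow> complex"
  assumes "countable (UNIV :: 'i set)" "sigma_finite_measure N" "\<And>i. f i \<in> borel_measurable N"
    and "(\<integral>\<^sup>+y. \<integral>\<^sup>+i. ennreal (norm (f i y)) \<partial>count_space UNIV \<partial>N) < \<infinity>"
  shows "(\<integral>y. \<integral>i. f i y \<partial>count_space UNIV \<partial>N) = (\<integral>i. \<integral>y. f i y \<partial>N \<partial>count_space UNIV)"
proof (rule Fubini_nn[symmetric])
  show sf: "sigma_finite_measure (count_space (UNIV :: 'i set))"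
    using assms(1) by (rule sigma_finite_measure_count_space_countable)
  show m: "case_prod f \<in> borel_measurable (count_space UNIV \<Otimes>\<^sub>M N)"
    using assms(1,3) by (intro measurable_pair_measure_countable1) auto
  show "(\<integral>\<^sup>+i. \<integral>\<^sup>+y. ennreal (norm (f i y)) \<partial>N \<partial>count_space UNIV) < \<infinity>"
    using assms(4) m by (subst Fubini_nn_integral_swap[OF sf assms(2)]) (auto simp: split_beta')
qed (rule assms)

lemma Lnorm_translate:
  fixes F :: "'a::euclidean_space \<Rightarrow> ennreal"
  assumes [measurable]: "F \<in> borel_measurable borel"
  shows "Lnorm lborel p (\<lambda>x. F (x - t)) = Lnorm lborel p F"
proof -
  have *: "(\<integral>\<^sup>+x. H (x - t) \<partial>lborel) = (\<integral>\<^sup>+x. H x \<partial>lborel)"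
    if [measurable]: "H \<in> borel_measurable borel" for H :: "'a \<Rightarrow> ennreal"
    using nn_integral_lborel_affine[of H 1 "- t"] by simp
  have "(AE x in lborel. F (x - t) \<le> z) \<longleftrightarrow> (AE x in lborel. F x \<le> z)" for z
  proof -
    have "(AE x in lborel. G x \<le> z) \<longleftrightarrow> (\<integral>\<^sup>+x. indicator {z<..} (G x) \<partial>lborel) = 0"
      if [measurable]: "G \<in> borel_measurable borel" for G :: "'a \<Rightarrow> ennreal"
      by (subst nn_integral_0_iff_AE) (auto simp: indicator_eq_0_iff not_less)
    from this[of F] this[of "\<lambda>x. F (x - t)"] *[of "\<lambda>x. indicator {z<..} (F x)"] show ?thesis by simp
  qed
  then have "esssup lborel (\<lambda>x. F (x - t)) = esssup lborel F" by (simp add: esssup_eq_AE)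
  moreover have "(\<integral>\<^sup>+x. ennreal_powr (F (x - t)) (enn2real p) \<partial>lborel) = (\<integral>\<^sup>+x. ennreal_powr (F x) (enn2real p) \<partial>lborel)"
    by (rule *) measurable
  ultimately show ?thesis by (simp add: Lnorm_def)
qed

definition LN :: "ennreal \<Rightarrow> ('a::euclidean_space \<Rightarrow> complex) \<Rightarrow> ennreal" where
  "LN p f = Lnorm lborel p (\<lambda>x. ennreal (norm (f x)))"

context frequency_decomposition
begin

section \<open>Convolution and its bounds\<close>

definition conv :: "int ^ 'n \<Rightarrow> (real ^ 'n \<Rightarrow> complex) \<Rightarrow> real ^ 'n \<Rightarrow> complex" where
  "conv k f x = (\<integral>y. f y * kernel k (x - y) \<partial>lborel)"

text \<open>The common majorant of all \<open>conv k\<close>: the kernels differ only by a phase, so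
  one function bounds every frequency at once.\<close>

definition absconv :: "(real ^ 'n \<Rightarrow> ennreal) \<Rightarrow> real ^ 'n \<Rightarrow> ennreal" where
  "absconv G x = (\<integral>\<^sup>+y. G y * ennreal (norm (K (x - y))) \<partial>lborel)"

lemma conv_measurable [measurable]:
  assumes [measurable]: "f \<in> borel_measurable borel"
  shows "conv k f \<in> borel_measurable borel"
  unfolding conv_def[abs_def] by measurable

lemma absconv_measurable [measurable]:
  assumes [measurable]: "G \<in> borel_measurable borel"
  shows "absconv G \<in> borel_measurable borel"
  unfolding absconv_def[abs_def] by measurable

lemma norm_conv_le_absconv: "ennreal (norm (conv k f x)) \<le> absconv (\<lambda>y. ennreal (norm (f y))) x"
  unfolding conv_def absconv_def
  using norm_integral_le_nn[of lborel "\<lambda>y. f y * kernel k (x - y)"] by (simp add: norm_mult ennreal_mult)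

lemma nn_integral_K_reflect: "(\<integral>\<^sup>+y. ennreal (norm (K (x - y))) \<partial>lborel) = \<kappa>"
  using nn_integral_lborel_affine[of "\<lambda>y. ennreal (norm (K (x - y)))" "-1" x] by (simp add: \<kappa>_def)

text \<open>The constant in the pointwise bound of convolutions, formed from the \<open>L^1\<close>
  norm and the supremum bound of \<open>K\<close> so as to serve every \<open>p\<close>.\<close>

definition A :: ennreal where "A = \<kappa> + ennreal B"

lemma A_finite: "A < \<infinity>"
  using \<kappa>_finite by (simp add: A_def)

lemma absconv_le:
  assumes p: "1 \<le> p" and [measurable]: "G \<in> borel_measurable borel"
  shows "absconv G x \<le> A * Lnorm lborel p G"
  using nn_integral_mult_le_Lnorm[OF p, of "\<lambda>y. ennreal (norm (K (x - y)))" lborel G "ennreal B"]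
  by (simp add: absconv_def A_def nn_integral_K_reflect mult.commute ennreal_leI K_bounded)

text \<open>A convolution is an average of translates with weights \<open>|K|\<close>, and
  translates have equal norms; Minkowski gives Young's inequality.\<close>

lemma absconv_Young:
  assumes p: "1 \<le> p" and [measurable]: "G \<in> borel_measurable borel"
  shows "Lnorm lborel p (absconv G) \<le> \<kappa> * Lnorm lborel p G"
proof -
  have "absconv G x = (\<integral>\<^sup>+t. ennreal (norm (K t)) * G (x - t) \<partial>lborel)" for x
    using nn_integral_lborel_affine[of "\<lambda>y. G y * ennreal (norm (K (x - y)))" "-1" x]
    by (simp add: absconv_def mult.commute)
  then have "Lnorm lborel p (absconv G) = Lnorm lborel p (\<lambda>x. \<integral>\<^sup>+t. ennreal (norm (K t)) * G (x - t) \<partial>lborel)"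
    by presburger
  also have "\<dots> \<le> (\<integral>\<^sup>+t. ennreal (norm (K t)) * Lnorm lborel p G \<partial>lborel)"
  proof (rule Lnorm_integral_le[OF p])
    fix t :: "real ^ 'n"
    have "Lnorm lborel p (\<lambda>x. ennreal (norm (K t)) * G (x - t)) \<le> ennreal (norm (K t)) * Lnorm lborel p (\<lambda>x. G (x - t))"
      by (rule Lnorm_cmult[OF p]) measurable
    then show "Lnorm lborel p (\<lambda>x. ennreal (norm (K t)) * G (x - t)) \<le> ennreal (norm (K t)) * Lnorm lborel p G"
      by (simp add: Lnorm_translate)
  qed (auto simp: sigma_finite_lborel)
  also have "\<dots> = \<kappa> * Lnorm lborel p G" by (simp add: nn_integral_multc \<kappa>_def)
  finally show ?thesis .
qed

lemma norm_conv_le: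
  "1 \<le> p \<Longrightarrow> f \<in> borel_measurable borel \<Longrightarrow> ennreal (norm (conv k f x)) \<le> A * LN p f"
  unfolding LN_def by (rule order_trans[OF norm_conv_le_absconv absconv_le]) auto

lemma LN_conv_le:
  assumes "1 \<le> p" and [measurable]: "f \<in> borel_measurable borel"
  shows "LN p (conv k f) \<le> \<kappa> * LN p f"
proof -
  have "LN p (conv k f) \<le> Lnorm lborel p (absconv (\<lambda>y. ennreal (norm (f y))))"
    unfolding LN_def using assms(1) norm_conv_le_absconv by (intro Lnorm_mono_AE) auto
  also have "\<dots> \<le> \<kappa> * LN p f" unfolding LN_def by (rule absconv_Young[OF assms(1)]) measurable
  finally show ?thesis .
qed

lemma LN_conv_finite:
  assumes "1 \<le> p" "f \<in> borel_measurable borel" "LN p f < \<infinity>"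
  shows "LN p (conv k f) < \<infinity>"
proof -
  have "LN p (conv k f) \<le> \<kappa> * LN p f" using assms(1,2) by (rule LN_conv_le)
  also have "\<dots> < \<infinity>" using assms(3) \<kappa>_finite by (simp add: ennreal_mult_less_top)
  finally show ?thesis .
qed

lemma integrable_mult_kernel:
  assumes p: "1 \<le> p" and [measurable]: "f \<in> borel_measurable borel" and fin: "LN p f < \<infinity>"
  shows "integrable lborel (\<lambda>y. f y * kernel k (x - y))"
proof (rule integrableI_bounded)
  have "(\<integral>\<^sup>+y. ennreal (norm (f y * kernel k (x - y))) \<partial>lborel) = absconv (\<lambda>y. ennreal (norm (f y))) x"
    by (simp add: absconv_def norm_mult ennreal_mult)
  also have "\<dots> \<le> A * LN p f" unfolding LN_def by (intro absconv_le[OF p]) auto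
  also have "\<dots> < \<infinity>" using fin A_finite by (simp add: ennreal_mult_less_top)
  finally show "(\<integral>\<^sup>+y. ennreal (norm (f y * kernel k (x - y))) \<partial>lborel) < \<infinity>" .
qed measurable

lemma integrable_conv_mult:
  assumes p: "1 \<le> p" and [measurable]: "f \<in> borel_measurable borel" and fin: "LN p f < \<infinity>"
    and \<phi>: "integrable lborel \<phi>"
  shows "integrable lborel (\<lambda>x. conv k f x * \<phi> x)"
proof -
  have [measurable]: "\<phi> \<in> borel_measurable borel" using borel_measurable_integrable[OF \<phi>] by simp
  have "A * LN p f < top" using A_finite fin by (simp add: ennreal_mult_less_top)
  then obtain b where b: "A * LN p f = ennreal b" "0 \<le> b" by (cases "A * LN p f") auto
  have "norm (conv k f x) \<le> b" for x using norm_conv_le[OF p, of f k x] b by simp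
  then have "integrable lborel (\<lambda>x. \<phi> x * conv k f x)" by (intro integrable_mult_bounded[OF \<phi>]) auto
  then show ?thesis by (simp add: mult.commute)
qed

text \<open>The kernel is itself a transform of \<open>s k\<close>; carrying out the integral over
  \<open>x\<close> first produces the transform of \<open>\<phi>\<close>.\<close>

lemma kernel_pairing:
  assumes \<phi>: "integrable lborel \<phi>"
  shows "(\<integral>x. \<phi> x * kernel k (x - u) \<partial>lborel) = inverse CC * Etrans (\<lambda>\<xi>. of_real (s k \<xi>) * Etrans \<phi> \<xi>) (- u)"
proof -
  have [measurable]: "\<phi> \<in> borel_measurable borel" using borel_measurable_integrable[OF \<phi>] by simp
  have "(\<integral>x. \<phi> x * kernel k (x - u) \<partial>lborel)
     = (\<integral>x. inverse CC * (\<integral>\<eta>. \<phi> x * (of_real (s k \<eta>) * cis (\<eta> \<bullet> (x - u))) \<partial>lborel) \<partial>lborel)"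
    by (intro Bochner_Integration.integral_cong refl)
       (simp add: kernel_eq_Etrans Etrans_def mult.left_commute)
  also have "\<dots> = inverse CC * (\<integral>x. \<integral>\<eta>. \<phi> x * (of_real (s k \<eta>) * cis (\<eta> \<bullet> (x - u))) \<partial>lborel \<partial>lborel)"
    by (rule integral_mult_right_zero)
  also have "(\<integral>x. \<integral>\<eta>. \<phi> x * (of_real (s k \<eta>) * cis (\<eta> \<bullet> (x - u))) \<partial>lborel \<partial>lborel)
     = (\<integral>\<eta>. \<integral>x. \<phi> x * (of_real (s k \<eta>) * cis (\<eta> \<bullet> (x - u))) \<partial>lborel \<partial>lborel)"
  proof (rule Fubini_nn)
    have "(\<integral>\<^sup>+\<eta>. ennreal (norm (complex_of_real (s k \<eta>))) \<partial>lborel) < \<infinity>"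
    proof -
      have "integrable lborel (\<lambda>\<eta>. \<sigma> (- lattice_point k + 1 *\<^sub>R \<eta>))"
        by (rule integrable_lborel_affine) (auto simp: test_functions_integrable[OF \<sigma>_test])
      then show ?thesis by (simp add: of_real_s integrable_iff_bounded)
    qed
    moreover have "(\<integral>\<^sup>+x. \<integral>\<^sup>+\<eta>. ennreal (norm (\<phi> x * (complex_of_real (s k \<eta>) * cis (\<eta> \<bullet> (x - u))))) \<partial>lborel \<partial>lborel)
      = (\<integral>\<^sup>+x. ennreal (norm (\<phi> x)) \<partial>lborel) * (\<integral>\<^sup>+\<eta>. ennreal (norm (complex_of_real (s k \<eta>))) \<partial>lborel)"
      by (simp only: norm_mult norm_cis mult_1_right ennreal_mult norm_ge_zero)
         (simp add: nn_integral_cmult nn_integral_multc del: norm_of_real)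
    ultimately show "(\<integral>\<^sup>+x. \<integral>\<^sup>+\<eta>. ennreal (norm (\<phi> x * (complex_of_real (s k \<eta>) * cis (\<eta> \<bullet> (x - u))))) \<partial>lborel \<partial>lborel) < \<infinity>"
      using \<phi> by (simp add: integrable_iff_bounded ennreal_mult_less_top)
  qed (simp_all add: sigma_finite_lborel)
  also have "\<dots> = Etrans (\<lambda>\<xi>. of_real (s k \<xi>) * Etrans \<phi> \<xi>) (- u)"
    unfolding Etrans_def[of _ "- u"]
  proof (intro Bochner_Integration.integral_cong refl)
    fix \<eta>
    have "(\<integral>x. \<phi> x * (of_real (s k \<eta>) * cis (\<eta> \<bullet> (x - u))) \<partial>lborel)
      = (\<integral>x. of_real (s k \<eta>) * cis (\<eta> \<bullet> - u) * (\<phi> x * cis (x \<bullet> \<eta>)) \<partial>lborel)"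
      by (simp add: inner_diff_right inner_commute mult_ac cis_mult)
    also have "\<dots> = of_real (s k \<eta>) * Etrans \<phi> \<eta> * cis (\<eta> \<bullet> - u)"
      unfolding Etrans_def by (subst integral_mult_right_zero) (simp only: mult_ac)
    finally show "(\<integral>x. \<phi> x * (of_real (s k \<eta>) * cis (\<eta> \<bullet> (x - u))) \<partial>lborel) = of_real (s k \<eta>) * Etrans \<phi> \<eta> * cis (\<eta> \<bullet> - u)" .
  qed
  finally show ?thesis .
qed

text \<open>This is the multiplier defined by duality, with all transforms placed on
  \<open>\<phi>\<close>. It holds for every \<open>p\<close>, and \<open>\<phi>\<close> need only be
  integrable, which admits kernels and products of kernels with other pieces as test
  functions.\<close>

lemma conv_pairing:
  assumes p: "1 \<le> p" and [measurable]: "f \<in> borel_measurable borel" and fin: "LN p f < \<infinity>"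
    and \<phi>: "integrable lborel \<phi>"
  shows "(\<integral>x. conv k f x * \<phi> x \<partial>lborel)
      = inverse CC * (\<integral>u. f u * Etrans (\<lambda>\<xi>. of_real (s k \<xi>) * Etrans \<phi> \<xi>) (- u) \<partial>lborel)" (is ?A)
    and "integrable lborel (\<lambda>u. f u * Etrans (\<lambda>\<xi>. of_real (s k \<xi>) * Etrans \<phi> \<xi>) (- u))" (is ?B)
proof -
  have [measurable]: "\<phi> \<in> borel_measurable borel" using borel_measurable_integrable[OF \<phi>] by simp
  have "(\<integral>\<^sup>+x. \<integral>\<^sup>+u. ennreal (norm (f u * kernel k (x - u) * \<phi> x)) \<partial>lborel \<partial>lborel)
      = (\<integral>\<^sup>+x. absconv (\<lambda>u. ennreal (norm (f u))) x * ennreal (norm (\<phi> x)) \<partial>lborel)"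
    by (simp add: norm_mult ennreal_mult nn_integral_multc absconv_def)
  also have "\<dots> \<le> (\<integral>\<^sup>+x. (A * LN p f) * ennreal (norm (\<phi> x)) \<partial>lborel)"
    unfolding LN_def by (intro nn_integral_mono mult_right_mono absconv_le[OF p]) auto
  also have "\<dots> = (A * LN p f) * (\<integral>\<^sup>+x. ennreal (norm (\<phi> x)) \<partial>lborel)"
    by (simp add: nn_integral_cmult)
  also have "\<dots> < \<infinity>" using A_finite fin \<phi> by (simp add: ennreal_mult_less_top integrable_iff_bounded)
  finally have bound: "(\<integral>\<^sup>+x. \<integral>\<^sup>+u. ennreal (norm (f u * kernel k (x - u) * \<phi> x)) \<partial>lborel \<partial>lborel) < \<infinity>" .
  have inner: "(\<integral>x. f u * kernel k (x - u) * \<phi> x \<partial>lborel)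
      = inverse CC * (f u * Etrans (\<lambda>\<xi>. of_real (s k \<xi>) * Etrans \<phi> \<xi>) (- u))" for u
  proof -
    have "(\<integral>x. f u * kernel k (x - u) * \<phi> x \<partial>lborel) = (\<integral>x. f u * (\<phi> x * kernel k (x - u)) \<partial>lborel)"
      by (simp only: mult_ac)
    also have "\<dots> = f u * (\<integral>x. \<phi> x * kernel k (x - u) \<partial>lborel)" by (rule integral_mult_right_zero)
    finally show ?thesis by (simp only: kernel_pairing[OF \<phi>] mult_ac)
  qed
  have "integrable lborel (\<lambda>u. \<integral>x. f u * kernel k (x - u) * \<phi> x \<partial>lborel)"
    by (rule integrable_Fubini_nn[OF _ _ _ bound]) (simp_all add: sigma_finite_lborel)
  then have "integrable lborel (\<lambda>u. CC * (inverse CC * (f u * Etrans (\<lambda>\<xi>. of_real (s k \<xi>) * Etrans \<phi> \<xi>) (- u))))"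
    unfolding inner by (rule integrable_mult_right)
  then show ?B by (simp flip: mult.assoc)
  have "(\<integral>x. conv k f x * \<phi> x \<partial>lborel) = (\<integral>x. \<integral>u. f u * kernel k (x - u) * \<phi> x \<partial>lborel \<partial>lborel)"
    unfolding conv_def by (subst integral_mult_left_zero) (rule refl)
  also have "\<dots> = (\<integral>u. \<integral>x. f u * kernel k (x - u) * \<phi> x \<partial>lborel \<partial>lborel)"
    by (rule Fubini_nn[OF _ _ _ bound]) (simp_all add: sigma_finite_lborel)
  also have "\<dots> = inverse CC * (\<integral>u. f u * Etrans (\<lambda>\<xi>. of_real (s k \<xi>) * Etrans \<phi> \<xi>) (- u) \<partial>lborel)"
    unfolding inner by (rule integral_mult_right_zero)
  finally show ?A .
qed

lemma conv_pairing_eq_0: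
  assumes "1 \<le> p" "f \<in> borel_measurable borel" "LN p f < \<infinity>" "integrable lborel \<phi>"
    and "\<And>\<xi>. s k \<xi> \<noteq> 0 \<Longrightarrow> Etrans \<phi> \<xi> = 0"
  shows "(\<integral>x. conv k f x * \<phi> x \<partial>lborel) = 0"
proof -
  have "(\<lambda>\<xi>. complex_of_real (s k \<xi>) * Etrans \<phi> \<xi>) = (\<lambda>_. 0)" using assms(5) by fastforce
  then show ?thesis using conv_pairing(1)[OF assms(1-4), of k] by (simp add: Etrans_def)
qed

lemma integrable_kernel_reflect: "integrable lborel (\<lambda>y. kernel k (x - y))"
proof -
  have "integrable lborel (kernel k)"
    unfolding kernel_def[abs_def] using integrable_mult_cis[OF K_integrable, of "\<lambda>x. lattice_point k \<bullet> x"]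
    by (simp add: mult.commute)
  from integrable_lborel_affine[OF this, of "-1" x] show ?thesis by simp
qed

text \<open>Frequencies add under multiplication. The transform of
  \<open>conv b g y * kernel j (x - y)\<close> at \<open>\<xi>\<close> is again a pairing of
  \<open>conv b g\<close>, now with a modulated kernel whose transform at \<open>\<eta>\<close> is a
  phase times \<open>s j (\<eta> + \<xi>)\<close>. The three supports have radius 1 in each
  coordinate, hence the 3.\<close>

lemma conv_product_localized:
  assumes p: "1 \<le> p1" "1 \<le> p2" and m[measurable]: "f \<in> borel_measurable borel" "g \<in> borel_measurable borel"
    and fin: "LN p1 f < \<infinity>" "LN p2 g < \<infinity>" and far: "j - a - b \<notin> lattice_cube 3"
  shows "(\<integral>y. conv a f y * (conv b g y * kernel j (x - y)) \<partial>lborel) = 0"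
proof (rule conv_pairing_eq_0[OF p(1) m(1) fin(1)])
  show "integrable lborel (\<lambda>y. conv b g y * kernel j (x - y))"
    by (intro integrable_conv_mult[OF p(2) m(2) fin(2)] integrable_kernel_reflect)
  fix \<xi> assume a: "s a \<xi> \<noteq> 0"
  have "Etrans (\<lambda>y. conv b g y * kernel j (x - y)) \<xi> = (\<integral>y. conv b g y * (kernel j (x - y) * cis (y \<bullet> \<xi>)) \<partial>lborel)"
    by (simp add: Etrans_def mult.assoc)
  also have "\<dots> = 0"
  proof (rule conv_pairing_eq_0[OF p(2) m(2) fin(2)])
    show "integrable lborel (\<lambda>y. kernel j (x - y) * cis (y \<bullet> \<xi>))"
      by (intro integrable_mult_cis integrable_kernel_reflect) simp
    fix \<eta> assume b: "s b \<eta> \<noteq> 0"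
    have "s j (\<eta> + \<xi>) = 0"
    proof (rule ccontr)
      assume j: "s j (\<eta> + \<xi>) \<noteq> 0"
      have "\<bar>j $ i - a $ i - b $ i\<bar> \<le> 3" for i
        using s_supp[OF a, of i] s_supp[OF b, of i] s_supp[OF j, of i] by simp
      then show False using far by (simp add: lattice_cube_def)
    qed
    then show "Etrans (\<lambda>y. kernel j (x - y) * cis (y \<bullet> \<xi>)) \<eta> = 0"
      by (simp add: Etrans_modulate Etrans_kernel_reflect)
  qed
  finally show "Etrans (\<lambda>y. conv b g y * kernel j (x - y)) \<xi> = 0" .
qed

text \<open>The supports of \<open>s j\<close> and \<open>s a\<close> meet only if their centres
  differ by at most \<open>1 + 1\<close> in each coordinate.\<close>

lemma conv_conv_localized:
  assumes p: "1 \<le> p" and m[measurable]: "f \<in> borel_measurable borel" and fin: "LN p f < \<infinity>"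
    and far: "j - a \<notin> lattice_cube 2"
  shows "conv j (conv a f) x = 0"
  unfolding conv_def[of j]
proof (rule conv_pairing_eq_0[OF p m fin])
  show "integrable lborel (\<lambda>y. kernel j (x - y))" by (rule integrable_kernel_reflect)
  fix \<xi> assume a: "s a \<xi> \<noteq> 0"
  have "s j \<xi> = 0"
  proof (rule ccontr)
    assume j: "s j \<xi> \<noteq> 0"
    have "\<bar>j $ i - a $ i\<bar> \<le> 2" for i
      using s_supp[OF a, of i] s_supp[OF j, of i] by linarith
    then show False using far by (simp add: lattice_cube_def)
  qed
  then show "Etrans (\<lambda>y. kernel j (x - y)) \<xi> = 0" by (simp add: Etrans_kernel_reflect)
qed

section \<open>Reconstruction from the frequency pieces\<close>

abbreviation cs :: "(int ^ 'n) measure" where "cs \<equiv> count_space UNIV"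

lemma sigma_finite_cs: "sigma_finite_measure cs"
  by (intro sigma_finite_measure_count_space_countable countable_UNIV_int_vec)

lemma case_prod_cs_measurable:
  "(\<And>k. F k \<in> borel_measurable N) \<Longrightarrow> case_prod F \<in> borel_measurable (cs \<Otimes>\<^sub>M N)"
  by (intro measurable_pair_measure_countable1 countable_UNIV_int_vec) auto

definition conv_sum :: "(real ^ 'n \<Rightarrow> complex) \<Rightarrow> real ^ 'n \<Rightarrow> ennreal" where
  "conv_sum f y = (\<integral>\<^sup>+k. ennreal (norm (conv k f y)) \<partial>cs)"

lemma conv_cs_measurable [measurable]:
  assumes [measurable]: "f \<in> borel_measurable borel"
  shows "conv_sum f \<in> borel_measurable borel" "(\<lambda>y. \<integral>k. conv k f y \<partial>cs) \<in> borel_measurable borel"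
proof -
  interpret cs: sigma_finite_measure cs by (rule sigma_finite_cs)
  have m: "(\<lambda>(k, y). conv k f y) \<in> borel_measurable (cs \<Otimes>\<^sub>M borel)"
    by (rule case_prod_cs_measurable) measurable
  have [measurable]: "(\<lambda>(y, k). conv k f y) \<in> borel_measurable (borel \<Otimes>\<^sub>M cs)"
    using measurable_pair_swap[OF m] by (simp add: split_beta')
  show "conv_sum f \<in> borel_measurable borel" "(\<lambda>y. \<integral>k. conv k f y \<partial>cs) \<in> borel_measurable borel"
    unfolding conv_sum_def[abs_def] by measurable
qed

lemma Lnorm_conv_sum_le:
  assumes p: "1 \<le> p" and [measurable]: "f \<in> borel_measurable borel"
  shows "Lnorm lborel p (conv_sum f) \<le> (\<integral>\<^sup>+k. LN p (conv k f) \<partial>cs)"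
  unfolding conv_sum_def LN_def
proof (rule Lnorm_integral_le[OF p sigma_finite_lborel sigma_finite_cs])
  show "(\<lambda>(i, x). ennreal (norm (conv i f x))) \<in> borel_measurable (cs \<Otimes>\<^sub>M lborel)"
    by (rule case_prod_cs_measurable) measurable
qed auto

text \<open>The difference \<open>d\<close> of both sides lies only in \<open>L^p\<close>, but its
  product with a reflected kernel is integrable, so uniqueness of the transform applies. That
  transform vanishes because a band-limited \<open>\<phi>\<close> meets only finitely many pieces,
  whose multipliers sum to 1 on its spectrum.\<close>

lemma conv_series:
  assumes p: "1 \<le> p" and m[measurable]: "f \<in> borel_measurable borel" and fin: "LN p f < \<infinity>"
    and sum: "(\<integral>\<^sup>+k. LN p (conv k f) \<partial>cs) < \<infinity>"
  shows "AE y in lborel. f y = (\<integral>k. conv k f y \<partial>cs)"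
proof -
  define F where "F y = (\<integral>k. conv k f y \<partial>cs)" for y
  define d where "d y = f y - F y" for y
  have [measurable]: "F \<in> borel_measurable borel" unfolding F_def[abs_def] by measurable
  have [measurable]: "d \<in> borel_measurable borel" unfolding d_def[abs_def] by measurable
  have Sfin: "Lnorm lborel p (conv_sum f) < \<infinity>" using Lnorm_conv_sum_le[OF p m] sum by order
  have F_le: "ennreal (norm (F y)) \<le> conv_sum f y" for y
    unfolding F_def conv_sum_def by (rule norm_integral_le_nn)
  have Ffin: "LN p F < \<infinity>"
  proof -
    have "LN p F \<le> Lnorm lborel p (conv_sum f)"
      unfolding LN_def using F_le by (intro Lnorm_mono_AE[OF p]) auto
    then show ?thesis using Sfin by order
  qed
  have zero: "AE y in lborel. d y * kernel 0 (x0 - y) = 0" for x0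
  proof (rule Etrans_unique)
    show "integrable lborel (\<lambda>y. d y * kernel 0 (x0 - y))"
      unfolding d_def left_diff_distrib by (intro Bochner_Integration.integrable_diff integrable_mult_kernel[OF p] fin Ffin) auto
    fix \<zeta>
    \<comment> \<open>Including the character turns the value of the transform at
      \<open>\<zeta>\<close> into a pairing with \<open>\<phi>\<close>, whose spectrum is a unit
      cube around \<open>- \<zeta>\<close>.\<close>
    define \<phi> where "\<phi> y = kernel 0 (x0 - y) * cis (y \<bullet> \<zeta>)" for y
    have \<phi>: "integrable lborel \<phi>"
      unfolding \<phi>_def[abs_def] by (intro integrable_mult_cis integrable_kernel_reflect) simp
    have [measurable]: "\<phi> \<in> borel_measurable borel" using borel_measurable_integrable[OF \<phi>] by simp
    have E\<phi>: "Etrans \<phi> \<xi> = cis (x0 \<bullet> (\<xi> + \<zeta>)) * \<sigma> (\<xi> + \<zeta>)" for \<xi>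
      by (simp add: \<phi>_def[abs_def] Etrans_modulate Etrans_kernel_reflect of_real_s)
    have \<psi>: "(\<lambda>\<xi>. cis (x0 \<bullet> \<xi>) * \<sigma> \<xi>) \<in> borel_measurable borel" by measurable
    \<comment> \<open>No limit is taken here: \<open>Etrans \<phi>\<close> is a shifted and
      modulated copy of \<open>\<sigma>\<close>, and \<open>CC * K\<close> is the transform of
      \<open>\<sigma>\<close> by definition.\<close>
    have EE\<phi>: "Etrans (Etrans \<phi>) (- u) = CC * \<phi> u" for u
    proof -
      have "Etrans (Etrans \<phi>) (- u) = cis (\<zeta> \<bullet> u) * Etrans (\<lambda>\<xi>. cis (x0 \<bullet> \<xi>) * \<sigma> \<xi>) (- u)"
        using Etrans_translate[OF \<psi>, of "- \<zeta>" "- u"] by (simp add: E\<phi>[abs_def])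
      also have "Etrans (\<lambda>\<xi>. cis (x0 \<bullet> \<xi>) * \<sigma> \<xi>) (- u) = Etrans \<sigma> (x0 - u)"
        using Etrans_modulate[of \<sigma> x0 "- u"] by (simp add: inner_commute mult.commute)
      finally have *: "Etrans (Etrans \<phi>) (- u) = cis (\<zeta> \<bullet> u) * Etrans \<sigma> (x0 - u)" .
      show ?thesis unfolding * by (simp add: \<phi>_def kernel_def K_def inner_commute mult_ac)
    qed
    have iE\<phi>: "integrable lborel (Etrans \<phi>)"
    proof -
      have "integrable lborel (\<lambda>\<xi>. \<sigma> \<xi> * cis (x0 \<bullet> \<xi>))"
        by (intro integrable_mult_cis test_functions_integrable \<sigma>_test) measurable
      from integrable_lborel_affine[OF this, of 1 \<zeta>] show ?thesis by (simp add: E\<phi>[abs_def] ac_simps)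
    qed
    \<comment> \<open>The margin 2 is one unit for the support of \<open>\<sigma>\<close> and one
      for that of \<open>s k\<close>.\<close>
    define Q :: "(int ^ 'n) set" where "Q = lattice_cube \<lceil>norm \<zeta> + 2\<rceil>"
    have Q: "k \<in> Q" if "s k \<xi> \<noteq> 0" "Etrans \<phi> \<xi> \<noteq> 0" for k \<xi>
    proof -
      have "real_of_int \<bar>k $ i\<bar> \<le> norm \<zeta> + 2" for i
        using s_supp[OF that(1), of i] \<sigma>_supp[of "\<xi> + \<zeta>" i] that(2) component_le_norm_cart[of \<zeta> i]
        by (simp add: E\<phi>)
      then have "real_of_int \<bar>k $ i\<bar> \<le> real_of_int \<lceil>norm \<zeta> + 2\<rceil>" for i
        using le_of_int_ceiling order_trans by blast
      then have "\<bar>k $ i\<bar> \<le> \<lceil>norm \<zeta> + 2\<rceil>" for i by (simp only: of_int_le_iff)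
      then show ?thesis by (simp add: Q_def lattice_cube_def)
    qed
    define b where "b k = (\<integral>y. conv k f y * \<phi> y \<partial>lborel)" for k
    have b0: "b k = 0" if "k \<notin> Q" for k
      unfolding b_def using Q[of k] that by (intro conv_pairing_eq_0[OF p m fin \<phi>]) blast
    have "(\<integral>y. F y * \<phi> y \<partial>lborel) = (\<integral>y. \<integral>k. conv k f y * \<phi> y \<partial>cs \<partial>lborel)"
      unfolding F_def by (subst integral_mult_left_zero) (rule refl)
    also have "\<dots> = (\<integral>k. b k \<partial>cs)"
      unfolding b_def
    proof (rule Fubini_count_space[OF countable_UNIV_int_vec sigma_finite_lborel])
      have "(\<integral>\<^sup>+y. \<integral>\<^sup>+k. ennreal (norm (conv k f y * \<phi> y)) \<partial>cs \<partial>lborel) = absconv (conv_sum f) x0"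
        by (simp add: norm_mult ennreal_mult nn_integral_multc absconv_def conv_sum_def \<phi>_def)
      also have "\<dots> \<le> A * Lnorm lborel p (conv_sum f)" by (intro absconv_le[OF p]) measurable
      also have "\<dots> < \<infinity>" using Sfin A_finite by (simp add: ennreal_mult_less_top)
      finally show "(\<integral>\<^sup>+y. \<integral>\<^sup>+k. ennreal (norm (conv k f y * \<phi> y)) \<partial>cs \<partial>lborel) < \<infinity>" .
    qed measurable
    also have "\<dots> = (\<Sum>k\<in>Q. b k)"
    proof -
      have sub: "{k. b k \<noteq> 0} \<subseteq> Q" using b0 by blast
      have "finite {k. b k \<noteq> 0}" by (rule finite_subset[OF sub]) (simp add: Q_def)
      then have "(\<integral>k. b k \<partial>cs) = (\<Sum>k | k \<in> UNIV \<and> b k \<noteq> 0. b k)"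
        by (intro lebesgue_integral_count_space_finite_support) simp
      also have "\<dots> = (\<Sum>k\<in>Q. b k)" using sub by (intro sum.mono_neutral_left) (auto simp: Q_def)
      finally show ?thesis .
    qed
    also have "\<dots> = inverse CC * (\<Sum>k\<in>Q. \<integral>u. f u * Etrans (\<lambda>\<xi>. of_real (s k \<xi>) * Etrans \<phi> \<xi>) (- u) \<partial>lborel)"
      unfolding b_def conv_pairing(1)[OF p m fin \<phi>] by (rule sum_distrib_left[symmetric])
    also have "(\<Sum>k\<in>Q. \<integral>u. f u * Etrans (\<lambda>\<xi>. of_real (s k \<xi>) * Etrans \<phi> \<xi>) (- u) \<partial>lborel)
        = (\<integral>u. (\<Sum>k\<in>Q. f u * Etrans (\<lambda>\<xi>. of_real (s k \<xi>) * Etrans \<phi> \<xi>) (- u)) \<partial>lborel)"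
      by (rule Bochner_Integration.integral_sum[symmetric]) (rule conv_pairing(2)[OF p m fin \<phi>])
    also have "\<dots> = (\<integral>u. CC * (f u * \<phi> u) \<partial>lborel)"
    proof (intro Bochner_Integration.integral_cong refl)
      fix u
      have "(\<Sum>k\<in>Q. Etrans (\<lambda>\<xi>. of_real (s k \<xi>) * Etrans \<phi> \<xi>) (- u))
          = (\<integral>\<xi>. (\<Sum>k\<in>Q. of_real (s k \<xi>) * Etrans \<phi> \<xi> * cis (\<xi> \<bullet> - u)) \<partial>lborel)"
        unfolding Etrans_def[of _ "- u"]
      proof (rule Bochner_Integration.integral_sum[symmetric])
        fix k
        have "integrable lborel (\<lambda>\<xi>. Etrans \<phi> \<xi> * of_real (s k \<xi>))"
          by (rule integrable_mult_bounded[OF iE\<phi> _ s_le_1]) measurable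
        then show "integrable lborel (\<lambda>\<xi>. of_real (s k \<xi>) * Etrans \<phi> \<xi> * cis (\<xi> \<bullet> - u))"
          by (intro integrable_mult_cis) (simp_all add: mult.commute)
      qed
      also have "\<dots> = Etrans (Etrans \<phi>) (- u)"
        unfolding Etrans_def[of _ "- u"]
      proof (intro Bochner_Integration.integral_cong refl)
        fix \<xi>
        \<comment> \<open>On the spectrum of \<open>\<phi>\<close> the finite set \<open>Q\<close>
          contains every lattice point with a nonzero term, so the partition of unity is complete
          there.\<close>
        have "(\<Sum>k\<in>Q. s k \<xi>) = 1" if "Etrans \<phi> \<xi> \<noteq> 0"
        proof (rule sum_s)
          show "{m. \<rho> (\<xi> - lattice_point m) \<noteq> 0} \<subseteq> Q"
            using Q[OF _ that] denom_ge_1[of \<xi>] by (auto simp: s_denom)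
        qed (simp add: Q_def)
        then have "of_real (\<Sum>k\<in>Q. s k \<xi>) * Etrans \<phi> \<xi> = Etrans \<phi> \<xi>" by (cases "Etrans \<phi> \<xi> = 0") auto
        then show "(\<Sum>k\<in>Q. of_real (s k \<xi>) * Etrans \<phi> \<xi> * cis (\<xi> \<bullet> - u)) = Etrans \<phi> \<xi> * cis (\<xi> \<bullet> - u)"
          by (simp flip: sum_distrib_right)
      qed
      finally show "(\<Sum>k\<in>Q. f u * Etrans (\<lambda>\<xi>. of_real (s k \<xi>) * Etrans \<phi> \<xi>) (- u)) = CC * (f u * \<phi> u)"
        by (simp add: EE\<phi> flip: sum_distrib_left)
    qed
    also have "inverse CC * (\<integral>u. CC * (f u * \<phi> u) \<partial>lborel) = (\<integral>u. f u * \<phi> u \<partial>lborel)"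
      by simp
    finally have eq: "(\<integral>y. F y * \<phi> y \<partial>lborel) = (\<integral>u. f u * \<phi> u \<partial>lborel)" .
    have i\<phi>: "integrable lborel (\<lambda>y. h y * \<phi> y)" if "h \<in> borel_measurable borel" "LN p h < \<infinity>" for h
      unfolding \<phi>_def using integrable_mult_cis[OF integrable_mult_kernel[OF p that, of 0 x0], of "\<lambda>y. y \<bullet> \<zeta>"] by (simp add: mult.assoc)
    have "Etrans (\<lambda>y. d y * kernel 0 (x0 - y)) \<zeta> = (\<integral>y. f y * \<phi> y - F y * \<phi> y \<partial>lborel)"
      by (simp add: Etrans_def \<phi>_def d_def algebra_simps)
    also have "\<dots> = (\<integral>y. f y * \<phi> y \<partial>lborel) - (\<integral>y. F y * \<phi> y \<partial>lborel)"
      by (intro Bochner_Integration.integral_diff i\<phi> fin Ffin) auto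
    finally show "Etrans (\<lambda>y. d y * kernel 0 (x0 - y)) \<zeta> = 0" by (simp add: eq)
  qed
  \<comment> \<open>A single \<open>x0\<close> shows \<open>d y = 0\<close> only where
    \<open>K (x0 - y)\<close> is nonzero. Integrating over \<open>x0\<close> replaces the kernel by
    the nonzero constant \<open>\<kappa>\<close>.\<close>
  have "\<kappa> * (\<integral>\<^sup>+y. ennreal (norm (d y)) \<partial>lborel) = (\<integral>\<^sup>+y. \<integral>\<^sup>+x. ennreal (norm (d y)) * ennreal (norm (K (x - y))) \<partial>lborel \<partial>lborel)"
  proof -
    have "(\<integral>\<^sup>+x. ennreal (norm (K (x - y))) \<partial>lborel) = \<kappa>" for y
      using nn_integral_lborel_affine[of "\<lambda>x. ennreal (norm (K (x - y)))" 1 y] by (simp add: \<kappa>_def)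
    then show ?thesis by (simp add: nn_integral_cmult nn_integral_multc mult.commute)
  qed
  also have "\<dots> = (\<integral>\<^sup>+x. \<integral>\<^sup>+y. ennreal (norm (d y)) * ennreal (norm (K (x - y))) \<partial>lborel \<partial>lborel)"
    by (rule Fubini_nn_integral_swap) (simp_all add: sigma_finite_lborel)
  also have "\<dots> = (\<integral>\<^sup>+x. 0 \<partial>(lborel :: (real ^ 'n) measure))"
  proof (intro nn_integral_cong)
    fix x
    from zero[of x] have "AE y in lborel. ennreal (norm (d y)) * ennreal (norm (K (x - y))) = 0"
      by eventually_elim (metis ennreal_0 mult_zero_left mult_zero_right mult_eq_0_iff norm_eq_zero norm_kernel)
    then show "(\<integral>\<^sup>+y. ennreal (norm (d y)) * ennreal (norm (K (x - y))) \<partial>lborel) = 0"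
      by (subst nn_integral_0_iff_AE) auto
  qed
  finally have "(\<integral>\<^sup>+y. ennreal (norm (d y)) \<partial>lborel) = 0" using \<kappa>_nonzero by simp
  then have "AE y in lborel. d y = 0" by (simp add: nn_integral_0_iff_AE)
  then show ?thesis by eventually_elim (simp add: d_def F_def)
qed

text \<open>A piece of frequency near \<open>a\<close> is reproduced by finitely many
  \<open>conv k\<close>, and each of these maps \<open>L^p\<close> into bounded functions with
  constant \<open>A\<close>. The number of terms is that of the cube of radius 2, whatever
  \<open>a\<close> is.\<close>

lemma Bernstein:
  assumes p: "1 \<le> p" and m[measurable]: "f \<in> borel_measurable borel" and fin: "LN p f < \<infinity>"
  shows "LN \<infinity> (conv a f) \<le> of_nat (card (lattice_cube 2 :: (int ^ 'n) set)) * A * LN p (conv a f)"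
proof -
  let ?g = "conv a f"
  have gfin: "LN p ?g < \<infinity>" by (rule LN_conv_finite[OF p m fin])
  define Q where "Q = (\<lambda>k. a + k) ` lattice_cube 2"
  have finQ: "finite Q" by (simp add: Q_def)
  have cQ: "card Q \<le> card (lattice_cube 2 :: (int ^ 'n) set)" unfolding Q_def by (rule card_image_le) simp
  have zero: "conv k ?g x = 0" if "k \<notin> Q" for k x
  proof (rule conv_conv_localized[OF p m fin])
    show "k - a \<notin> lattice_cube 2" using that unfolding Q_def by (metis add.commute diff_add_cancel image_eqI)
  qed
  have count: "(\<integral>\<^sup>+k. H k \<partial>cs) = (\<Sum>k\<in>Q. H k)" if "\<And>k. k \<notin> Q \<Longrightarrow> H k = 0" for H :: "int ^ 'n \<Rightarrow> ennreal"
    using that finQ by (intro nn_integral_count_space') auto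
  have "(\<integral>\<^sup>+k. LN p (conv k ?g) \<partial>cs) = (\<Sum>k\<in>Q. LN p (conv k ?g))"
  proof (rule count)
    fix k assume "k \<notin> Q"
    then have "(\<lambda>x. ennreal (norm (conv k ?g x))) = (\<lambda>x. 0)" using zero by auto
    then show "LN p (conv k ?g) = 0" using Lnorm_0_iff[OF p, of "\<lambda>x. 0" lborel] by (simp add: LN_def)
  qed
  also have "\<dots> < \<infinity>"
  proof -
    have "LN p (conv k ?g) < \<infinity>" for k by (rule LN_conv_finite[OF p _ gfin]) measurable
    then show ?thesis using finQ by (simp add: less_top)
  qed
  finally have "AE y in lborel. ?g y = (\<integral>k. conv k ?g y \<partial>cs)"
    using gfin by (intro conv_series[OF p]) auto
  then have "AE y in lborel. ennreal (norm (?g y)) \<le> of_nat (card (lattice_cube 2 :: (int ^ 'n) set)) * A * LN p ?g"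
  proof eventually_elim
    case (elim y)
    have "ennreal (norm (?g y)) \<le> (\<integral>\<^sup>+k. ennreal (norm (conv k ?g y)) \<partial>cs)"
      unfolding elim[symmetric] by (subst elim) (rule norm_integral_le_nn)
    also have "\<dots> = (\<Sum>k\<in>Q. ennreal (norm (conv k ?g y)))" using zero by (intro count) simp
    also have "\<dots> \<le> (\<Sum>k\<in>Q. A * LN p ?g)" by (intro sum_mono norm_conv_le[OF p]) measurable
    also have "\<dots> = of_nat (card Q) * (A * LN p ?g)" by simp
    also have "\<dots> \<le> of_nat (card (lattice_cube 2 :: (int ^ 'n) set)) * (A * LN p ?g)"
      using cQ by (intro mult_right_mono) auto
    finally show ?case by (simp add: mult.assoc)
  qed
  then show ?thesis by (simp add: LN_def Lnorm_def esssup_I)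
qed

end

section \<open>Passage to distributions\<close>

lemma Lp_norm_eq_Lnorm: "Lp_norm p f = Lnorm lebesgue p (\<lambda>x. ennreal (norm (f x)))"
  by (simp add: Lp_norm_def Lnorm_def ennreal_powr_ennreal)

lemma Lnorm_lebesgue:
  assumes "F \<in> borel_measurable borel"
  shows "Lnorm lebesgue p F = Lnorm lborel p F"
proof -
  have "F \<in> borel_measurable lebesgue" using assms by (simp add: measurable_completion)
  then have "esssup lebesgue F = esssup lborel F"
    using assms by (simp add: esssup_eq_AE AE_completion_iff)
  then show ?thesis by (simp add: Lnorm_def nn_integral_completion)
qed

lemma Lp_norm_eq_LN: "f \<in> borel_measurable borel \<Longrightarrow> Lp_norm p f = LN p f"
  by (simp add: Lp_norm_eq_Lnorm LN_def Lnorm_lebesgue)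

lemma lebesgue_ex_borel:
  fixes f :: "real ^ 'n \<Rightarrow> complex"
  assumes [measurable]: "f \<in> borel_measurable lebesgue"
  obtains f' where "f' \<in> borel_measurable borel" "AE x in lborel. f x = f' x"
proof -
  have "(\<lambda>x. Re (f x)) \<in> borel_measurable lebesgue" "(\<lambda>x. Im (f x)) \<in> borel_measurable lebesgue"
    by measurable
  from this[THEN completion_ex_borel_measurable_real] obtain u v where
    [measurable]: "u \<in> borel_measurable borel" "v \<in> borel_measurable borel"
    and uv: "AE x in lborel. Re (f x) = u x" "AE x in lborel. Im (f x) = v x" by auto
  show ?thesis
  proof
    show "(\<lambda>x. Complex (u x) (v x)) \<in> borel_measurable borel" by (simp add: Complex_eq)
    show "AE x in lborel. f x = Complex (u x) (v x)"
      using uv by eventually_elim (simp add: complex_eq_iff)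
  qed
qed

text \<open>Membership in \<open>L^p\<close> is phrased with Lebesgue measurability, whereas
  convolutions and iterated integrals are handled for Borel functions; changing \<open>f\<close> on
  a null set connects the two.\<close>

definition borel_version :: "(real ^ 'n \<Rightarrow> complex) \<Rightarrow> (real ^ 'n \<Rightarrow> complex) \<Rightarrow> bool" where
  "borel_version f f' \<longleftrightarrow> f \<in> borel_measurable lebesgue \<and> f' \<in> borel_measurable borel \<and> (AE x in lborel. f x = f' x)"

lemma borel_versionD:
  assumes "borel_version f f'"
  shows "f \<in> borel_measurable lebesgue" "f' \<in> borel_measurable borel" "f' \<in> borel_measurable lebesgue"
    "AE x in lborel. f x = f' x" "AE x in lebesgue. f x = f' x"
  using assms by (auto simp: borel_version_def measurable_completion AE_completion)

lemma Lp_norm_borel_version: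
  assumes "borel_version f f'"
  shows "Lp_norm p f = LN p f'"
proof -
  note v = borel_versionD[OF assms]
  have "Lp_norm p f = Lnorm lebesgue p (\<lambda>x. ennreal (norm (f' x)))"
    unfolding Lp_norm_eq_Lnorm
  proof (rule Lnorm_cong_AE)
    show "AE x in lebesgue. ennreal (norm (f x)) = ennreal (norm (f' x))"
      using v(5) by eventually_elim simp
  qed (use v in auto)
  then show ?thesis using Lp_norm_eq_LN[OF v(2)] by (simp add: Lp_norm_eq_Lnorm)
qed

lemma Lp_space_borel_version:
  assumes "f \<in> Lp_space p"
  obtains f' where "borel_version f f'" "LN p f' < \<infinity>"
proof -
  have m: "f \<in> borel_measurable lebesgue" using assms by (simp add: Lp_space_def)
  obtain f' where "f' \<in> borel_measurable borel" "AE x in lborel. f x = f' x"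
    using lebesgue_ex_borel[OF m] by blast
  then have v: "borel_version f f'" using m by (simp add: borel_version_def)
  have "LN p f' < \<infinity>" using assms Lp_norm_borel_version[OF v, of p] by (simp add: Lp_space_def)
  with v show ?thesis by (rule that)
qed

lemma Lp_space_iff_borel_version:
  "borel_version f f' \<Longrightarrow> f \<in> Lp_space p \<longleftrightarrow> LN p f' < \<infinity>"
  using borel_versionD(1) by (auto simp: Lp_space_def Lp_norm_borel_version)

lemma borel_version_refl: "f \<in> borel_measurable borel \<Longrightarrow> borel_version f f"
  by (simp add: borel_version_def measurable_completion)

lemma regular_dist_borel_version:
  assumes "borel_version f f'" and [measurable]: "\<phi> \<in> borel_measurable borel"
  shows "regular_dist f \<phi> = (\<integral>x. f' x * \<phi> x \<partial>lborel)"
proof -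
  note v = borel_versionD[OF assms(1)]
  have [measurable]: "\<phi> \<in> borel_measurable lebesgue" by (simp add: measurable_completion)
  note [measurable] = v(1-3)
  have "regular_dist f \<phi> = (\<integral>x. f' x * \<phi> x \<partial>lebesgue)"
    unfolding regular_dist_def
  proof (rule integral_cong_AE)
    show "AE x in lebesgue. f x * \<phi> x = f' x * \<phi> x" using v(5) by eventually_elim simp
  qed measurable
  then show ?thesis by (simp add: integral_completion)
qed

section \<open>Agreement with the distributional operators\<close>

definition fourier_const :: "'n::finite itself \<Rightarrow> complex" where
  "fourier_const _ = of_real ((2 * pi) powr (- real CARD('n) / 2))"

lemma fourier_const_square:
  "fourier_const TYPE('n::finite) * fourier_const TYPE('n) = inverse (of_real ((2 * pi) ^ CARD('n)))"
proof -
  have "(2 * pi) powr (- real CARD('n) / 2) * (2 * pi) powr (- real CARD('n) / 2) = inverse ((2 * pi) ^ CARD('n))"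
  proof -
    have "- real CARD('n) / 2 + - real CARD('n) / 2 = - real CARD('n)" by simp
    then show ?thesis by (simp only: powr_add[symmetric] powr_minus) (simp only: powr_realpow[of "2 * pi"] pi_gt_zero zero_less_mult_iff zero_less_numeral simp_thms)
  qed
  then show ?thesis unfolding fourier_const_def of_real_inverse[symmetric] of_real_mult[symmetric] by (rule arg_cong)
qed

lemma fourier_eq_Etrans:
  fixes u :: "real ^ 'n \<Rightarrow> complex"
  assumes [measurable]: "u \<in> borel_measurable borel"
  shows "fourier u \<xi> = fourier_const TYPE('n) * Etrans u (- \<xi>)"
proof -
  have "exp (- (\<i> * complex_of_real (x \<bullet> \<xi>))) = cis (x \<bullet> - \<xi>)" for x by (simp add: cis_conv_exp)
  then show ?thesis by (simp add: fourier_def fourier_const_def Etrans_def integral_completion del: inner_minus_right)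
qed

lemma inv_fourier_eq_Etrans:
  fixes u :: "real ^ 'n \<Rightarrow> complex"
  assumes [measurable]: "u \<in> borel_measurable borel"
  shows "inv_fourier u x = fourier_const TYPE('n) * Etrans u x"
proof -
  have "exp (\<i> * complex_of_real (x \<bullet> \<xi>)) = cis (\<xi> \<bullet> x)" for \<xi> by (simp add: cis_conv_exp inner_commute)
  then show ?thesis by (simp add: inv_fourier_def fourier_const_def Etrans_def integral_completion)
qed

text \<open>The seminorms of orders 0 and \<open>2 n\<close> without derivatives bound
  \<open>(1 + |x|^2)^n |\<phi> x|\<close>, and \<open>(1 + |x|^2)^n\<close> dominates the product of
  the coordinate factors in \<open>decay\<close>.\<close>

lemma schwartz_integrable:
  fixes \<phi> :: "real ^ 'n \<Rightarrow> complex"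
  assumes \<phi>: "schwartz \<phi>"
  shows "integrable lborel \<phi>"
proof -
  let ?n = "CARD('n)"
  have diff: "\<phi> differentiable_on UNIV"
    using \<phi>[unfolded schwartz_def smooth_def, THEN conjunct1, rule_format, of "[]"] by simp
  then have [measurable]: "\<phi> \<in> borel_measurable borel"
    by (intro borel_measurable_continuous_onI differentiable_imp_continuous_on)
  have bdd: "bounded (range (\<lambda>x. norm x ^ N *\<^sub>R \<phi> x))" for N
    using \<phi>[unfolded schwartz_def, THEN conjunct2, rule_format, of N "[]"] by simp
  obtain a where a: "\<And>x. norm (\<phi> x) \<le> a" using bdd[of 0] by (auto simp: bounded_iff)
  obtain b where b: "\<And>x. norm x ^ (2 * ?n) * norm (\<phi> x) \<le> b" using bdd[of "2 * ?n"] by (auto simp: bounded_iff)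
  have "norm (\<phi> x) \<le> 2 ^ ?n * (a + b) * decay x" for x
  proof -
    have decay: "inverse ((1 + (norm x)\<^sup>2) ^ ?n) \<le> decay x"
    proof -
      have "inverse ((1 + (norm x)\<^sup>2) ^ ?n) = (\<Prod>b\<in>(Basis :: (real ^ 'n) set). inverse (1 + (norm x)\<^sup>2))"
        by (simp add: power_inverse)
      also have "\<dots> \<le> decay x" unfolding decay_def
      proof (intro prod_mono conjI le_imp_inverse_le add_left_mono)
        fix b :: "real ^ 'n" assume "b \<in> Basis"
        then have "\<bar>x \<bullet> b\<bar> \<le> norm x" by (rule Basis_le_norm)
        then show "(x \<bullet> b)\<^sup>2 \<le> (norm x)\<^sup>2" by (metis abs_ge_zero power2_abs power_mono)
      qed (auto intro: add_pos_nonneg add_nonneg_nonneg)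
      finally show ?thesis .
    qed
    have "(1 + (norm x)\<^sup>2) ^ ?n \<le> 2 ^ ?n * (1 + norm x ^ (2 * ?n))"
    proof -
      have "1 + (norm x)\<^sup>2 \<le> 2 * max 1 ((norm x)\<^sup>2)" by simp
      then have "(1 + (norm x)\<^sup>2) ^ ?n \<le> (2 * max 1 ((norm x)\<^sup>2)) ^ ?n" by (intro power_mono) auto
      also have "\<dots> = 2 ^ ?n * max 1 ((norm x)\<^sup>2) ^ ?n" by (rule power_mult_distrib)
      also have "max 1 ((norm x)\<^sup>2) ^ ?n \<le> 1 + norm x ^ (2 * ?n)"
        by (cases "1 \<le> (norm x)\<^sup>2") (simp_all add: max_def power_mult)
      finally show ?thesis by simp
    qed
    then have "(1 + (norm x)\<^sup>2) ^ ?n * norm (\<phi> x) \<le> 2 ^ ?n * (1 + norm x ^ (2 * ?n)) * norm (\<phi> x)"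
      by (rule mult_right_mono) simp
    also have "\<dots> = 2 ^ ?n * (norm (\<phi> x) + norm x ^ (2 * ?n) * norm (\<phi> x))" by (simp add: algebra_simps)
    also have "\<dots> \<le> 2 ^ ?n * (a + b)" by (intro mult_left_mono add_mono a b) simp
    finally have c: "(1 + (norm x)\<^sup>2) ^ ?n * norm (\<phi> x) \<le> 2 ^ ?n * (a + b)" .
    have pos: "0 < (1 + (norm x)\<^sup>2) ^ ?n" by (intro zero_less_power add_pos_nonneg) auto
    have nn: "0 \<le> 2 ^ ?n * (a + b)"
      using c by (rule order_trans[rotated]) (intro mult_nonneg_nonneg less_imp_le[OF pos] norm_ge_zero)
    have "norm (\<phi> x) \<le> 2 ^ ?n * (a + b) * inverse ((1 + (norm x)\<^sup>2) ^ ?n)"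
      using c pos by (simp add: pos_le_divide_eq mult.commute flip: divide_inverse)
    also have "\<dots> \<le> 2 ^ ?n * (a + b) * decay x" by (rule mult_left_mono[OF decay nn])
    finally show ?thesis .
  qed
  then show ?thesis
  proof (intro Bochner_Integration.integrable_bound[OF integrable_mult_right[OF integrable_decay]])
    fix c assume "\<And>x. norm (\<phi> x) \<le> c * decay x"
    then show "AE x in lborel. norm (\<phi> x) \<le> norm (c * decay x)"
      by (intro AE_I2) (metis abs_ge_self order_trans real_norm_def)
  qed auto
qed

context frequency_decomposition
begin

text \<open>Unfolding the dualities applies to \<open>\<phi>\<close> the inverse transform, the
  multiplier and the transform, in this order. The two normalising constants multiply to
  \<open>inverse CC\<close>, and \<open>conv_pairing\<close> brings the operator back to
  \<open>f'\<close>.\<close>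

lemma box_op_eq:
  assumes p: "1 \<le> p" and v: "borel_version f f'" and fin: "LN p f' < \<infinity>" and \<phi>: "schwartz \<phi>"
  shows "box_op s k f \<phi> = (\<integral>x. conv k f' x * \<phi> x \<partial>lborel)"
proof -
  let ?c = "fourier_const TYPE('n)"
  note i\<phi> = schwartz_integrable[OF \<phi>]
  have [measurable]: "\<phi> \<in> borel_measurable borel" using borel_measurable_integrable[OF i\<phi>] by simp
  note [measurable] = borel_versionD(2)[OF v]
  let ?u = "\<lambda>\<xi>. of_real (s k \<xi>) * inv_fourier \<phi> \<xi>"
  have u: "?u = (\<lambda>\<xi>. of_real (s k \<xi>) * (?c * Etrans \<phi> \<xi>))" by (simp add: inv_fourier_eq_Etrans)
  have [measurable]: "?u \<in> borel_measurable borel" unfolding u by measurable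
  have F: "fourier ?u x = inverse CC * Etrans (\<lambda>\<xi>. of_real (s k \<xi>) * Etrans \<phi> \<xi>) (- x)" for x
  proof -
    have "Etrans ?u (- x) = (\<integral>\<xi>. ?c * (of_real (s k \<xi>) * Etrans \<phi> \<xi> * cis (\<xi> \<bullet> - x)) \<partial>lborel)"
      unfolding u Etrans_def[of _ "- x"] by (simp only: mult_ac)
    also have "\<dots> = ?c * Etrans (\<lambda>\<xi>. of_real (s k \<xi>) * Etrans \<phi> \<xi>) (- x)"
      unfolding Etrans_def[of _ "- x"] by (rule integral_mult_right_zero)
    finally show ?thesis
      using fourier_const_square[where 'n='n] by (simp add: fourier_eq_Etrans CC_def flip: mult.assoc)
  qed
  have "box_op s k f \<phi> = regular_dist f (fourier ?u)"
    by (simp add: box_op_def inv_fourier_dist_def mult_dist_def fourier_dist_def)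
  also have "\<dots> = (\<integral>x. f' x * fourier ?u x \<partial>lborel)"
    by (rule regular_dist_borel_version[OF v]) (simp add: F[abs_def])
  also have "\<dots> = (\<integral>x. inverse CC * (f' x * Etrans (\<lambda>\<xi>. of_real (s k \<xi>) * Etrans \<phi> \<xi>) (- x)) \<partial>lborel)"
    unfolding F by (simp only: mult.left_commute)
  also have "\<dots> = inverse CC * (\<integral>x. f' x * Etrans (\<lambda>\<xi>. of_real (s k \<xi>) * Etrans \<phi> \<xi>) (- x) \<partial>lborel)"
    by (rule integral_mult_right_zero)
  also have "\<dots> = (\<integral>x. conv k f' x * \<phi> x \<partial>lborel)"
    by (rule conv_pairing(1)[OF p _ fin i\<phi>, symmetric]) measurable
  finally show ?thesis .
qed

lemma cutoff_test: "0 < r \<Longrightarrow> (\<lambda>x. complex_of_real (\<rho> (r *\<^sub>R x))) \<in> test_functions"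
proof -
  assume r: "0 < r"
  have "(\<lambda>\<xi>. complex_of_real (\<rho> \<xi>)) \<in> smooth_closure"
    by (intro smooth_closure.smooth smooth_of_real smooth_\<rho>)
  from smooth_closure.affine[OF this, of r 0] have "(\<lambda>x. complex_of_real (\<rho> (r *\<^sub>R x))) \<in> smooth_closure" by simp
  moreover have "\<rho> (r *\<^sub>R x) = 0" if "real CARD('n) / r < norm x" for x
  proof (rule ccontr)
    assume "\<rho> (r *\<^sub>R x) \<noteq> 0"
    then have "norm (r *\<^sub>R x) \<le> real CARD('n) * 1" by (intro norm_le_of_supp \<rho>_supp)
    then show False using that r by (simp add: field_simps)
  qed
  ultimately show ?thesis unfolding test_functions_def by auto
qed

text \<open>A cutoff times a character is a test function, so the cut-off difference of
  \<open>f\<close> and \<open>g\<close> is integrable with vanishing transform, hence 0 almost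
  everywhere.\<close>

lemma AE_eq_of_test_functions:
  fixes f g :: "real ^ 'n \<Rightarrow> complex"
  assumes p: "1 \<le> p" and m[measurable]: "f \<in> borel_measurable borel" "g \<in> borel_measurable borel"
    and fin: "LN p f < \<infinity>" "LN p g < \<infinity>"
    and eq: "\<And>\<phi>. \<phi> \<in> test_functions \<Longrightarrow> (\<integral>x. f x * \<phi> x \<partial>lborel) = (\<integral>x. g x * \<phi> x \<partial>lborel)"
  shows "AE x in lborel. f x = g x"
proof -
  have int: "integrable lborel (\<lambda>x. h x * \<phi> x)"
    if [measurable]: "h \<in> borel_measurable borel" and h: "LN p h < \<infinity>" and \<phi>: "\<phi> \<in> test_functions" for h \<phi>
  proof (rule integrableI_bounded)
    note [measurable] = test_functions_measurable[OF \<phi>]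
    show "(\<lambda>x. h x * \<phi> x) \<in> borel_measurable lborel" by measurable
    obtain b where b: "\<And>x. norm (\<phi> x) \<le> b" using test_functions_bounded[OF \<phi>] by blast
    have "(\<integral>\<^sup>+x. ennreal (norm (h x * \<phi> x)) \<partial>lborel) = (\<integral>\<^sup>+x. ennreal (norm (\<phi> x)) * ennreal (norm (h x)) \<partial>lborel)"
      by (simp add: norm_mult ennreal_mult mult.commute)
    also have "\<dots> \<le> ((\<integral>\<^sup>+x. ennreal (norm (\<phi> x)) \<partial>lborel) + ennreal b) * LN p h"
      unfolding LN_def by (rule nn_integral_mult_le_Lnorm[OF p]) (auto intro: ennreal_leI b)
    also have "\<dots> < \<infinity>"
      using h test_functions_integrable[OF \<phi>] by (simp add: integrable_iff_bounded ennreal_mult_less_top)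
    finally show "(\<integral>\<^sup>+x. ennreal (norm (h x * \<phi> x)) \<partial>lborel) < \<infinity>" .
  qed
  \<comment> \<open>Dilating \<open>\<rho>\<close> by these factors gives cutoffs equal to 1 on
    cubes which exhaust the space.\<close>
  let ?r = "\<lambda>n. 1 / real (Suc n)"
  have "AE x in lborel. (f x - g x) * complex_of_real (\<rho> (?r n *\<^sub>R x)) = 0" for n
  proof (rule Etrans_unique)
    have c: "(\<lambda>x. complex_of_real (\<rho> (?r n *\<^sub>R x))) \<in> test_functions" by (rule cutoff_test) simp
    show "integrable lborel (\<lambda>x. (f x - g x) * complex_of_real (\<rho> (?r n *\<^sub>R x)))"
      unfolding left_diff_distrib by (intro Bochner_Integration.integrable_diff int m fin c)
    fix \<zeta>
    let ?\<phi> = "\<lambda>x. complex_of_real (\<rho> (?r n *\<^sub>R x)) * cis (x \<bullet> \<zeta>)"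
    have \<phi>: "?\<phi> \<in> test_functions" by (intro test_functions_mult c smooth_closure.cis)
    have "Etrans (\<lambda>x. (f x - g x) * complex_of_real (\<rho> (?r n *\<^sub>R x))) \<zeta> = (\<integral>x. f x * ?\<phi> x - g x * ?\<phi> x \<partial>lborel)"
      unfolding Etrans_def by (simp only: left_diff_distrib mult.assoc)
    also have "\<dots> = (\<integral>x. f x * ?\<phi> x \<partial>lborel) - (\<integral>x. g x * ?\<phi> x \<partial>lborel)"
      by (intro Bochner_Integration.integral_diff int m fin \<phi>)
    also have "\<dots> = 0" using eq[OF \<phi>] by simp
    finally show "Etrans (\<lambda>x. (f x - g x) * complex_of_real (\<rho> (?r n *\<^sub>R x))) \<zeta> = 0" .
  qed
  then have "AE x in lborel. \<forall>n. (f x - g x) * complex_of_real (\<rho> (?r n *\<^sub>R x)) = 0"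
    by (simp only: AE_all_countable simp_thms)
  then show ?thesis
  proof eventually_elim
    case (elim x)
    obtain n :: nat where n: "2 * norm x \<le> real n" using real_arch_simple by blast
    have "\<rho> (?r n *\<^sub>R x) = 1"
    proof (rule \<rho>_1)
      fix i
      have "\<bar>x $ i\<bar> \<le> norm x" by (rule component_le_norm_cart)
      then show "\<bar>(?r n *\<^sub>R x) $ i\<bar> \<le> 1 / 2" using n by (simp add: abs_mult field_simps)
    qed
    then show ?case using elim[rule_format, of n] by simp
  qed
qed

text \<open>All functions representing the distribution agree almost everywhere and so have equal
  norms; the infimum runs over a single value, attained by the convolution.\<close>

lemma dist_Lp_norm_box_op:
  assumes p: "1 \<le> p" and v: "borel_version f f'" and fin: "LN p f' < \<infinity>"
  shows "dist_Lp_norm p (box_op s k f) = LN p (conv k f')"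
proof (rule antisym)
  note [measurable] = borel_versionD(2)[OF v]
  have c: "borel_version (conv k f') (conv k f')" by (intro borel_version_refl) measurable
  have cfin: "LN p (conv k f') < \<infinity>" using fin by (intro LN_conv_finite[OF p]) auto
  have "conv k f' \<in> {h \<in> Lp_space p. \<forall>\<phi>. schwartz \<phi> \<longrightarrow> box_op s k f \<phi> = regular_dist h \<phi>}"
  proof (intro CollectI conjI allI impI)
    show "conv k f' \<in> Lp_space p" using Lp_space_iff_borel_version[OF c] cfin by simp
    fix \<phi> :: "real ^ 'n \<Rightarrow> complex" assume \<phi>: "schwartz \<phi>"
    have "\<phi> \<in> borel_measurable borel" using borel_measurable_integrable[OF schwartz_integrable[OF \<phi>]] by simp
    then show "box_op s k f \<phi> = regular_dist (conv k f') \<phi>"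
      using box_op_eq[OF p v fin \<phi>] regular_dist_borel_version[OF c] by simp
  qed
  then have "dist_Lp_norm p (box_op s k f) \<le> Lp_norm p (conv k f')"
    unfolding dist_Lp_norm_def by (rule INF_lower)
  then show "dist_Lp_norm p (box_op s k f) \<le> LN p (conv k f')" using Lp_norm_borel_version[OF c] by simp
  show "LN p (conv k f') \<le> dist_Lp_norm p (box_op s k f)"
    unfolding dist_Lp_norm_def
  proof (rule INF_greatest)
    fix h assume h: "h \<in> {h \<in> Lp_space p. \<forall>\<phi>. schwartz \<phi> \<longrightarrow> box_op s k f \<phi> = regular_dist h \<phi>}"
    then obtain h' where h': "borel_version h h'" "LN p h' < \<infinity>" using Lp_space_borel_version by blast
    note [measurable] = borel_versionD(2)[OF h'(1)]
    have "AE x in lborel. conv k f' x = h' x"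
    proof (rule AE_eq_of_test_functions[OF p _ _ cfin h'(2)])
      fix \<phi> :: "real ^ 'n \<Rightarrow> complex" assume \<phi>: "\<phi> \<in> test_functions"
      then show "(\<integral>x. conv k f' x * \<phi> x \<partial>lborel) = (\<integral>x. h' x * \<phi> x \<partial>lborel)"
        using h test_functions_schwartz[OF \<phi>] box_op_eq[OF p v fin, of \<phi> k]
          regular_dist_borel_version[OF h'(1) test_functions_measurable[OF \<phi>]] by auto
    qed measurable
    then have "AE x in lborel. ennreal (norm (conv k f' x)) = ennreal (norm (h' x))" by eventually_elim simp
    then have "LN p (conv k f') = LN p h'" unfolding LN_def by (intro Lnorm_cong_AE) auto
    then show "LN p (conv k f') \<le> Lp_norm p h" using Lp_norm_borel_version[OF h'(1)] by simp
  qed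
qed

text \<open>For counting measure the essential supremum is the supremum, so finite and infinite
  \<open>q\<close> merge into one norm over the lattice.\<close>

lemma modulation_norm_eq:
  assumes p: "1 \<le> p" and q: "1 \<le> q" and v: "borel_version f f'" and fin: "LN p f' < \<infinity>"
  shows "modulation_norm s w p q f = Lnorm cs q (\<lambda>k. ennreal (exp (w (norm (lattice_point k)))) * LN p (conv k f'))"
proof (cases "q = \<infinity>")
  case True
  have "esssup cs F = (SUP k. F k)" for F :: "int ^ 'n \<Rightarrow> ennreal"
  proof (rule antisym)
    show "esssup cs F \<le> (SUP k. F k)" by (rule esssup_I) (auto simp: AE_count_space intro: SUP_upper)
    show "(SUP k. F k) \<le> esssup cs F" using esssup_AE[of F cs] by (auto simp: AE_count_space intro: SUP_least)
  qed
  then show ?thesis using True by (simp add: modulation_norm_def Lnorm_def dist_Lp_norm_box_op[OF p v fin])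
next
  case False
  have r: "0 < enn2real q" using enn2real_ge_1[OF q False] by simp
  have "ennreal (exp (enn2real q * w t)) = ennreal_powr (ennreal (exp (w t))) (enn2real q)" for t
    by (simp add: ennreal_powr_ennreal powr_def mult.commute)
  then show ?thesis using False r
    by (simp add: modulation_norm_def Lnorm_def dist_Lp_norm_box_op[OF p v fin] ennreal_powr_mult
        infsum_conv_nn_integral[OF countable_UNIV_int_vec])
qed

end

section \<open>The product estimate\<close>

text \<open>Minkowski's integral inequality over a measure space of two points.\<close>

lemma Lnorm_add_le:
  assumes p: "1 \<le> p" and M: "sigma_finite_measure M"
    and [measurable]: "F \<in> borel_measurable M" "G \<in> borel_measurable M"
  shows "Lnorm M p (\<lambda>x. F x + G x) \<le> Lnorm M p F + Lnorm M p G"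
proof -
  let ?N = "count_space (UNIV :: bool set)"
  have sum: "(\<integral>\<^sup>+b. H b \<partial>?N) = H True + H False" for H :: "bool \<Rightarrow> ennreal"
    by (simp add: nn_integral_count_space_finite UNIV_bool add.commute)
  have "Lnorm M p (\<lambda>x. \<integral>\<^sup>+b. (if b then F x else G x) \<partial>?N)
      \<le> (\<integral>\<^sup>+b. (if b then Lnorm M p F else Lnorm M p G) \<partial>?N)"
  proof (rule Lnorm_integral_le[OF p M])
    show "sigma_finite_measure ?N" by (rule sigma_finite_measure_count_space_countable) simp
    show "(\<lambda>(b, x). if b then F x else G x) \<in> borel_measurable (?N \<Otimes>\<^sub>M M)"
      by (rule measurable_pair_measure_countable1) auto
  qed auto
  then show ?thesis by (simp add: sum)
qed

lemma LN_add_le: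
  assumes "1 \<le> p" and [measurable]: "f \<in> borel_measurable borel" "g \<in> borel_measurable borel"
  shows "LN p (\<lambda>x. f x + g x) \<le> LN p f + LN p g"
proof -
  have "LN p (\<lambda>x. f x + g x) \<le> Lnorm lborel p (\<lambda>x. ennreal (norm (f x)) + ennreal (norm (g x)))"
    unfolding LN_def using norm_triangle_ineq
    by (intro Lnorm_mono_AE[OF assms(1)]) (auto simp flip: ennreal_plus)
  also have "\<dots> \<le> LN p f + LN p g"
    unfolding LN_def by (intro Lnorm_add_le[OF assms(1) sigma_finite_lborel]) auto
  finally show ?thesis .
qed

lemma LN_cmult_le:
  assumes "1 \<le> p" and [measurable]: "f \<in> borel_measurable borel"
  shows "LN p (\<lambda>x. c * f x) \<le> ennreal (norm c) * LN p f"
  unfolding LN_def norm_mult by (simp add: ennreal_mult) (rule Lnorm_cmult[OF assms(1)], measurable)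

lemma LN_mult_le:
  assumes "1 \<le> p1" "1 \<le> p2" "1 \<le> p" "1 / p = 1 / p1 + 1 / p2"
    and [measurable]: "f \<in> borel_measurable borel" "g \<in> borel_measurable borel"
  shows "LN p (\<lambda>x. f x * g x) \<le> LN p1 f * LN p2 g"
  unfolding LN_def norm_mult by (simp add: ennreal_mult) (rule Lnorm_Hoelder[OF assms(1-4)], measurable)

context frequency_decomposition
begin

text \<open>Convolution with the indicator of a cube; it carries the slack of 3 left by the
  frequency localisation of products.\<close>

definition near_sum :: "(int ^ 'n \<Rightarrow> ennreal) \<Rightarrow> int ^ 'n \<Rightarrow> ennreal" where
  "near_sum a m = (\<integral>\<^sup>+k. indicator (lattice_cube 3) (m - k) * a k \<partial>cs)"

lemma Lnorm_cs_translate: "Lnorm cs q (\<lambda>j. F (j - m)) = Lnorm cs q F"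
  by (rule Lnorm_count_space_bij) (rule bij_betwI[of _ _ _ "\<lambda>j. j + m"], auto)

definition overlap :: ennreal where "overlap = (\<integral>\<^sup>+k. indicator (lattice_cube 3) k \<partial>cs)"

lemma overlap_finite: "overlap < \<infinity>"
  by (simp add: overlap_def nn_integral_indicator[of _ cs] of_nat_less_top)

lemma measurable_cs2: "(F :: (int ^ 'n) \<times> (int ^ 'n) \<Rightarrow> ennreal) \<in> borel_measurable (cs \<Otimes>\<^sub>M cs)"
  by (rule measurable_pair_measure_countable1[OF countable_UNIV_int_vec]) simp

text \<open>Young's inequality on the lattice, with the indicator of the cube as the summable
  factor.\<close>

lemma Lnorm_near_sum_le:
  assumes q: "1 \<le> q"
  shows "Lnorm cs q (near_sum a) \<le> overlap * Lnorm cs q a"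
proof -
  have "near_sum a m = (\<integral>\<^sup>+r. indicator (lattice_cube 3) r * a (m - r) \<partial>cs)" for m
  proof -
    have "bij (\<lambda>r. m - r)" by (rule bij_betwI[of _ _ _ "\<lambda>r. m - r"]) auto
    from nn_integral_bij_count_space[OF this, of "\<lambda>k. indicator (lattice_cube 3) (m - k) * a k"]
    show ?thesis by (simp add: near_sum_def)
  qed
  then have "Lnorm cs q (near_sum a) = Lnorm cs q (\<lambda>m. \<integral>\<^sup>+r. indicator (lattice_cube 3) r * a (m - r) \<partial>cs)"
    by presburger
  also have "\<dots> \<le> (\<integral>\<^sup>+r. indicator (lattice_cube 3) r * Lnorm cs q a \<partial>cs)"
  proof (rule Lnorm_integral_le[OF q sigma_finite_cs sigma_finite_cs])
    fix r :: "int ^ 'n"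
    have "Lnorm cs q (\<lambda>x. indicator (lattice_cube 3) r * a (x - r)) \<le> indicator (lattice_cube 3) r * Lnorm cs q (\<lambda>x. a (x - r))"
      by (rule Lnorm_cmult[OF q]) simp
    then show "Lnorm cs q (\<lambda>x. indicator (lattice_cube 3) r * a (x - r)) \<le> indicator (lattice_cube 3) r * Lnorm cs q a"
      by (simp only: Lnorm_cs_translate)
  qed (simp_all add: measurable_cs2)
  also have "\<dots> = overlap * Lnorm cs q a"
    by (simp add: overlap_def nn_integral_multc)
  finally show ?thesis .
qed

text \<open>The values of \<open>b\<close> are bounded by its norm in the sequence space, so that
  the summable \<open>c\<close> alone plays the role of the \<open>l^1\<close> factor.\<close>

lemma Lnorm_weighted_near_sum_le:
  assumes q: "1 \<le> q"
  shows "Lnorm cs q (\<lambda>j. \<integral>\<^sup>+l. (b l * c l) * near_sum a (j - l) \<partial>cs)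
     \<le> (\<integral>\<^sup>+l. c l \<partial>cs) * overlap * Lnorm cs q a * Lnorm cs q b"
proof -
  have "Lnorm cs q (\<lambda>j. \<integral>\<^sup>+l. (b l * c l) * near_sum a (j - l) \<partial>cs)
      \<le> (\<integral>\<^sup>+l. c l * (overlap * Lnorm cs q a * Lnorm cs q b) \<partial>cs)"
  proof (rule Lnorm_integral_le[OF q sigma_finite_cs sigma_finite_cs])
    fix l :: "int ^ 'n"
    have "Lnorm cs q (\<lambda>j. (b l * c l) * near_sum a (j - l)) \<le> (b l * c l) * Lnorm cs q (\<lambda>j. near_sum a (j - l))"
      by (rule Lnorm_cmult[OF q]) simp
    also have "\<dots> = (b l * c l) * Lnorm cs q (near_sum a)" by (simp only: Lnorm_cs_translate)
    also have "\<dots> \<le> (Lnorm cs q b * c l) * (overlap * Lnorm cs q a)"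
      by (intro mult_mono Lnorm_near_sum_le[OF q] le_Lnorm_count_space[OF q]) auto
    finally show "Lnorm cs q (\<lambda>j. (b l * c l) * near_sum a (j - l)) \<le> c l * (overlap * Lnorm cs q a * Lnorm cs q b)"
      by (simp add: mult_ac)
  qed (simp_all add: measurable_cs2)
  then show ?thesis by (subst (asm) nn_integral_multc) (simp_all add: mult_ac)
qed

definition weight :: "(real \<Rightarrow> real) \<Rightarrow> int ^ 'n \<Rightarrow> ennreal" where
  "weight w k = ennreal (exp (w (norm (lattice_point k))))"

text \<open>By almost subadditivity of the weight, the larger of the frequencies \<open>k\<close> and \<open>l\<close> absorbs the full weight
  of their sum, up to a factor which leaves summable decay in the smaller one.\<close>

lemma weighted_Young:
  assumes w: "w \<in> weight_class"
  obtains D where "D < \<infinity>"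
    "\<And>q a b. 1 \<le> q \<Longrightarrow>
      Lnorm cs q (\<lambda>j. weight w j * (\<integral>\<^sup>+k. \<integral>\<^sup>+l. indicator (lattice_cube 3) (j - k - l) * (a k * b l) \<partial>cs \<partial>cs))
      \<le> D * Lnorm cs q (\<lambda>k. weight w k * a k) * Lnorm cs q (\<lambda>k. weight w k * b k)"
proof -
  \<comment> \<open>A vector with entries of modulus at most 3 has norm at most
    \<open>3 n\<close>.\<close>
  define R where "R = real CARD('n) * 3"
  have "0 \<le> R" by (simp add: R_def)
  from weight_class_almost_subadditive[OF w this] obtain c C where c: "0 \<le> c" "c < 1" "0 \<le> C"
    and sub: "\<And>x y. 0 \<le> y \<Longrightarrow> y \<le> x \<Longrightarrow> w (x + y + R) \<le> w x + c * w y + C" by metis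
  have mono: "w x \<le> w y" if "0 \<le> x" "x \<le> y" for x y
    using w that by (cases "x = y") (auto simp: weight_class_def strict_mono_on_def less_imp_le)
  define n where "n k = norm (lattice_point k)" for k :: "int ^ 'n"
  \<comment> \<open>The gain at the smaller frequency, which carries \<open>exp (c * w)\<close>
    instead of \<open>exp w\<close>. It is summable because \<open>1 - c > 0\<close>.\<close>
  define \<gamma> where "\<gamma> k = ennreal (exp (- (1 - c) * w (n k)))" for k
  define \<Gamma> where "\<Gamma> = (\<integral>\<^sup>+k. \<gamma> k \<partial>cs)"
  have \<Gamma>: "\<Gamma> < \<infinity>" unfolding \<Gamma>_def \<gamma>_def n_def using c by (intro weight_class_summable[OF w]) simp
  have key: "weight w j \<le> ennreal (exp C) * (weight w k * (weight w l * \<gamma> l))"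
    if near: "j - k - l \<in> lattice_cube 3" and le: "n l \<le> n k" for j k l
  proof -
    have "n j \<le> n k + n l + R"
    proof -
      have eq: "lattice_point j = lattice_point k + lattice_point l + lattice_point (j - k - l)"
        by (simp add: lattice_point_diff)
      have R: "norm (lattice_point (j - k - l)) \<le> R" unfolding R_def
      proof (rule norm_le_of_supp)
        fix i
        have "\<bar>(j - k - l) $ i\<bar> \<le> 3" using near by (simp add: lattice_cube_def)
        then show "\<bar>lattice_point (j - k - l) $ i\<bar> \<le> 3" by (simp only: lattice_point_nth)
      qed
      have "n j \<le> norm (lattice_point k + lattice_point l) + norm (lattice_point (j - k - l))"
        unfolding n_def by (subst eq) (rule norm_triangle_ineq)
      then show ?thesis using norm_triangle_ineq[of "lattice_point k" "lattice_point l"] R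
        unfolding n_def by linarith
    qed
    then have "w (n j) \<le> w (n k + n l + R)" by (intro mono) (simp_all add: n_def)
    also have "\<dots> \<le> w (n k) + c * w (n l) + C" using le by (intro sub) (simp_all add: n_def)
    finally have "exp (w (n j)) \<le> exp (C + (w (n k) + (w (n l) + - (1 - c) * w (n l))))"
      by (simp add: algebra_simps)
    also have "\<dots> = exp C * (exp (w (n k)) * (exp (w (n l)) * exp (- (1 - c) * w (n l))))"
      by (simp only: exp_add)
    finally show ?thesis
      by (simp only: weight_def \<gamma>_def n_def ennreal_mult[symmetric] exp_ge_zero mult_nonneg_nonneg ennreal_leI)
  qed
  \<comment> \<open>The 2 counts the regions in which \<open>k\<close> or \<open>l\<close> is the
    larger frequency.\<close>
  define D where "D = ennreal (exp C) * (2 * (\<Gamma> * overlap))"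
  have Dfin: "D < \<infinity>" using \<Gamma> overlap_finite by (simp add: D_def ennreal_mult_less_top)
  have "Lnorm cs q (\<lambda>j. weight w j * (\<integral>\<^sup>+k. \<integral>\<^sup>+l. indicator (lattice_cube 3) (j - k - l) * (a k * b l) \<partial>cs \<partial>cs))
      \<le> D * Lnorm cs q (\<lambda>k. weight w k * a k) * Lnorm cs q (\<lambda>k. weight w k * b k)"
    if q: "1 \<le> q" for q a b
  proof -
    define \<alpha> where "\<alpha> k = weight w k * a k" for k
    define \<beta> where "\<beta> k = weight w k * b k" for k
    let ?I = "\<lambda>j k l. indicator (lattice_cube 3) (j - k - l) :: ennreal"
    \<comment> \<open>\<open>?S\<close> majorises the region \<open>n l \<le> n k\<close> and
      \<open>?T\<close> the opposite one, after the full weights have been distributed to both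
      sequences.\<close>
    let ?S = "\<lambda>j. \<integral>\<^sup>+l. (\<beta> l * \<gamma> l) * near_sum \<alpha> (j - l) \<partial>cs"
    let ?T = "\<lambda>j. \<integral>\<^sup>+k. (\<alpha> k * \<gamma> k) * near_sum \<beta> (j - k) \<partial>cs"
    have pw: "weight w j * (\<integral>\<^sup>+k. \<integral>\<^sup>+l. ?I j k l * (a k * b l) \<partial>cs \<partial>cs) \<le> ennreal (exp C) * (?S j + ?T j)" for j
    proof -
      have "weight w j * (\<integral>\<^sup>+k. \<integral>\<^sup>+l. ?I j k l * (a k * b l) \<partial>cs \<partial>cs)
          = (\<integral>\<^sup>+k. \<integral>\<^sup>+l. weight w j * (?I j k l * (a k * b l)) \<partial>cs \<partial>cs)"
        by (simp add: nn_integral_cmult)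
      also have "\<dots> \<le> (\<integral>\<^sup>+k. \<integral>\<^sup>+l. ennreal (exp C) * (?I j k l * (\<alpha> k * (\<beta> l * \<gamma> l)) + ?I j k l * (\<beta> l * (\<alpha> k * \<gamma> k))) \<partial>cs \<partial>cs)"
      proof (intro nn_integral_mono)
        fix k l
        show "weight w j * (?I j k l * (a k * b l))
          \<le> ennreal (exp C) * (?I j k l * (\<alpha> k * (\<beta> l * \<gamma> l)) + ?I j k l * (\<beta> l * (\<alpha> k * \<gamma> k)))"
        proof (cases "j - k - l \<in> lattice_cube 3")
          case True
          show ?thesis
          proof (cases "n l \<le> n k")
            case le: True
            have "weight w j * (a k * b l) \<le> ennreal (exp C) * (weight w k * (weight w l * \<gamma> l)) * (a k * b l)"
              by (rule mult_right_mono[OF key[OF True le]]) simp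
            also have "\<dots> = ennreal (exp C) * (\<alpha> k * (\<beta> l * \<gamma> l))" by (simp add: \<alpha>_def \<beta>_def mult_ac)
            also have "\<dots> \<le> ennreal (exp C) * (\<alpha> k * (\<beta> l * \<gamma> l) + \<beta> l * (\<alpha> k * \<gamma> k))"
              by (intro mult_left_mono) auto
            finally show ?thesis using True by simp
          next
            case False
            have "j - l - k \<in> lattice_cube 3" using True by (simp add: algebra_simps)
            from key[OF this] False
            have "weight w j * (a k * b l) \<le> ennreal (exp C) * (weight w l * (weight w k * \<gamma> k)) * (a k * b l)"
              by (intro mult_right_mono) auto
            also have "\<dots> = ennreal (exp C) * (\<beta> l * (\<alpha> k * \<gamma> k))" by (simp add: \<alpha>_def \<beta>_def mult_ac)
            also have "\<dots> \<le> ennreal (exp C) * (\<alpha> k * (\<beta> l * \<gamma> l) + \<beta> l * (\<alpha> k * \<gamma> k))"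
              by (intro mult_left_mono) auto
            finally show ?thesis using True by simp
          qed
        qed simp
      qed
      also have "\<dots> = ennreal (exp C) * ((\<integral>\<^sup>+k. \<integral>\<^sup>+l. ?I j k l * (\<alpha> k * (\<beta> l * \<gamma> l)) \<partial>cs \<partial>cs)
          + (\<integral>\<^sup>+k. \<integral>\<^sup>+l. ?I j k l * (\<beta> l * (\<alpha> k * \<gamma> k)) \<partial>cs \<partial>cs))"
        by (simp add: nn_integral_cmult nn_integral_add)
      also have "(\<integral>\<^sup>+k. \<integral>\<^sup>+l. ?I j k l * (\<alpha> k * (\<beta> l * \<gamma> l)) \<partial>cs \<partial>cs)
          = (\<integral>\<^sup>+l. \<integral>\<^sup>+k. ?I j k l * (\<alpha> k * (\<beta> l * \<gamma> l)) \<partial>cs \<partial>cs)"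
        by (rule Fubini_nn_integral_swap[OF sigma_finite_cs sigma_finite_cs measurable_cs2])
      also have "\<dots> = ?S j"
      proof (intro nn_integral_cong)
        fix l
        have "(\<integral>\<^sup>+k. ?I j k l * (\<alpha> k * (\<beta> l * \<gamma> l)) \<partial>cs) = (\<integral>\<^sup>+k. (\<beta> l * \<gamma> l) * (indicator (lattice_cube 3) (j - l - k) * \<alpha> k) \<partial>cs)"
          by (intro nn_integral_cong) (simp add: mult_ac algebra_simps)
        then show "(\<integral>\<^sup>+k. ?I j k l * (\<alpha> k * (\<beta> l * \<gamma> l)) \<partial>cs) = (\<beta> l * \<gamma> l) * near_sum \<alpha> (j - l)"
          by (simp add: near_sum_def nn_integral_cmult)
      qed
      also have "(\<integral>\<^sup>+k. \<integral>\<^sup>+l. ?I j k l * (\<beta> l * (\<alpha> k * \<gamma> k)) \<partial>cs \<partial>cs) = ?T j"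
      proof (intro nn_integral_cong)
        fix k
        have "(\<integral>\<^sup>+l. ?I j k l * (\<beta> l * (\<alpha> k * \<gamma> k)) \<partial>cs) = (\<integral>\<^sup>+l. (\<alpha> k * \<gamma> k) * (?I j k l * \<beta> l) \<partial>cs)"
          by (intro nn_integral_cong) (simp add: mult_ac)
        then show "(\<integral>\<^sup>+l. ?I j k l * (\<beta> l * (\<alpha> k * \<gamma> k)) \<partial>cs) = (\<alpha> k * \<gamma> k) * near_sum \<beta> (j - k)"
          by (simp add: near_sum_def nn_integral_cmult)
      qed
      finally show ?thesis .
    qed
    have "Lnorm cs q (\<lambda>j. weight w j * (\<integral>\<^sup>+k. \<integral>\<^sup>+l. ?I j k l * (a k * b l) \<partial>cs \<partial>cs))
        \<le> Lnorm cs q (\<lambda>j. ennreal (exp C) * (?S j + ?T j))"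
      using pw by (intro Lnorm_mono_AE[OF q]) auto
    also have "\<dots> \<le> ennreal (exp C) * Lnorm cs q (\<lambda>j. ?S j + ?T j)" by (rule Lnorm_cmult[OF q]) simp
    also have "\<dots> \<le> ennreal (exp C) * (Lnorm cs q ?S + Lnorm cs q ?T)"
      by (intro mult_left_mono Lnorm_add_le[OF q sigma_finite_cs]) auto
    also have "\<dots> \<le> ennreal (exp C) * (\<Gamma> * overlap * Lnorm cs q \<alpha> * Lnorm cs q \<beta> + \<Gamma> * overlap * Lnorm cs q \<beta> * Lnorm cs q \<alpha>)"
      unfolding \<Gamma>_def by (intro mult_left_mono add_mono Lnorm_weighted_near_sum_le[OF q]) simp
    also have "\<dots> = D * Lnorm cs q \<alpha> * Lnorm cs q \<beta>"
      by (simp only: D_def mult_2 distrib_left distrib_right mult_ac)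
    finally show ?thesis unfolding \<alpha>_def \<beta>_def .
  qed
  with Dfin show ?thesis by (rule that)
qed

section \<open>Products of functions\<close>

definition mod_norm :: "(real \<Rightarrow> real) \<Rightarrow> ennreal \<Rightarrow> ennreal \<Rightarrow> (real ^ 'n \<Rightarrow> complex) \<Rightarrow> ennreal" where
  "mod_norm w p q f = Lnorm cs q (\<lambda>k. weight w k * LN p (conv k f))"

text \<open>Each piece has norm at most \<open>exp (- w)\<close> times the modulation norm, and
  \<open>exp (- w)\<close> is summable over the lattice; this works alike for all
  \<open>q\<close>.\<close>

lemma sum_LN_conv_finite:
  assumes w: "w \<in> weight_class" and q: "1 \<le> q" and fin: "mod_norm w p q f < \<infinity>"
  shows "(\<integral>\<^sup>+k. LN p (conv k f) \<partial>cs) < \<infinity>"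
proof -
  let ?e = "\<lambda>k::int ^ 'n. ennreal (exp (- 1 * w (norm (lattice_point k))))"
  have "LN p (conv k f) \<le> ?e k * mod_norm w p q f" for k
  proof -
    have "?e k * weight w k = 1" by (simp add: weight_def ennreal_mult[symmetric] exp_minus)
    then have "LN p (conv k f) = ?e k * (weight w k * LN p (conv k f))" by (simp add: mult.assoc[symmetric])
    also have "\<dots> \<le> ?e k * mod_norm w p q f"
      unfolding mod_norm_def by (intro mult_left_mono le_Lnorm_count_space[OF q]) simp
    finally show ?thesis .
  qed
  then have "(\<integral>\<^sup>+k. LN p (conv k f) \<partial>cs) \<le> (\<integral>\<^sup>+k. ?e k * mod_norm w p q f \<partial>cs)"
    by (intro nn_integral_mono)
  also have "\<dots> = (\<integral>\<^sup>+k. ?e k \<partial>cs) * mod_norm w p q f" by (simp add: nn_integral_multc)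
  also have "\<dots> < \<infinity>" using fin weight_class_summable[OF w, of 1, where 'n='n] by (simp add: ennreal_mult_less_top)
  finally show ?thesis .
qed

text \<open>The series of \<open>f\<close> is inserted first and the one of \<open>g\<close>
  afterwards, with the fixed piece \<open>conv k f\<close> as cofactor; each time summation and
  integration are exchanged.\<close>

lemma conv_product_eq_series:
  assumes p: "1 \<le> p1" "1 \<le> p2" "1 \<le> p" "1 / p = 1 / p1 + 1 / p2"
    and m[measurable]: "f \<in> borel_measurable borel" "g \<in> borel_measurable borel"
    and fin: "LN p1 f < \<infinity>" "LN p2 g < \<infinity>"
    and sum: "(\<integral>\<^sup>+k. LN p1 (conv k f) \<partial>cs) < \<infinity>" "(\<integral>\<^sup>+k. LN p2 (conv k g) \<partial>cs) < \<infinity>"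
  shows "conv j (\<lambda>y. f y * g y) x
     = (\<integral>k. \<integral>l. (\<integral>y. conv k f y * (conv l g y * kernel j (x - y)) \<partial>lborel) \<partial>cs \<partial>cs)"
proof -
  have fs: "AE y in lborel. f y = (\<integral>k. conv k f y \<partial>cs)" by (rule conv_series[OF p(1) m(1) fin(1) sum(1)])
  have gs: "AE y in lborel. g y = (\<integral>k. conv k g y \<partial>cs)" by (rule conv_series[OF p(2) m(2) fin(2) sum(2)])
  have S: "Lnorm lborel p1 (conv_sum f) < \<infinity>" "Lnorm lborel p2 (conv_sum g) < \<infinity>"
    using Lnorm_conv_sum_le[OF p(1) m(1)] Lnorm_conv_sum_le[OF p(2) m(2)] sum by (auto elim: le_less_trans)
  \<comment> \<open>Absolute convergence for both exchanges: Hoelder puts \<open>F * G\<close> into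
    \<open>L^p\<close>, and its convolution with \<open>|K|\<close> is then finite at every
    point.\<close>
  have fin_abs: "(\<integral>\<^sup>+y. F y * (G y * ennreal (norm (K (x - y)))) \<partial>lborel) < \<infinity>"
    if [measurable]: "F \<in> borel_measurable borel" "G \<in> borel_measurable borel"
      and "Lnorm lborel p1 F < \<infinity>" "Lnorm lborel p2 G < \<infinity>" for F G
  proof -
    have "(\<integral>\<^sup>+y. F y * (G y * ennreal (norm (K (x - y)))) \<partial>lborel) = absconv (\<lambda>y. F y * G y) x"
      by (simp add: absconv_def mult.assoc)
    also have "\<dots> \<le> A * Lnorm lborel p (\<lambda>y. F y * G y)" by (intro absconv_le[OF p(3)]) measurable
    also have "\<dots> \<le> A * (Lnorm lborel p1 F * Lnorm lborel p2 G)"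
      by (intro mult_left_mono Lnorm_Hoelder[OF p]) auto
    also have "\<dots> < \<infinity>" using that A_finite by (simp add: ennreal_mult_less_top)
    finally show ?thesis .
  qed
  have mf: "(\<lambda>y. \<integral>k. conv k f y \<partial>cs) \<in> borel_measurable lborel" "(\<lambda>y. \<integral>k. conv k g y \<partial>cs) \<in> borel_measurable lborel"
    using conv_cs_measurable(2)[OF m(1)] conv_cs_measurable(2)[OF m(2)] by simp_all
  note [measurable] = mf
  have "conv j (\<lambda>y. f y * g y) x = (\<integral>y. (\<integral>k. conv k f y \<partial>cs) * (g y * kernel j (x - y)) \<partial>lborel)"
    unfolding conv_def[of j]
  proof (rule integral_cong_AE)
    show "AE y in lborel. f y * g y * kernel j (x - y) = (\<integral>k. conv k f y \<partial>cs) * (g y * kernel j (x - y))"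
      using fs by eventually_elim (simp add: mult.assoc)
  qed measurable
  also have "\<dots> = (\<integral>y. \<integral>k. conv k f y * (g y * kernel j (x - y)) \<partial>cs \<partial>lborel)"
    by (subst integral_mult_left_zero) (rule refl)
  also have "\<dots> = (\<integral>k. \<integral>y. conv k f y * (g y * kernel j (x - y)) \<partial>lborel \<partial>cs)"
  proof (rule Fubini_count_space[OF countable_UNIV_int_vec sigma_finite_lborel])
    have "(\<integral>\<^sup>+y. \<integral>\<^sup>+k. ennreal (norm (conv k f y * (g y * kernel j (x - y)))) \<partial>cs \<partial>lborel)
        = (\<integral>\<^sup>+y. conv_sum f y * (ennreal (norm (g y)) * ennreal (norm (K (x - y)))) \<partial>lborel)"
      by (simp add: norm_mult ennreal_mult nn_integral_multc conv_sum_def)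
    also have "\<dots> < \<infinity>" using S fin by (intro fin_abs) (auto simp: LN_def)
    finally show "(\<integral>\<^sup>+y. \<integral>\<^sup>+k. ennreal (norm (conv k f y * (g y * kernel j (x - y)))) \<partial>cs \<partial>lborel) < \<infinity>" .
  qed measurable
  also have "\<dots> = (\<integral>k. \<integral>l. (\<integral>y. conv k f y * (conv l g y * kernel j (x - y)) \<partial>lborel) \<partial>cs \<partial>cs)"
  proof (intro Bochner_Integration.integral_cong refl)
    fix k
    have kfin: "LN p1 (conv k f) < \<infinity>" by (rule LN_conv_finite[OF p(1) m(1) fin(1)])
    have "(\<integral>y. conv k f y * (g y * kernel j (x - y)) \<partial>lborel)
        = (\<integral>y. (\<integral>l. conv l g y \<partial>cs) * (conv k f y * kernel j (x - y)) \<partial>lborel)"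
    proof (rule integral_cong_AE)
      show "AE y in lborel. conv k f y * (g y * kernel j (x - y)) = (\<integral>l. conv l g y \<partial>cs) * (conv k f y * kernel j (x - y))"
        using gs by eventually_elim (simp add: mult_ac)
    qed measurable
    also have "\<dots> = (\<integral>y. \<integral>l. conv l g y * (conv k f y * kernel j (x - y)) \<partial>cs \<partial>lborel)"
      by (subst integral_mult_left_zero) (rule refl)
    also have "\<dots> = (\<integral>l. \<integral>y. conv l g y * (conv k f y * kernel j (x - y)) \<partial>lborel \<partial>cs)"
    proof (rule Fubini_count_space[OF countable_UNIV_int_vec sigma_finite_lborel])
      have "(\<integral>\<^sup>+y. \<integral>\<^sup>+l. ennreal (norm (conv l g y * (conv k f y * kernel j (x - y)))) \<partial>cs \<partial>lborel)
          = (\<integral>\<^sup>+y. ennreal (norm (conv k f y)) * (conv_sum g y * ennreal (norm (K (x - y)))) \<partial>lborel)"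
        by (simp add: norm_mult ennreal_mult nn_integral_multc conv_sum_def mult.left_commute)
      also have "\<dots> < \<infinity>" using S kfin by (intro fin_abs) (auto simp: LN_def)
      finally show "(\<integral>\<^sup>+y. \<integral>\<^sup>+l. ennreal (norm (conv l g y * (conv k f y * kernel j (x - y)))) \<partial>cs \<partial>lborel) < \<infinity>" .
    qed measurable
    finally show "(\<integral>y. conv k f y * (g y * kernel j (x - y)) \<partial>lborel)
        = (\<integral>l. (\<integral>y. conv k f y * (conv l g y * kernel j (x - y)) \<partial>lborel) \<partial>cs)"
      by (simp only: mult.left_commute)
  qed
  finally show ?thesis .
qed

text \<open>Only pairs of frequencies with \<open>j - k - l\<close> in the cube survive. Their
  contributions are majorised pointwise by \<open>absconv\<close>, Minkowski takes the norm inside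
  both sums, and Young and Hoelder bound each term.\<close>

lemma LN_conv_product_le:
  assumes p: "1 \<le> p1" "1 \<le> p2" "1 \<le> p" "1 / p = 1 / p1 + 1 / p2"
    and m[measurable]: "f \<in> borel_measurable borel" "g \<in> borel_measurable borel"
    and fin: "LN p1 f < \<infinity>" "LN p2 g < \<infinity>"
    and sum: "(\<integral>\<^sup>+k. LN p1 (conv k f) \<partial>cs) < \<infinity>" "(\<integral>\<^sup>+k. LN p2 (conv k g) \<partial>cs) < \<infinity>"
  shows "LN p (conv j (\<lambda>y. f y * g y))
     \<le> \<kappa> * (\<integral>\<^sup>+k. \<integral>\<^sup>+l. indicator (lattice_cube 3) (j - k - l) * (LN p1 (conv k f) * LN p2 (conv l g)) \<partial>cs \<partial>cs)"
proof -
  let ?I = "\<lambda>k l. indicator (lattice_cube 3) (j - k - l) :: ennreal"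
  let ?G = "\<lambda>k l y. ennreal (norm (conv k f y)) * ennreal (norm (conv l g y))"
  have G [measurable]: "?G k l \<in> borel_measurable borel" for k l by measurable
  have pw: "ennreal (norm (conv j (\<lambda>y. f y * g y) x)) \<le> (\<integral>\<^sup>+k. \<integral>\<^sup>+l. ?I k l * absconv (?G k l) x \<partial>cs \<partial>cs)" for x
  proof -
    let ?V = "\<lambda>k l. (\<integral>y. conv k f y * (conv l g y * kernel j (x - y)) \<partial>lborel)"
    have "ennreal (norm (conv j (\<lambda>y. f y * g y) x)) \<le> (\<integral>\<^sup>+k. ennreal (norm (\<integral>l. ?V k l \<partial>cs)) \<partial>cs)"
      unfolding conv_product_eq_series[OF p m fin sum] by (rule norm_integral_le_nn)
    also have "\<dots> \<le> (\<integral>\<^sup>+k. \<integral>\<^sup>+l. ennreal (norm (?V k l)) \<partial>cs \<partial>cs)"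
      by (intro nn_integral_mono norm_integral_le_nn)
    also have "\<dots> \<le> (\<integral>\<^sup>+k. \<integral>\<^sup>+l. ?I k l * absconv (?G k l) x \<partial>cs \<partial>cs)"
    proof (intro nn_integral_mono)
      fix k l
      show "ennreal (norm (?V k l)) \<le> ?I k l * absconv (?G k l) x"
      proof (cases "j - k - l \<in> lattice_cube 3")
        case True
        have "ennreal (norm (?V k l)) \<le> (\<integral>\<^sup>+y. ennreal (norm (conv k f y * (conv l g y * kernel j (x - y)))) \<partial>lborel)"
          by (rule norm_integral_le_nn)
        also have "\<dots> = absconv (?G k l) x" by (simp add: absconv_def norm_mult ennreal_mult mult.assoc)
        finally show ?thesis using True by simp
      next
        case False
        then show ?thesis using conv_product_localized[OF p(1,2) m fin False] by simp
      qed
    qed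
    finally show ?thesis .
  qed
  have inner_m: "(\<lambda>x. \<integral>\<^sup>+l. ?I k l * absconv (?G k l) x \<partial>cs) \<in> borel_measurable lborel" for k
  proof -
    interpret cs: sigma_finite_measure cs by (rule sigma_finite_cs)
    have "(\<lambda>(l, x). ?I k l * absconv (?G k l) x) \<in> borel_measurable (cs \<Otimes>\<^sub>M lborel)"
      by (rule case_prod_cs_measurable) measurable
    then have "(\<lambda>(x, l). ?I k l * absconv (?G k l) x) \<in> borel_measurable (lborel \<Otimes>\<^sub>M cs)"
      by (subst (asm) measurable_pair_swap_iff) (simp add: split_beta')
    then show ?thesis by (rule cs.borel_measurable_nn_integral)
  qed
  have "LN p (conv j (\<lambda>y. f y * g y)) \<le> Lnorm lborel p (\<lambda>x. \<integral>\<^sup>+k. \<integral>\<^sup>+l. ?I k l * absconv (?G k l) x \<partial>cs \<partial>cs)"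
    unfolding LN_def using pw by (intro Lnorm_mono_AE[OF p(3)]) auto
  also have "\<dots> \<le> (\<integral>\<^sup>+k. \<integral>\<^sup>+l. ?I k l * (\<kappa> * (LN p1 (conv k f) * LN p2 (conv l g))) \<partial>cs \<partial>cs)"
  proof (rule Lnorm_integral_le[OF p(3) sigma_finite_lborel sigma_finite_cs])
    show "(\<lambda>(k, x). \<integral>\<^sup>+l. ?I k l * absconv (?G k l) x \<partial>cs) \<in> borel_measurable (cs \<Otimes>\<^sub>M lborel)"
      by (rule case_prod_cs_measurable) (rule inner_m)
    fix k
    show "Lnorm lborel p (\<lambda>x. \<integral>\<^sup>+l. ?I k l * absconv (?G k l) x \<partial>cs)
        \<le> (\<integral>\<^sup>+l. ?I k l * (\<kappa> * (LN p1 (conv k f) * LN p2 (conv l g))) \<partial>cs)"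
    proof (rule Lnorm_integral_le[OF p(3) sigma_finite_lborel sigma_finite_cs])
      show "(\<lambda>(l, x). ?I k l * absconv (?G k l) x) \<in> borel_measurable (cs \<Otimes>\<^sub>M lborel)"
        by (rule case_prod_cs_measurable) measurable
      fix l
      have "Lnorm lborel p (\<lambda>x. ?I k l * absconv (?G k l) x) \<le> ?I k l * Lnorm lborel p (absconv (?G k l))"
        by (rule Lnorm_cmult[OF p(3)]) measurable
      also have "\<dots> \<le> ?I k l * (\<kappa> * Lnorm lborel p (?G k l))"
        by (intro mult_left_mono absconv_Young[OF p(3)]) auto
      also have "\<dots> \<le> ?I k l * (\<kappa> * (LN p1 (conv k f) * LN p2 (conv l g)))"
        unfolding LN_def by (intro mult_left_mono Lnorm_Hoelder[OF p]) auto
      finally show "Lnorm lborel p (\<lambda>x. ?I k l * absconv (?G k l) x) \<le> ?I k l * (\<kappa> * (LN p1 (conv k f) * LN p2 (conv l g)))" .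
    qed simp
  qed simp
  also have "\<dots> = \<kappa> * (\<integral>\<^sup>+k. \<integral>\<^sup>+l. ?I k l * (LN p1 (conv k f) * LN p2 (conv l g)) \<partial>cs \<partial>cs)"
    by (simp add: nn_integral_cmult mult.left_commute[of _ \<kappa>])
  finally show ?thesis .
qed

text \<open>The constant is \<open>\<kappa>\<close> times that of the sequence inequality, both
  fixed before any exponent is chosen.\<close>

lemma mod_norm_product:
  assumes w: "w \<in> weight_class"
  obtains D where "D < \<infinity>"
    "\<And>p1 p2 p q f g. 1 \<le> p1 \<Longrightarrow> 1 \<le> p2 \<Longrightarrow> 1 \<le> p \<Longrightarrow> 1 / p = 1 / p1 + 1 / p2 \<Longrightarrow> 1 \<le> q \<Longrightarrow>
      f \<in> borel_measurable borel \<Longrightarrow> g \<in> borel_measurable borel \<Longrightarrow> LN p1 f < \<infinity> \<Longrightarrow> LN p2 g < \<infinity> \<Longrightarrow>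
      mod_norm w p1 q f < \<infinity> \<Longrightarrow> mod_norm w p2 q g < \<infinity> \<Longrightarrow>
      mod_norm w p q (\<lambda>x. f x * g x) \<le> D * mod_norm w p1 q f * mod_norm w p2 q g"
proof -
  obtain D where D: "D < \<infinity>" and Y: "\<And>q a b. 1 \<le> q \<Longrightarrow>
      Lnorm cs q (\<lambda>j. weight w j * (\<integral>\<^sup>+k. \<integral>\<^sup>+l. indicator (lattice_cube 3) (j - k - l) * (a k * b l) \<partial>cs \<partial>cs))
      \<le> D * Lnorm cs q (\<lambda>k. weight w k * a k) * Lnorm cs q (\<lambda>k. weight w k * b k)"
    using weighted_Young[OF w] by blast
  show ?thesis
  proof
    show "\<kappa> * D < \<infinity>" using D \<kappa>_finite by (simp add: ennreal_mult_less_top)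
    fix p1 p2 p q :: ennreal and f g :: "real ^ 'n \<Rightarrow> complex"
    assume p: "1 \<le> p1" "1 \<le> p2" "1 \<le> p" "1 / p = 1 / p1 + 1 / p2" and q: "1 \<le> q"
      and m: "f \<in> borel_measurable borel" "g \<in> borel_measurable borel"
      and fin: "LN p1 f < \<infinity>" "LN p2 g < \<infinity>"
      and M: "mod_norm w p1 q f < \<infinity>" "mod_norm w p2 q g < \<infinity>"
    let ?P = "\<lambda>j. \<integral>\<^sup>+k. \<integral>\<^sup>+l. indicator (lattice_cube 3) (j - k - l) * (LN p1 (conv k f) * LN p2 (conv l g)) \<partial>cs \<partial>cs"
    have "mod_norm w p q (\<lambda>x. f x * g x) \<le> Lnorm cs q (\<lambda>j. \<kappa> * (weight w j * ?P j))"
      unfolding mod_norm_def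
    proof (rule Lnorm_mono_AE[OF q])
      show "AE j in cs. weight w j * LN p (conv j (\<lambda>x. f x * g x)) \<le> \<kappa> * (weight w j * ?P j)"
      proof (rule AE_I2)
        fix j
        have "weight w j * LN p (conv j (\<lambda>x. f x * g x)) \<le> weight w j * (\<kappa> * ?P j)"
          by (intro mult_left_mono LN_conv_product_le[OF p m fin] sum_LN_conv_finite[OF w q] M) simp
        then show "weight w j * LN p (conv j (\<lambda>x. f x * g x)) \<le> \<kappa> * (weight w j * ?P j)"
          by (simp only: mult.left_commute)
      qed
    qed simp
    also have "\<dots> \<le> \<kappa> * Lnorm cs q (\<lambda>j. weight w j * ?P j)" by (rule Lnorm_cmult[OF q]) simp
    also have "\<dots> \<le> \<kappa> * (D * mod_norm w p1 q f * mod_norm w p2 q g)"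
      unfolding mod_norm_def by (intro mult_left_mono Y[OF q]) simp
    finally show "mod_norm w p q (\<lambda>x. f x * g x) \<le> \<kappa> * D * mod_norm w p1 q f * mod_norm w p2 q g"
      by (simp only: mult.assoc)
  qed
qed

end

section \<open>Modulation spaces\<close>

lemma borel_version_mult:
  "borel_version f f' \<Longrightarrow> borel_version g g' \<Longrightarrow> borel_version (\<lambda>x. f x * g x) (\<lambda>x. f' x * g' x)"
  unfolding borel_version_def by (auto elim: AE_mp)

lemma borel_version_add:
  "borel_version f f' \<Longrightarrow> borel_version g g' \<Longrightarrow> borel_version (\<lambda>x. f x + g x) (\<lambda>x. f' x + g' x)"
  unfolding borel_version_def by (auto elim: AE_mp)

lemma LN_zero: "1 \<le> p \<Longrightarrow> LN p (\<lambda>x. 0) = 0"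
  using Lnorm_0_iff[of p "\<lambda>x. 0" lborel] by (simp add: LN_def)

context frequency_decomposition
begin

lemma modulation_norm_eq_mod_norm:
  assumes "1 \<le> p" "1 \<le> q" "borel_version f f'" "LN p f' < \<infinity>"
  shows "modulation_norm s w p q f = mod_norm w p q f'"
  unfolding modulation_norm_eq[OF assms] mod_norm_def weight_def ..

lemma modulation_spaceE:
  assumes "1 \<le> p" "1 \<le> q" "f \<in> modulation_space s w p q"
  obtains f' where "borel_version f f'" "f' \<in> borel_measurable borel" "LN p f' < \<infinity>"
    "mod_norm w p q f' < \<infinity>" "modulation_norm s w p q f = mod_norm w p q f'"
proof -
  have f: "f \<in> Lp_space p" "modulation_norm s w p q f < \<infinity>"
    using assms(3) by (auto simp: modulation_space_def)
  obtain f' where v: "borel_version f f'" "LN p f' < \<infinity>" using Lp_space_borel_version[OF f(1)] by blast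
  note eq = modulation_norm_eq_mod_norm[OF assms(1,2) v, of w]
  from v(1) borel_versionD(2)[OF v(1)] v(2) f(2)[unfolded eq] eq show ?thesis by (rule that)
qed

lemma modulation_spaceI:
  assumes "1 \<le> p" "1 \<le> q" "borel_version f f'" "LN p f' < \<infinity>" "mod_norm w p q f' < \<infinity>"
  shows "f \<in> modulation_space s w p q"
  using assms modulation_norm_eq_mod_norm[OF assms(1-4), of w] Lp_space_iff_borel_version[OF assms(3)]
  by (simp add: modulation_space_def)

lemma modulation_space_product:
  assumes w: "w \<in> weight_class" and q: "1 \<le> q"
  obtains C :: real where "0 < C"
    "\<And>p1 p2 p f g. 1 \<le> p1 \<Longrightarrow> 1 \<le> p2 \<Longrightarrow> 1 / p = 1 / p1 + 1 / p2 \<Longrightarrow> 1 \<le> p \<Longrightarrow>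
      f \<in> modulation_space s w p1 q \<Longrightarrow> g \<in> modulation_space s w p2 q \<Longrightarrow>
      (\<lambda>x. f x * g x) \<in> modulation_space s w p q \<and>
      modulation_norm s w p q (\<lambda>x. f x * g x)
        \<le> ennreal C * modulation_norm s w p1 q f * modulation_norm s w p2 q g"
proof -
  obtain D where D: "D < \<infinity>" and prod: "\<And>p1 p2 p q f g. 1 \<le> p1 \<Longrightarrow> 1 \<le> p2 \<Longrightarrow> 1 \<le> p \<Longrightarrow>
      1 / p = 1 / p1 + 1 / p2 \<Longrightarrow> 1 \<le> q \<Longrightarrow>
      f \<in> borel_measurable borel \<Longrightarrow> g \<in> borel_measurable borel \<Longrightarrow> LN p1 f < \<infinity> \<Longrightarrow> LN p2 g < \<infinity> \<Longrightarrow>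
      mod_norm w p1 q f < \<infinity> \<Longrightarrow> mod_norm w p2 q g < \<infinity> \<Longrightarrow>
      mod_norm w p q (\<lambda>x. f x * g x) \<le> D * mod_norm w p1 q f * mod_norm w p2 q g"
    using mod_norm_product[OF w] by blast
  \<comment> \<open>\<open>D\<close> may be 0, and the constant has to be a positive real.\<close>
  define C where "C = enn2real D + 1"
  have C: "0 < C" by (simp add: C_def add_nonneg_pos)
  have "D = ennreal (enn2real D)" using D by simp
  also have "\<dots> \<le> ennreal C" unfolding C_def by (intro ennreal_leI) simp
  finally have DC: "D \<le> ennreal C" .
  show ?thesis
  proof (rule that[OF C])
    fix p1 p2 p :: ennreal and f g :: "real ^ 'n \<Rightarrow> complex"
    assume p: "1 \<le> p1" "1 \<le> p2" "1 / p = 1 / p1 + 1 / p2" "1 \<le> p"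
      and f: "f \<in> modulation_space s w p1 q" and g: "g \<in> modulation_space s w p2 q"
    obtain f' where f': "borel_version f f'" "f' \<in> borel_measurable borel" "LN p1 f' < \<infinity>"
      "mod_norm w p1 q f' < \<infinity>" "modulation_norm s w p1 q f = mod_norm w p1 q f'"
      using modulation_spaceE[OF p(1) q f] by blast
    obtain g' where g': "borel_version g g'" "g' \<in> borel_measurable borel" "LN p2 g' < \<infinity>"
      "mod_norm w p2 q g' < \<infinity>" "modulation_norm s w p2 q g = mod_norm w p2 q g'"
      using modulation_spaceE[OF p(2) q g] by blast
    note v = borel_version_mult[OF f'(1) g'(1)]
    have "LN p (\<lambda>x. f' x * g' x) \<le> LN p1 f' * LN p2 g'"
      by (rule LN_mult_le[OF p(1,2,4,3) f'(2) g'(2)])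
    also have "\<dots> < \<infinity>" using f'(3) g'(3) by (simp add: ennreal_mult_less_top)
    finally have fin: "LN p (\<lambda>x. f' x * g' x) < \<infinity>" .
    have "mod_norm w p q (\<lambda>x. f' x * g' x) \<le> D * mod_norm w p1 q f' * mod_norm w p2 q g'"
      by (rule prod[OF p(1,2,4,3) q f'(2) g'(2) f'(3) g'(3) f'(4) g'(4)])
    also have "\<dots> \<le> ennreal C * mod_norm w p1 q f' * mod_norm w p2 q g'"
      by (intro mult_right_mono DC) auto
    finally have le: "mod_norm w p q (\<lambda>x. f' x * g' x) \<le> ennreal C * mod_norm w p1 q f' * mod_norm w p2 q g'" .
    also have "\<dots> < \<infinity>" using f'(4) g'(4) by (simp add: ennreal_mult_less_top)
    finally have "(\<lambda>x. f x * g x) \<in> modulation_space s w p q"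
      by (rule modulation_spaceI[OF p(4) q v fin])
    then show "(\<lambda>x. f x * g x) \<in> modulation_space s w p q \<and>
      modulation_norm s w p q (\<lambda>x. f x * g x)
        \<le> ennreal C * modulation_norm s w p1 q f * modulation_norm s w p2 q g"
      using le modulation_norm_eq_mod_norm[OF p(4) q v fin, of w] by (simp only: f'(5) g'(5) simp_thms)
  qed
qed

text \<open>Membership in the space with exponent \<infinity> asks that \<open>f\<close> itself be
  bounded, not only its pieces. The reconstruction series reduces this to Bernstein's inequality for
  the pieces.\<close>

lemma LN_infinity_finite:
  assumes p: "1 \<le> p" and m[measurable]: "f \<in> borel_measurable borel" and fin: "LN p f < \<infinity>"
    and sum: "(\<integral>\<^sup>+k. LN p (conv k f) \<partial>cs) < \<infinity>"
  shows "LN \<infinity> f < \<infinity>"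
proof -
  let ?c = "of_nat (card (lattice_cube 2 :: (int ^ 'n) set)) * A"
  have "AE y in lborel. ennreal (norm (f y)) \<le> conv_sum f y"
    using conv_series[OF p m fin sum]
  proof eventually_elim
    case (elim y)
    show ?case unfolding conv_sum_def by (subst elim) (rule norm_integral_le_nn)
  qed
  then have "LN \<infinity> f \<le> Lnorm lborel \<infinity> (conv_sum f)" unfolding LN_def by (intro Lnorm_mono_AE) auto
  also have "\<dots> \<le> (\<integral>\<^sup>+k. LN \<infinity> (conv k f) \<partial>cs)" by (rule Lnorm_conv_sum_le) auto
  also have "\<dots> \<le> (\<integral>\<^sup>+k. ?c * LN p (conv k f) \<partial>cs)" by (intro nn_integral_mono Bernstein[OF p m fin])
  also have "\<dots> = ?c * (\<integral>\<^sup>+k. LN p (conv k f) \<partial>cs)" by (simp add: nn_integral_cmult)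
  also have "\<dots> < \<infinity>" using sum A_finite by (simp add: ennreal_mult_less_top of_nat_less_top)
  finally show ?thesis .
qed

text \<open>The algebra property is the product estimate for the exponents \<open>p\<close> and \<open>\<infinity>\<close>, combined with this
  embedding, which rests on Bernstein's inequality for the band-limited pieces.\<close>

lemma modulation_space_embed_infinity:
  assumes w: "w \<in> weight_class" and p: "1 \<le> p" and q: "1 \<le> q"
  obtains C :: real where "0 < C"
    "\<And>f. f \<in> modulation_space s w p q \<Longrightarrow>
      f \<in> modulation_space s w \<infinity> q \<and> modulation_norm s w \<infinity> q f \<le> ennreal C * modulation_norm s w p q f"
proof -
  define c where "c = of_nat (card (lattice_cube 2 :: (int ^ 'n) set)) * A"
  have cfin: "c < \<infinity>" using A_finite by (simp add: c_def ennreal_mult_less_top of_nat_less_top)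
  define C where "C = enn2real c + 1"
  have C: "0 < C" by (simp add: C_def add_nonneg_pos)
  have "c = ennreal (enn2real c)" using cfin by simp
  also have "\<dots> \<le> ennreal C" unfolding C_def by (intro ennreal_leI) simp
  finally have cC: "c \<le> ennreal C" .
  show ?thesis
  proof (rule that[OF C])
    fix f assume f: "f \<in> modulation_space s w p q"
    obtain f' where f': "borel_version f f'" "f' \<in> borel_measurable borel" "LN p f' < \<infinity>"
      "mod_norm w p q f' < \<infinity>" "modulation_norm s w p q f = mod_norm w p q f'"
      using modulation_spaceE[OF p q f] by blast
    have i: "(1::ennreal) \<le> \<infinity>" by simp
    have fin: "LN \<infinity> f' < \<infinity>"
      by (rule LN_infinity_finite[OF p f'(2,3) sum_LN_conv_finite[OF w q f'(4)]])
    have "mod_norm w \<infinity> q f' \<le> Lnorm cs q (\<lambda>k. ennreal C * (weight w k * LN p (conv k f')))"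
      unfolding mod_norm_def
    proof (rule Lnorm_mono_AE[OF q])
      show "AE k in cs. weight w k * LN \<infinity> (conv k f') \<le> ennreal C * (weight w k * LN p (conv k f'))"
      proof (rule AE_I2)
        fix k
        have "LN \<infinity> (conv k f') \<le> c * LN p (conv k f')" unfolding c_def by (rule Bernstein[OF p f'(2,3)])
        also have "\<dots> \<le> ennreal C * LN p (conv k f')" by (intro mult_right_mono cC) simp
        finally have "weight w k * LN \<infinity> (conv k f') \<le> weight w k * (ennreal C * LN p (conv k f'))"
          by (rule mult_left_mono) simp
        then show "weight w k * LN \<infinity> (conv k f') \<le> ennreal C * (weight w k * LN p (conv k f'))"
          by (simp only: mult.left_commute)
      qed
    qed simp
    also have "\<dots> \<le> ennreal C * mod_norm w p q f'"
      unfolding mod_norm_def by (rule Lnorm_cmult[OF q]) simp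
    finally have le: "mod_norm w \<infinity> q f' \<le> ennreal C * mod_norm w p q f'" .
    also have "\<dots> < \<infinity>" using f'(4) by (simp add: ennreal_mult_less_top)
    finally have "f \<in> modulation_space s w \<infinity> q" by (rule modulation_spaceI[OF i q f'(1) fin])
    then show "f \<in> modulation_space s w \<infinity> q \<and> modulation_norm s w \<infinity> q f \<le> ennreal C * modulation_norm s w p q f"
      using le modulation_norm_eq_mod_norm[OF i q f'(1) fin, of w] by (simp only: f'(5) simp_thms)
  qed
qed

section \<open>Linear structure and the algebra property\<close>

lemma conv_zero: "conv k (\<lambda>x. 0) = (\<lambda>x. 0)"
  by (simp add: conv_def[abs_def])

lemma conv_cmult: "conv k (\<lambda>x. c * f x) = (\<lambda>x. c * conv k f x)"
  unfolding conv_def[abs_def] by (simp only: mult.assoc integral_mult_right_zero)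

lemma conv_add:
  assumes p: "1 \<le> p" and m: "f \<in> borel_measurable borel" "g \<in> borel_measurable borel"
    and fin: "LN p f < \<infinity>" "LN p g < \<infinity>"
  shows "conv k (\<lambda>x. f x + g x) = (\<lambda>x. conv k f x + conv k g x)"
proof
  fix x
  show "conv k (\<lambda>x. f x + g x) x = conv k f x + conv k g x"
    unfolding conv_def distrib_right
    by (rule Bochner_Integration.integral_add[OF integrable_mult_kernel[OF p m(1) fin(1)] integrable_mult_kernel[OF p m(2) fin(2)]])
qed

lemma modulation_space_zero:
  assumes "1 \<le> p" "1 \<le> q"
  shows "(\<lambda>x. 0) \<in> modulation_space s w p q"
proof (rule modulation_spaceI[OF assms borel_version_refl])
  show "LN p (\<lambda>x :: real ^ 'n. 0) < \<infinity>" by (simp add: LN_zero[OF assms(1)])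
  show "mod_norm w p q (\<lambda>x. 0) < \<infinity>"
    using Lnorm_0_iff[OF assms(2), of "\<lambda>k. 0" cs] by (simp add: mod_norm_def conv_zero LN_zero[OF assms(1)])
qed simp

lemma modulation_space_add:
  assumes p: "1 \<le> p" and q: "1 \<le> q" and f: "f \<in> modulation_space s w p q" and g: "g \<in> modulation_space s w p q"
  shows "(\<lambda>x. f x + g x) \<in> modulation_space s w p q"
proof -
  obtain f' where f': "borel_version f f'" and mf: "f' \<in> borel_measurable borel" "LN p f' < \<infinity>" "mod_norm w p q f' < \<infinity>"
    using modulation_spaceE[OF p q f] by blast
  obtain g' where g': "borel_version g g'" and mg: "g' \<in> borel_measurable borel" "LN p g' < \<infinity>" "mod_norm w p q g' < \<infinity>"
    using modulation_spaceE[OF p q g] by blast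
  note [measurable] = mf(1) mg(1)
  show ?thesis
  proof (rule modulation_spaceI[OF p q borel_version_add[OF f' g']])
    have "LN p (\<lambda>x. f' x + g' x) \<le> LN p f' + LN p g'" by (rule LN_add_le[OF p mf(1) mg(1)])
    also have "\<dots> < \<infinity>" using mf(2) mg(2) by simp
    finally show "LN p (\<lambda>x. f' x + g' x) < \<infinity>" .
    have "mod_norm w p q (\<lambda>x. f' x + g' x)
        \<le> Lnorm cs q (\<lambda>k. weight w k * LN p (conv k f') + weight w k * LN p (conv k g'))"
      unfolding mod_norm_def conv_add[OF p mf(1) mg(1) mf(2) mg(2)] distrib_left[symmetric]
    proof (rule Lnorm_mono_AE[OF q])
      have "LN p (\<lambda>x. conv k f' x + conv k g' x) \<le> LN p (conv k f') + LN p (conv k g')" for k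
        by (rule LN_add_le[OF p]) measurable
      then show "AE k in cs. weight w k * LN p (\<lambda>x. conv k f' x + conv k g' x)
          \<le> weight w k * (LN p (conv k f') + LN p (conv k g'))"
        by (intro AE_I2 mult_left_mono) simp_all
    qed simp
    also have "\<dots> \<le> mod_norm w p q f' + mod_norm w p q g'"
      unfolding mod_norm_def by (intro Lnorm_add_le[OF q sigma_finite_cs]) simp_all
    also have "\<dots> < \<infinity>" using mf(3) mg(3) by simp
    finally show "mod_norm w p q (\<lambda>x. f' x + g' x) < \<infinity>" .
  qed
qed

lemma modulation_space_cmult:
  assumes p: "1 \<le> p" and q: "1 \<le> q" and f: "f \<in> modulation_space s w p q"
  shows "(\<lambda>x. c * f x) \<in> modulation_space s w p q"
proof -
  obtain f' where f': "borel_version f f'" and mf: "f' \<in> borel_measurable borel" "LN p f' < \<infinity>" "mod_norm w p q f' < \<infinity>"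
    using modulation_spaceE[OF p q f] by blast
  note [measurable] = mf(1)
  have "borel_version (\<lambda>x. c) (\<lambda>x. c)" by (rule borel_version_refl) simp
  note v = borel_version_mult[OF this f']
  show ?thesis
  proof (rule modulation_spaceI[OF p q v])
    have "LN p (\<lambda>x. c * f' x) \<le> ennreal (norm c) * LN p f'" by (rule LN_cmult_le[OF p mf(1)])
    also have "\<dots> < \<infinity>" using mf(2) by (simp add: ennreal_mult_less_top)
    finally show "LN p (\<lambda>x. c * f' x) < \<infinity>" .
    have "mod_norm w p q (\<lambda>x. c * f' x) \<le> Lnorm cs q (\<lambda>k. ennreal (norm c) * (weight w k * LN p (conv k f')))"
      unfolding mod_norm_def conv_cmult
    proof (rule Lnorm_mono_AE[OF q])
      have "weight w k * LN p (\<lambda>x. c * conv k f' x) \<le> weight w k * (ennreal (norm c) * LN p (conv k f'))" for k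
        by (intro mult_left_mono LN_cmult_le[OF p]) measurable
      then show "AE k in cs. weight w k * LN p (\<lambda>x. c * conv k f' x) \<le> ennreal (norm c) * (weight w k * LN p (conv k f'))"
        by (intro AE_I2) (simp only: mult.left_commute)
    qed simp
    also have "\<dots> \<le> ennreal (norm c) * mod_norm w p q f'"
      unfolding mod_norm_def by (rule Lnorm_cmult[OF q]) simp
    also have "\<dots> < \<infinity>" using mf(3) by (simp add: ennreal_mult_less_top)
    finally show "mod_norm w p q (\<lambda>x. c * f' x) < \<infinity>" .
  qed
qed

lemma modulation_space_algebra:
  assumes w: "w \<in> weight_class" and p: "1 \<le> p" and q: "1 \<le> q"
  shows "pointwise_algebra (modulation_space s w p q) (modulation_norm s w p q)"
proof -
  obtain C1 where C1: "0 < C1" and emb: "\<And>f. f \<in> modulation_space s w p q \<Longrightarrow>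
      f \<in> modulation_space s w \<infinity> q \<and> modulation_norm s w \<infinity> q f \<le> ennreal C1 * modulation_norm s w p q f"
    using modulation_space_embed_infinity[OF w p q] by blast
  obtain C2 where C2: "0 < C2" and prod: "\<And>p1 p2 p f g. 1 \<le> p1 \<Longrightarrow> 1 \<le> p2 \<Longrightarrow> 1 / p = 1 / p1 + 1 / p2 \<Longrightarrow> 1 \<le> p \<Longrightarrow>
      f \<in> modulation_space s w p1 q \<Longrightarrow> g \<in> modulation_space s w p2 q \<Longrightarrow>
      (\<lambda>x. f x * g x) \<in> modulation_space s w p q \<and>
      modulation_norm s w p q (\<lambda>x. f x * g x)
        \<le> ennreal C2 * modulation_norm s w p1 q f * modulation_norm s w p2 q g"
    using modulation_space_product[OF w q] by blast
  have mult: "(\<lambda>x. f x * g x) \<in> modulation_space s w p q \<and>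
      modulation_norm s w p q (\<lambda>x. f x * g x) \<le> ennreal (C2 * C1) * modulation_norm s w p q f * modulation_norm s w p q g"
    if f: "f \<in> modulation_space s w p q" and g: "g \<in> modulation_space s w p q" for f g
  proof -
    \<comment> \<open>The reciprocal of \<infinity> is 0, so \<open>p\<close> and \<infinity> are
      admissible exponents with product exponent \<open>p\<close>.\<close>
    have e: "1 / p = 1 / p + 1 / \<infinity>" by (simp add: divide_ennreal_def)
    have i: "(1::ennreal) \<le> \<infinity>" by simp
    note pr = prod[OF p i e p f conjunct1[OF emb[OF g]]]
    note conjunct2[OF pr]
    also have "ennreal C2 * modulation_norm s w p q f * modulation_norm s w \<infinity> q g
        \<le> ennreal C2 * modulation_norm s w p q f * (ennreal C1 * modulation_norm s w p q g)"
      by (intro mult_left_mono conjunct2[OF emb[OF g]]) simp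
    also have "\<dots> = ennreal (C2 * C1) * modulation_norm s w p q f * modulation_norm s w p q g"
      using C1 C2 by (simp add: ennreal_mult mult_ac)
    finally show ?thesis using conjunct1[OF pr] by blast
  qed
  moreover have "0 < C2 * C1" using C1 C2 by simp
  ultimately show ?thesis
    unfolding pointwise_algebra_def
    using modulation_space_zero[OF p q] modulation_space_add[OF p q] modulation_space_cmult[OF p q] by blast
qed

end

theorem theorem4p2:
  fixes s :: "int ^ 'n \<Rightarrow> real ^ 'n \<Rightarrow> real" and w :: "real \<Rightarrow> real" and q :: ennreal
  assumes "freq_uniform_decomposition s"
    and "w \<in> weight_class"
    and "1 \<le> q"
  shows "(\<exists>C::real. C > 0 \<and>
           (\<forall>(p1::ennreal) (p2::ennreal) (p::ennreal) f g.
              1 \<le> p1 \<longrightarrow> 1 \<le> p2 \<longrightarrow> 1 / p = 1 / p1 + 1 / p2 \<longrightarrow> 1 \<le> p \<longrightarrow>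
              f \<in> modulation_space s w p1 q \<longrightarrow> g \<in> modulation_space s w p2 q \<longrightarrow>
              (\<lambda>x. f x * g x) \<in> modulation_space s w p q \<and>
              modulation_norm s w p q (\<lambda>x. f x * g x)
                \<le> ennreal C * modulation_norm s w p1 q f * modulation_norm s w p2 q g)) \<and>
         (\<forall>p::ennreal. 1 \<le> p \<longrightarrow>
            pointwise_algebra (modulation_space s w p q) (modulation_norm s w p q))"
  proof -
  obtain \<rho> where "frequency_decomposition s \<rho>"
    using assms(1) unfolding freq_uniform_decomposition_def frequency_decomposition_def by blast
  then interpret frequency_decomposition s \<rho> .
  show ?thesis
  proof
    obtain C where "0 < C" and "\<And>p1 p2 p f g. 1 \<le> p1 \<Longrightarrow> 1 \<le> p2 \<Longrightarrow> 1 / p = 1 / p1 + 1 / p2 \<Longrightarrow> 1 \<le> p \<Longrightarrow>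
      f \<in> modulation_space s w p1 q \<Longrightarrow> g \<in> modulation_space s w p2 q \<Longrightarrow>
      (\<lambda>x. f x * g x) \<in> modulation_space s w p q \<and>
      modulation_norm s w p q (\<lambda>x. f x * g x)
        \<le> ennreal C * modulation_norm s w p1 q f * modulation_norm s w p2 q g"
      using modulation_space_product[OF assms(2,3)] by blast
    then show "\<exists>C::real. C > 0 \<and>
           (\<forall>(p1::ennreal) (p2::ennreal) (p::ennreal) f g.
              1 \<le> p1 \<longrightarrow> 1 \<le> p2 \<longrightarrow> 1 / p = 1 / p1 + 1 / p2 \<longrightarrow> 1 \<le> p \<longrightarrow>
              f \<in> modulation_space s w p1 q \<longrightarrow> g \<in> modulation_space s w p2 q \<longrightarrow>
              (\<lambda>x. f x * g x) \<in> modulation_space s w p q \<and>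
              modulation_norm s w p q (\<lambda>x. f x * g x)
                \<le> ennreal C * modulation_norm s w p1 q f * modulation_norm s w p2 q g)"
      by blast
    show "\<forall>p::ennreal. 1 \<le> p \<longrightarrow>
            pointwise_algebra (modulation_space s w p q) (modulation_norm s w p q)"
      using modulation_space_algebra[OF assms(2) _ assms(3)] by blast
  qed
qed

end
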